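(* Let $G$ be an lctd group and $P<G$ a closed subgroup. Let $\mathcal{X}$ and $\mathcal{O}$ be lctd spaces on which $G$ acts continuously, and let $p:\mathcal{X}\to\mathcal{O}$ be a $G$-equivariant continuous surjection. Assume: (i) $G$ acts transitively on $\mathcal{O}$; (ii) there is a non-zero $G$-invariant distribution on $\mathcal{O}$; (iii) there are finitely many $P$-orbits in $\mathcal{O}$. Suppose there exist an element $x\in\mathcal{O}$ and an open $P$-orbit $\mathcal{U}\subset\mathcal{O}$ containing $x$ such that: (iv) $\mathcal{D}(p^{-1}(x))^{Stab(P,x)}=\mathcal{D}(p^{-1}(x))^{Stab(G,x)}$; (v) for every $y\in\mathcal{O}\setminus\mathcal{U}$, $\mathcal{D}(p^{-1}(y))^{Stab(P,y),\,\Delta_{P/Stab(P,y)}^{-1}}=\{0\}$. Then $\mathcal{D}(\mathcal{X})^{P}=\mathcal{D}(\mathcal{X})^{G}$.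
   Context: "lctd" means locally compact totally disconnected. For an lctd space $X$, $\mathcal{S}(X)$ is the space of locally constant compactly supported complex functions on $X$ and $\mathcal{D}(X)$, the space of distributions, is its linear dual. A continuous left action of a group $G$ on $X$ induces an action on $\mathcal{S}(X)$ by $(g\cdot f)(x)=f(g^{-1}\cdot x)$ and the dual action on $\mathcal{D}(X)$. For a group $G$ acting linearly on a complex vector space $V$ and a character $\chi$ of $G$ (with values in $\mathbb{C}^\times$), $V^{G,\chi}=\{v\in V: g\cdot v=\chi(g)v\ \forall g\in G\}$ and $V^G=V^{G,1}$. $Stab(H,x)$ is the stabilizer of $x$ in the group $H$. $\Delta_G$ is the modular character of an lctd group $G$, normalized by $\mu(Eg)=\Delta_G(g)\mu(E)$ for a left Haar measure $\mu$ (so that the group of matrices in $\mathbf{GL}_n(F)$, $F$ a $p$-adic field, with bottom row $(0,\ldots,0,1)$ has modular character $|\det|^{-1}$). For a closed subgroup $H<G$, $\Delta_{G/H}=\Delta_G|_H\,\Delta_H^{-1}$, a character of $H$.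
   Formalization: The formal theorem additionally assumes that G is σ-compact (countable at infinity); without this the claim is false, e.g. for a large discrete group acting transitively on the square of the split real line, with P of index two omitting the coordinate swap. *)

theory Defs
  imports "HOL-Analysis.Analysis" "HOL-Algebra.Group_Action"
begin

section \<open>Locally compact totally disconnected spaces and groups\<close>

definition totally_disconnected_space :: "'a topology \<Rightarrow> bool" where
  "totally_disconnected_space X \<longleftrightarrow> (\<forall>S. connectedin X S \<longrightarrow> (\<exists>a. S \<subseteq> {a}))"

text \<open>As usual for these spaces, the Hausdorff property is part of the notion.\<close>

definition lctd_space :: "'a topology \<Rightarrow> bool" where
  "lctd_space X \<longleftrightarrow>
     Hausdorff_space X \<and> locally_compact_space X \<and> totally_disconnected_space X"

definition sigma_compact_space :: "'a topology \<Rightarrow> bool" where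
  "sigma_compact_space X \<longleftrightarrow>
     (\<exists>K :: nat \<Rightarrow> 'a set. (\<forall>n. compactin X (K n)) \<and> topspace X = (\<Union>n. K n))"

definition topological_group :: "('g, 'm) monoid_scheme \<Rightarrow> 'g topology \<Rightarrow> bool" where
  "topological_group G T \<longleftrightarrow>
     group G \<and> topspace T = carrier G \<and>
     continuous_map (prod_topology T T) T (\<lambda>(g, h). g \<otimes>\<^bsub>G\<^esub> h) \<and>
     continuous_map T T (\<lambda>g. inv\<^bsub>G\<^esub> g)"

definition lctd_group :: "('g, 'm) monoid_scheme \<Rightarrow> 'g topology \<Rightarrow> bool" where
  "lctd_group G T \<longleftrightarrow> topological_group G T \<and> lctd_space T"

abbreviation restrict_group ::
    "('g, 'm) monoid_scheme \<Rightarrow> 'g set \<Rightarrow> ('g, 'm) monoid_scheme" where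
  "restrict_group G H \<equiv> G\<lparr>carrier := H\<rparr>"

definition continuous_action ::
    "('g, 'm) monoid_scheme \<Rightarrow> 'g topology \<Rightarrow> 'x topology \<Rightarrow> ('g \<Rightarrow> 'x \<Rightarrow> 'x) \<Rightarrow> bool" where
  "continuous_action G T X \<phi> \<longleftrightarrow>
     group_action G (topspace X) \<phi> \<and>
     continuous_map (prod_topology T X) X (\<lambda>(g, x). \<phi> g x)"


section \<open>Haar measure and the modular character\<close>

text \<open>A left Haar measure is a nonzero left invariant Radon measure on the Borel sets.\<close>

definition left_haar_measure ::
    "('g, 'm) monoid_scheme \<Rightarrow> 'g topology \<Rightarrow> 'g measure \<Rightarrow> bool" where
  "left_haar_measure G T \<mu> \<longleftrightarrow>
     sets \<mu> = sets (sigma (topspace T) {U. openin T U}) \<and>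
     emeasure \<mu> (space \<mu>) \<noteq> 0 \<and>
     (\<forall>K. compactin T K \<longrightarrow> emeasure \<mu> K < \<infinity>) \<and>
     (\<forall>E\<in>sets \<mu>. emeasure \<mu> E = (INF U\<in>{U. openin T U \<and> E \<subseteq> U}. emeasure \<mu> U)) \<and>
     (\<forall>U. openin T U \<longrightarrow>
        emeasure \<mu> U = (SUP K\<in>{K. compactin T K \<and> K \<subseteq> U}. emeasure \<mu> K)) \<and>
     (\<forall>g\<in>carrier G. \<forall>E\<in>sets \<mu>. emeasure \<mu> (g <#\<^bsub>G\<^esub> E) = emeasure \<mu> E)"

definition modular_character ::
    "('g, 'm) monoid_scheme \<Rightarrow> 'g topology \<Rightarrow> 'g \<Rightarrow> real" where
  "modular_character G T g =
     (THE c. 0 < c \<and> (\<exists>\<mu>. left_haar_measure G T \<mu> \<and>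
        (\<forall>E\<in>sets \<mu>. emeasure \<mu> (E #>\<^bsub>G\<^esub> g) = ennreal c * emeasure \<mu> E)))"

definition relative_modular_character ::
    "('g, 'm) monoid_scheme \<Rightarrow> 'g topology \<Rightarrow> 'g set \<Rightarrow> 'g \<Rightarrow> real" where
  "relative_modular_character G T H h =
     modular_character G T h *
     inverse (modular_character (restrict_group G H) (subtopology T H) h)"


section \<open>Test functions and distributions\<close>

text \<open>
  Functions on \<open>topspace X\<close> are represented by their extension by zero, so that the test
  functions form a linear subspace of the type of all complex functions.
\<close>

definition test_functions :: "'x topology \<Rightarrow> ('x \<Rightarrow> complex) set" where
  "test_functions X =
     {f. (\<forall>x. x \<notin> topspace X \<longrightarrow> f x = 0) \<and>
         (\<forall>x\<in>topspace X. \<exists>U. openin X U \<and> x \<in> U \<and> (\<forall>y\<in>U. f y = f x)) \<and>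
         compactin X (X closure_of {x \<in> topspace X. f x \<noteq> 0})}"

text \<open>
  Linear functionals on the test functions are taken in \<open>extensional\<close> form, so that each
  functional has exactly one representative.
\<close>

definition distributions :: "'x topology \<Rightarrow> (('x \<Rightarrow> complex) \<Rightarrow> complex) set" where
  "distributions X =
     {\<xi>. \<xi> \<in> extensional (test_functions X) \<and>
         (\<forall>f\<in>test_functions X. \<forall>f'\<in>test_functions X. \<xi> (\<lambda>x. f x + f' x) = \<xi> f + \<xi> f') \<and>
         (\<forall>c. \<forall>f\<in>test_functions X. \<xi> (\<lambda>x. c * f x) = c * \<xi> f)}"

definition zero_distribution :: "'x topology \<Rightarrow> ('x \<Rightarrow> complex) \<Rightarrow> complex" where
  "zero_distribution X = (\<lambda>f\<in>test_functions X. 0)"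

text \<open>
  \<open>X\<close> may be a subspace, stable under \<open>G\<close>, of the space on which the action \<open>\<phi>\<close> is given.
\<close>

definition function_action ::
    "('g, 'm) monoid_scheme \<Rightarrow> ('g \<Rightarrow> 'x \<Rightarrow> 'x) \<Rightarrow> 'x topology \<Rightarrow> 'g
      \<Rightarrow> ('x \<Rightarrow> complex) \<Rightarrow> ('x \<Rightarrow> complex)" where
  "function_action G \<phi> X g f = (\<lambda>x. if x \<in> topspace X then f (\<phi> (inv\<^bsub>G\<^esub> g) x) else 0)"

definition distribution_action ::
    "('g, 'm) monoid_scheme \<Rightarrow> ('g \<Rightarrow> 'x \<Rightarrow> 'x) \<Rightarrow> 'x topology \<Rightarrow> 'g
      \<Rightarrow> (('x \<Rightarrow> complex) \<Rightarrow> complex) \<Rightarrow> (('x \<Rightarrow> complex) \<Rightarrow> complex)" where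
  "distribution_action G \<phi> X g \<xi> =
     (\<lambda>f\<in>test_functions X. \<xi> (function_action G \<phi> X (inv\<^bsub>G\<^esub> g) f))"

definition equivariant_distributions ::
    "('g, 'm) monoid_scheme \<Rightarrow> ('g \<Rightarrow> 'x \<Rightarrow> 'x) \<Rightarrow> 'x topology \<Rightarrow> ('g \<Rightarrow> complex)
      \<Rightarrow> (('x \<Rightarrow> complex) \<Rightarrow> complex) set" where
  "equivariant_distributions G \<phi> X \<psi> =
     {\<xi> \<in> distributions X. \<forall>g\<in>carrier G.
        distribution_action G \<phi> X g \<xi> = (\<lambda>f\<in>test_functions X. \<psi> g * \<xi> f)}"

abbreviation invariant_distributions ::
    "('g, 'm) monoid_scheme \<Rightarrow> ('g \<Rightarrow> 'x \<Rightarrow> 'x) \<Rightarrow> 'x topology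
      \<Rightarrow> (('x \<Rightarrow> complex) \<Rightarrow> complex) set" where
  "invariant_distributions G \<phi> X \<equiv> equivariant_distributions G \<phi> X (\<lambda>_. 1)"

definition fiber :: "'x topology \<Rightarrow> ('x \<Rightarrow> 'o) \<Rightarrow> 'o \<Rightarrow> 'x topology" where
  "fiber X p y = subtopology X {z \<in> topspace X. p z = y}"

end

theory Submission
  imports Defs
begin

text \<open>
  Let \<open>\<xi>\<close> be a \<open>P\<close>-invariant distribution on \<open>X\<close>. Frobenius reciprocity over the open orbit \<open>U\<close>
  turns \<open>\<xi>\<close> into a \<open>Stab(P, x)\<close>-invariant distribution \<open>\<zeta>\<close> on the fiber over \<open>x\<close>, which by (iv) is
  \<open>Stab(G, x)\<close>-invariant. Integrating the \<open>G\<close>-translates of \<open>\<zeta>\<close> against the invariant distribution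
  on the base gives a \<open>G\<close>-invariant distribution that agrees with \<open>\<xi>\<close> over \<open>U\<close>. The difference is
  \<open>P\<close>-invariant and vanishes over \<open>U\<close>. By Baire's theorem the complement of \<open>U\<close> can be exhausted by
  orbits each of which is open in what remains, and Frobenius reciprocity together with (v) shows
  that the difference vanishes over one orbit after the other.

  Frobenius reciprocity is used in elementary form. For a test function \<open>f\<close> invariant under a
  compact open subgroup \<open>K\<close>, the value of \<open>\<xi>\<close> on the part of \<open>f\<close> over \<open>K y\<close>, divided by a
  normalization \<open>\<nu> K\<close>, depends only on the restriction of \<open>f\<close> to the fiber over \<open>y\<close>. Here \<open>\<nu> K\<close> is the
  volume of \<open>K y\<close> where an invariant volume exists, and in general the quotient of the Haar measures
  of \<open>K\<close> and \<open>K \<inter> Stab(y)\<close>, whose behaviour under conjugation produces the modular characters.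
\<close>

section \<open>Compact open sets\<close>

text \<open>The modular characters in (v) are defined through arbitrary Haar measures, so existence
  and uniqueness of Haar measure must be available before they can be evaluated. Both come from
  counting cosets of compact open subgroups, which replaces limits by exact ratios. On the open
  orbit (iv) admits no character, so the normalization used there must not change under conjugation
  by the stabilizer. The invariant distribution of (ii) supplies one, but its volumes are mere
  complex numbers that might vanish. Transitivity of the large group settles this: the volumes of
  nonempty compact open sets are positive multiples of one number, so no cancellation can occur. The
  same distribution later integrates the translates of \<open>\<zeta>\<close>, so the normalization
  cancels, and this is why the extension reproduces \<open>\<xi>\<close> over the open orbit
  exactly. Everything relies on the orbits \<open>K y\<close> being open in their stratum.
  Sigma-compactness enters for this purpose: it makes an orbit a countable union of compact
  translates of \<open>K y\<close>, to which Baire's theorem applies.\<close>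

definition compact_open :: "'a topology \<Rightarrow> 'a set \<Rightarrow> bool" where
  "compact_open X A \<longleftrightarrow> openin X A \<and> compactin X A"

lemma compact_open_subset: "compact_open X A \<Longrightarrow> A \<subseteq> topspace X"
  by (simp add: compact_open_def openin_subset)

lemma compact_open_empty [simp]: "compact_open X {}"
  by (simp add: compact_open_def)

lemma compact_open_Un: "compact_open X A \<Longrightarrow> compact_open X B \<Longrightarrow> compact_open X (A \<union> B)"
  by (auto simp: compact_open_def intro: compactin_Un)

lemma compact_open_Union:
  "finite \<A> \<Longrightarrow> (\<And>A. A \<in> \<A> \<Longrightarrow> compact_open X A) \<Longrightarrow> compact_open X (\<Union>\<A>)"
  by (auto simp: compact_open_def intro: compactin_Union)

lemma compact_open_closed_Int:
  "compact_open X A \<Longrightarrow> openin X B \<Longrightarrow> closedin X B \<Longrightarrow> compact_open X (A \<inter> B)"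
  by (auto simp: compact_open_def intro: compact_Int_closedin)

lemma compact_open_closedin: "Hausdorff_space X \<Longrightarrow> compact_open X A \<Longrightarrow> closedin X A"
  by (simp add: compact_open_def compactin_imp_closedin)

lemma compact_open_Int:
  "Hausdorff_space X \<Longrightarrow> compact_open X A \<Longrightarrow> compact_open X B \<Longrightarrow> compact_open X (A \<inter> B)"
  by (meson compact_open_closed_Int compact_open_closedin compact_open_def)

lemma compact_open_diff:
  "Hausdorff_space X \<Longrightarrow> compact_open X A \<Longrightarrow> compact_open X B \<Longrightarrow> compact_open X (A - B)"
proof -
  assume H: "Hausdorff_space X" and A: "compact_open X A" and B: "compact_open X B"
  have "A - B = A \<inter> (topspace X - B)" using compact_open_subset[OF A] by blast
  moreover have "openin X (topspace X - B)" "closedin X (topspace X - B)"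
    using compact_open_closedin[OF H B] B by (auto simp: compact_open_def)
  ultimately show ?thesis using compact_open_closed_Int[OF A] by metis
qed

lemma compact_open_homeomorphic_image:
  "homeomorphic_map X Y h \<Longrightarrow> compact_open X A \<Longrightarrow> compact_open Y (h ` A)"
  by (metis compact_open_def compact_open_subset homeomorphic_map_openness homeomorphic_imp_continuous_map
      image_compactin)

text \<open>The free predicate \<open>P\<close> lets each piece of the finite cover carry extra
  information, such as lying inside a single member of a given open cover.\<close>

lemma compact_open_cover:
  assumes "compactin X A" "openin X W" "A \<subseteq> W"
    and basis: "\<And>z. z \<in> A \<Longrightarrow> \<exists>B. compact_open X B \<and> z \<in> B \<and> B \<subseteq> W \<and> P B"
  obtains \<B> where "finite \<B>" "A \<subseteq> \<Union>\<B>" "\<And>B. B \<in> \<B> \<Longrightarrow> compact_open X B \<and> B \<subseteq> W \<and> P B"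
proof -
  let ?\<U> = "{B. compact_open X B \<and> B \<subseteq> W \<and> P B}"
  have "A \<subseteq> \<Union>?\<U>" using basis by blast
  moreover have "\<forall>U\<in>?\<U>. openin X U" by (simp add: compact_open_def)
  ultimately obtain \<B> where "finite \<B>" "\<B> \<subseteq> ?\<U>" "A \<subseteq> \<Union>\<B>"
    using compactinD[OF \<open>compactin X A\<close>, of ?\<U>] by auto
  with that show thesis by blast
qed

lemma lctd_space_Hausdorff: "lctd_space X \<Longrightarrow> Hausdorff_space X"
  by (simp add: lctd_space_def)

text \<open>In a locally compact Hausdorff space a compact component inside an open set can be
  enclosed in a clopen subset of that open set. Total disconnectedness makes the component of
  \<open>z\<close> a single point, and a clopen set inside a compact neighbourhood is itself
  compact.\<close>

lemma lctd_space_compact_open_basis: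
  assumes "lctd_space X" "openin X W" "z \<in> W"
  obtains B where "compact_open X B" "z \<in> B" "B \<subseteq> W"
proof -
  have H: "Hausdorff_space X" and L: "locally_compact_space X"
    and td: "totally_disconnected_space X"
    using assms(1) by (auto simp: lctd_space_def)
  have z: "z \<in> topspace X" using assms openin_subset by blast
  obtain N C where NC: "openin X N" "compactin X C" "z \<in> N" "N \<subseteq> C" "C \<subseteq> W"
    using locally_compact_space_neighbourhood_base[of X] H L assms(2,3)
    unfolding neighbourhood_base_of by metis
  have "\<exists>a. connected_component_of_set X z \<subseteq> {a}"
    using td connectedin_connected_component_of totally_disconnected_space_def by metis
  moreover have "z \<in> connected_component_of_set X z"
    using z by (simp add: connected_component_of_refl)
  ultimately have "connected_component_of_set X z = {z}" by blast
  then have "{z} \<in> connected_components_of X"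
    using z by (auto simp: connected_components_of_def)
  then obtain A B where AB: "openin X A" "openin X B" "disjnt A B" "A \<union> B = topspace X"
      "{z} \<subseteq> A" "A \<subseteq> N"
    using wilder_locally_compact_component_thm[of X "{z}" N] H L NC z by auto
  then have "A = topspace X - B" by (auto simp: disjnt_def)
  then have "closedin X A" using AB(2) by blast
  then have "compactin X A" using NC AB by (meson closed_compactin order_trans)
  with AB NC show thesis by (intro that[of A]) (auto simp: compact_open_def)
qed

lemma lctd_space_compact_open_between:
  assumes "lctd_space X" "compactin X A" "openin X W" "A \<subseteq> W"
  obtains B where "compact_open X B" "A \<subseteq> B" "B \<subseteq> W"
proof -
  obtain \<B> where \<B>: "finite \<B>" "A \<subseteq> \<Union>\<B>" "\<And>B. B \<in> \<B> \<Longrightarrow> compact_open X B \<and> B \<subseteq> W \<and> True"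
    using compact_open_cover[OF assms(2-4), of "\<lambda>_. True"]
      lctd_space_compact_open_basis[OF assms(1,3)] assms(4)
    by (metis subset_iff)
  then show thesis
    by (intro that[of "\<Union>\<B>"] compact_open_Union) auto
qed

text \<open>Some open set of the ambient space cuts out \<open>A\<close>. Compactness of
  \<open>A\<close> leaves room for a compact open \<open>B\<close> between \<open>A\<close> and that
  open set, and such a \<open>B\<close> still meets \<open>C\<close> exactly in \<open>A\<close>.
  Functions and cells on a subspace are thickened in this way.\<close>

lemma compact_open_extend:
  assumes "lctd_space X" "compact_open (subtopology X C) A"
  obtains B where "compact_open X B" "B \<inter> C = A"
proof -
  obtain W where W: "openin X W" "A = W \<inter> C"
    using assms(2) unfolding compact_open_def openin_subtopology by blast
  obtain B where "compact_open X B" "A \<subseteq> B" "B \<subseteq> W"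
    using lctd_space_compact_open_between[OF assms(1) _ W(1), of A] assms(2) W
    unfolding compact_open_def compactin_subtopology by blast
  then show thesis using W by (intro that[of B]) auto
qed

lemma lctd_space_closed_subtopology:
  assumes "lctd_space X" "closedin X C"
  shows "lctd_space (subtopology X C)"
  using assms locally_compact_space_closed_subset Hausdorff_space_subtopology
  unfolding lctd_space_def totally_disconnected_space_def
  by (meson connectedin_subtopology)

lemma sigma_compact_closed_subtopology:
  assumes "sigma_compact_space X" "closedin X C"
  shows "sigma_compact_space (subtopology X C)"
proof -
  obtain K :: "nat \<Rightarrow> _" where K: "\<And>n. compactin X (K n)" "topspace X = (\<Union>n. K n)"
    using assms(1) unfolding sigma_compact_space_def by metis
  have "compactin (subtopology X C) (K n \<inter> C)" for n
    using K(1) assms(2) by (auto simp: compactin_subtopology intro: compact_Int_closedin)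
  moreover have "topspace (subtopology X C) = (\<Union>n. K n \<inter> C)"
    using K(2) by auto
  ultimately show ?thesis
    unfolding sigma_compact_space_def by (intro exI[of _ "\<lambda>n. K n \<inter> C"]) auto
qed

section \<open>Test functions and distributions\<close>

lemma test_functions_outside: "f \<in> test_functions X \<Longrightarrow> x \<notin> topspace X \<Longrightarrow> f x = 0"
  by (simp add: test_functions_def)

lemma test_functions_locally_constant:
  assumes "f \<in> test_functions X" "x \<in> topspace X"
  obtains U c where "openin X U" "x \<in> U" "\<And>y. y \<in> U \<Longrightarrow> f y = c"
  using assms unfolding test_functions_def by blast

lemma openin_locally_constant_vimage:
  assumes "\<And>x. x \<in> topspace X \<Longrightarrow> \<exists>U c. openin X U \<and> x \<in> U \<and> (\<forall>y\<in>U. f y = c)"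
  shows "openin X {x \<in> topspace X. f x \<in> S}"
proof (subst openin_subopen, intro ballI)
  fix x assume x: "x \<in> {x \<in> topspace X. f x \<in> S}"
  then have "x \<in> topspace X" "f x \<in> S" by auto
  obtain U c where "openin X U" "x \<in> U" "\<forall>y\<in>U. f y = c"
    using assms[OF \<open>x \<in> topspace X\<close>] by blast
  with \<open>f x \<in> S\<close> show "\<exists>T. openin X T \<and> x \<in> T \<and> T \<subseteq> {x \<in> topspace X. f x \<in> S}"
    using openin_subset[OF \<open>openin X U\<close>] by (intro exI[of _ U]) auto
qed

lemma test_functions_openin_vimage:
  "f \<in> test_functions X \<Longrightarrow> openin X {x \<in> topspace X. f x \<in> S}"
  by (rule openin_locally_constant_vimage) (metis test_functions_locally_constant)

lemma test_functions_closedin_vimage: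
  assumes "f \<in> test_functions X" shows "closedin X {x \<in> topspace X. f x \<in> S}"
proof -
  have "topspace X - {x \<in> topspace X. f x \<in> S} = {x \<in> topspace X. f x \<in> - S}" by auto
  then show ?thesis
    using test_functions_openin_vimage[OF assms, of "- S"] by (simp add: closedin_def)
qed

text \<open>Local constancy makes the set where \<open>f\<close> is nonzero both open and closed, so
  passing to its closure adds nothing, and it is compact as a closed subset of
  \<open>A\<close>.\<close>

lemma test_functionsI:
  assumes "compactin X A" and zero: "\<And>x. x \<notin> A \<Longrightarrow> f x = 0"
    and loc: "\<And>x. x \<in> topspace X \<Longrightarrow> \<exists>U c. openin X U \<and> x \<in> U \<and> (\<forall>y\<in>U. f y = c)"
  shows "f \<in> test_functions X"
proof -
  let ?S = "{x \<in> topspace X. f x \<noteq> 0}"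
  have "topspace X - ?S = {x \<in> topspace X. f x \<in> {0}}" by auto
  then have "openin X (topspace X - ?S)"
    using openin_locally_constant_vimage[OF loc, of "{0}"] by simp
  then have "closedin X ?S" unfolding closedin_def by simp
  moreover have "?S \<subseteq> A" using zero by blast
  ultimately have "compactin X ?S" using \<open>compactin X A\<close> by (meson closed_compactin)
  moreover have "f x = 0" if "x \<notin> topspace X" for x
    using zero that compactin_subset_topspace[OF \<open>compactin X A\<close>] by blast
  ultimately show ?thesis
    using loc closure_of_closedin[OF \<open>closedin X ?S\<close>] unfolding test_functions_def
    by simp metis
qed

text \<open>The value 0 has to be kept out of \<open>S\<close> because its level contains every
  point outside the space and is in general not compact.\<close>

lemma test_functions_vimage_compact_open:
  assumes f: "f \<in> test_functions X" and "0 \<notin> S"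
  shows "compact_open X {x. f x \<in> S}"
proof -
  let ?T = "{x \<in> topspace X. f x \<in> - {0}}"
  have "closedin X ?T" by (rule test_functions_closedin_vimage[OF f])
  moreover have "?T = {x \<in> topspace X. f x \<noteq> 0}" by auto
  ultimately have "compactin X ?T"
    using f closure_of_closedin[of X ?T] unfolding test_functions_def by simp
  then have "compactin X (?T \<inter> {x \<in> topspace X. f x \<in> S})"
    using test_functions_closedin_vimage[OF f] by (meson compact_Int_closedin)
  moreover have "?T \<inter> {x \<in> topspace X. f x \<in> S} = {x \<in> topspace X. f x \<in> S}"
    using assms(2) by auto
  moreover have "{x \<in> topspace X. f x \<in> S} = {x. f x \<in> S}"
    using assms test_functions_outside[OF f] by force
  ultimately show ?thesis
    using test_functions_openin_vimage[OF f, of S] by (simp add: compact_open_def)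
qed

lemma test_functions_support: "f \<in> test_functions X \<Longrightarrow> compact_open X {x. f x \<noteq> 0}"
  using test_functions_vimage_compact_open[of f X "- {0}"] by simp

text \<open>The level sets of the nonzero values are open and cover the compact support, so finitely
  many of them do.\<close>

lemma test_functions_finite_range:
  assumes f: "f \<in> test_functions X" shows "finite (range f)"
proof -
  let ?\<U> = "(\<lambda>c. {x \<in> topspace X. f x \<in> {c}}) ` (- {0})"
  have "\<exists>\<F>. finite \<F> \<and> \<F> \<subseteq> ?\<U> \<and> {x. f x \<noteq> 0} \<subseteq> \<Union>\<F>"
  proof (rule compactinD[of X])
    show "compactin X {x. f x \<noteq> 0}"
      using test_functions_support[OF f] by (simp add: compact_open_def)
    show "\<And>U. U \<in> ?\<U> \<Longrightarrow> openin X U" using test_functions_openin_vimage[OF f] by blast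
    show "{x. f x \<noteq> 0} \<subseteq> \<Union>?\<U>" using test_functions_outside[OF f] by auto
  qed
  then obtain \<F> where \<F>: "finite \<F>" "\<F> \<subseteq> ?\<U>" "{x. f x \<noteq> 0} \<subseteq> \<Union>\<F>" by blast
  obtain C where C: "finite C" "\<F> = (\<lambda>c. {x \<in> topspace X. f x \<in> {c}}) ` C"
    using finite_subset_image[OF \<F>(1,2)] by blast
  with \<F>(3) have "{x. f x \<noteq> 0} \<subseteq> (\<Union>c\<in>C. {x \<in> topspace X. f x \<in> {c}})" by simp
  then have "range f \<subseteq> insert 0 C" by auto
  with C(1) show ?thesis by (meson finite.insertI finite_subset)
qed

lemma test_functions_combine:
  assumes f: "f \<in> test_functions X" and g: "g \<in> test_functions X" and "h 0 0 = 0"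
  shows "(\<lambda>x. h (f x) (g x)) \<in> test_functions X"
proof (rule test_functionsI[of X "{x. f x \<noteq> 0} \<union> {x. g x \<noteq> 0}"])
  show "compactin X ({x. f x \<noteq> 0} \<union> {x. g x \<noteq> 0})"
    using compact_open_Un[OF test_functions_support[OF f] test_functions_support[OF g]]
    by (simp add: compact_open_def)
  fix x assume x: "x \<in> topspace X"
  obtain U c where U: "openin X U" "x \<in> U" "\<And>y. y \<in> U \<Longrightarrow> f y = c"
    by (rule test_functions_locally_constant[OF f x]) blast
  obtain V d where V: "openin X V" "x \<in> V" "\<And>y. y \<in> V \<Longrightarrow> g y = d"
    by (rule test_functions_locally_constant[OF g x]) blast
  show "\<exists>U e. openin X U \<and> x \<in> U \<and> (\<forall>y\<in>U. h (f y) (g y) = e)"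
    using U V by (intro exI[of _ "U \<inter> V"] exI[of _ "h c d"]) auto
qed (use assms(3) in auto)

lemma test_functions_zero: "(\<lambda>x. 0) \<in> test_functions X"
  by (rule test_functionsI[of X "{}"]) auto

lemma test_functions_add:
  "f \<in> test_functions X \<Longrightarrow> g \<in> test_functions X \<Longrightarrow> (\<lambda>x. f x + g x) \<in> test_functions X"
  using test_functions_combine[of f X g "(+)"] by simp

lemma test_functions_diff:
  "f \<in> test_functions X \<Longrightarrow> g \<in> test_functions X \<Longrightarrow> (\<lambda>x. f x - g x) \<in> test_functions X"
  using test_functions_combine[of f X g "(-)"] by simp

lemma test_functions_cmult: "f \<in> test_functions X \<Longrightarrow> (\<lambda>x. c * f x) \<in> test_functions X"
  using test_functions_combine[of f X f "\<lambda>u v. c * u"] by simp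

lemma test_functions_sum:
  "(\<And>i. i \<in> I \<Longrightarrow> f i \<in> test_functions X) \<Longrightarrow> (\<lambda>x. \<Sum>i\<in>I. f i x) \<in> test_functions X"
  by (induction I rule: infinite_finite_induct)
    (auto simp: test_functions_zero intro: test_functions_add)

lemma test_functions_indicator:
  assumes "Hausdorff_space X" "compact_open X A"
  shows "indicator A \<in> test_functions X"
proof (rule test_functionsI[of X A])
  fix x assume x: "x \<in> topspace X"
  have "closedin X A" using assms compact_open_closedin by blast
  then show "\<exists>U c. openin X U \<and> x \<in> U \<and> (\<forall>y\<in>U. indicator A y = (c :: complex))"
    using x assms(2)
    by (intro exI[of _ "if x \<in> A then A else topspace X - A"] exI[of _ "indicator A x"])
      (auto simp: compact_open_def)
qed (use assms in \<open>auto simp: compact_open_def\<close>)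

lemma test_functions_expansion:
  assumes f: "f \<in> test_functions X"
  shows "f x = (\<Sum>c\<in>range f - {0}. c * indicator {z. f z = c} x)"
proof -
  have "(\<Sum>c\<in>range f - {0}. c * indicator {z. f z = c} x) =
      (\<Sum>c\<in>range f - {0}. if c = f x then c else 0)"
    by (intro sum.cong) (auto simp: indicator_def)
  also have "\<dots> = f x"
    using test_functions_finite_range[OF f] by (simp add: sum.delta)
  finally show ?thesis by simp
qed

text \<open>The extension is assembled level by level from thickenings \<open>B c\<close> of the
  level sets. Off \<open>C\<close> the thickenings may overlap, but at a point of \<open>C\<close>
  only the term belonging to its own value can survive.\<close>

lemma test_functions_extend:
  assumes X: "lctd_space X" and f: "f \<in> test_functions (subtopology X C)"
  obtains f' where "f' \<in> test_functions X" "\<And>x. x \<in> C \<Longrightarrow> f' x = f x"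
proof -
  define B where "B c = (SOME B. compact_open X B \<and> B \<inter> C = {x. f x = c})" for c
  have B: "compact_open X (B c) \<and> B c \<inter> C = {x. f x = c}" if "c \<noteq> 0" for c
  proof -
    have "compact_open (subtopology X C) {x. f x = c}"
      using test_functions_vimage_compact_open[OF f, of "{c}"] that by simp
    then have "\<exists>B. compact_open X B \<and> B \<inter> C = {x. f x = c}"
      by (rule compact_open_extend[OF X]) blast
    then show ?thesis unfolding B_def by (rule someI_ex)
  qed
  let ?f' = "\<lambda>x. \<Sum>c\<in>range f - {0}. c * indicator (B c) x"
  have "?f' \<in> test_functions X"
    using B by (intro test_functions_sum test_functions_cmult test_functions_indicator)
      (auto simp: lctd_space_Hausdorff[OF X])
  moreover have "?f' x = f x" if "x \<in> C" for x
  proof -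
    have "indicator (B c) x = (indicator {z. f z = c} x :: complex)" if "c \<in> range f - {0}" for c
      using B[of c] that \<open>x \<in> C\<close> by (auto simp: indicator_def)
    then have "?f' x = (\<Sum>c\<in>range f - {0}. c * indicator {z. f z = c} x)"
      by (intro sum.cong) simp_all
    then show ?thesis by (simp only: test_functions_expansion[OF f, of x, symmetric])
  qed
  ultimately show thesis using that by blast
qed

lemma test_functions_restrict:
  assumes f: "f \<in> test_functions X" and C: "closedin X C"
  shows "(\<lambda>x. if x \<in> C then f x else 0) \<in> test_functions (subtopology X C)"
proof (rule test_functionsI[of _ "{x. f x \<noteq> 0} \<inter> C"])
  show "compactin (subtopology X C) ({x. f x \<noteq> 0} \<inter> C)"
    using test_functions_support[OF f] C
    by (auto simp: compactin_subtopology compact_open_def intro: compact_Int_closedin)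
  fix x assume x: "x \<in> topspace (subtopology X C)"
  then have "x \<in> topspace X" by simp
  then obtain U c where "openin X U" "x \<in> U" "\<And>y. y \<in> U \<Longrightarrow> f y = c"
    by (rule test_functions_locally_constant[OF f]) blast
  then show "\<exists>U d. openin (subtopology X C) U \<and> x \<in> U \<and> (\<forall>y\<in>U. (if y \<in> C then f y else 0) = d)"
    using x by (intro exI[of _ "U \<inter> C"] exI[of _ c]) (auto simp: openin_subtopology)
qed auto

lemma test_functions_cutoff:
  assumes f: "f \<in> test_functions X" and B: "openin X B" "closedin X B"
  shows "(\<lambda>x. if x \<in> B then f x else 0) \<in> test_functions X"
proof (rule test_functionsI[of X "{x. f x \<noteq> 0}"])
  show "compactin X {x. f x \<noteq> 0}"
    using test_functions_support[OF f] by (simp add: compact_open_def)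
  fix x assume x: "x \<in> topspace X"
  obtain U c where U: "openin X U" "x \<in> U" "\<And>y. y \<in> U \<Longrightarrow> f y = c"
    by (rule test_functions_locally_constant[OF f x]) blast
  show "\<exists>U d. openin X U \<and> x \<in> U \<and> (\<forall>y\<in>U. (if y \<in> B then f y else 0) = d)"
    using U B x by (intro exI[of _ "U \<inter> (if x \<in> B then B else topspace X - B)"]
        exI[of _ "if x \<in> B then c else 0"]) auto
qed auto

section \<open>Linearity of distributions\<close>

lemma distributions_add:
  "\<xi> \<in> distributions X \<Longrightarrow> f \<in> test_functions X \<Longrightarrow> g \<in> test_functions X \<Longrightarrow>
    \<xi> (\<lambda>x. f x + g x) = \<xi> f + \<xi> g"
  by (simp add: distributions_def)

lemma distributions_cmult:
  "\<xi> \<in> distributions X \<Longrightarrow> f \<in> test_functions X \<Longrightarrow> \<xi> (\<lambda>x. c * f x) = c * \<xi> f"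
  by (simp add: distributions_def)

lemma distributions_zero: "\<xi> \<in> distributions X \<Longrightarrow> \<xi> (\<lambda>x. 0) = 0"
  using distributions_cmult[of \<xi> X "\<lambda>x. 0" 0] test_functions_zero[of X] by simp

lemma distributions_diff:
  assumes "\<xi> \<in> distributions X" "f \<in> test_functions X" "g \<in> test_functions X"
  shows "\<xi> (\<lambda>x. f x - g x) = \<xi> f - \<xi> g"
  using distributions_add[OF assms(1,2), of "\<lambda>x. (-1) * g x"]
    distributions_cmult[OF assms(1,3), of "-1"] test_functions_cmult[OF assms(3), of "-1"]
  by simp

lemma distributions_sum:
  assumes "\<xi> \<in> distributions X"
  shows "(\<And>i. i \<in> I \<Longrightarrow> f i \<in> test_functions X) \<Longrightarrow> \<xi> (\<lambda>x. \<Sum>i\<in>I. f i x) = (\<Sum>i\<in>I. \<xi> (f i))"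
proof (induction I rule: infinite_finite_induct)
  case (insert i I)
  then show ?case
    using distributions_add[OF assms, of "f i" "\<lambda>x. \<Sum>i\<in>I. f i x"] test_functions_sum[of I f X]
    by simp
qed (simp_all add: distributions_zero[OF assms])

lemma distributionsI:
  assumes "\<And>f. f \<notin> test_functions X \<Longrightarrow> \<xi> f = undefined"
    and "\<And>f g. f \<in> test_functions X \<Longrightarrow> g \<in> test_functions X \<Longrightarrow> \<xi> (\<lambda>x. f x + g x) = \<xi> f + \<xi> g"
    and "\<And>c f. f \<in> test_functions X \<Longrightarrow> \<xi> (\<lambda>x. c * f x) = c * \<xi> f"
  shows "\<xi> \<in> distributions X"
  using assms by (simp add: distributions_def extensional_def)

lemma distributions_eqI:
  assumes "\<xi> \<in> distributions X" "\<eta> \<in> distributions X"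
    and "\<And>f. f \<in> test_functions X \<Longrightarrow> \<xi> f = \<eta> f"
  shows "\<xi> = \<eta>"
  using assms by (auto simp: distributions_def intro: extensionalityI)

section \<open>Compact open subgroups\<close>

locale lctd_topological_group = group G for G (structure) +
  fixes T :: "'a topology"
  assumes lctd_group: "lctd_group G T"
begin

lemma lctd_T: "lctd_space T" and topspace_T: "topspace T = carrier G"
  and continuous_mult: "continuous_map (prod_topology T T) T (\<lambda>(g, h). g \<otimes> h)"
  and continuous_inv: "continuous_map T T (\<lambda>g. inv g)"
  using lctd_group by (auto simp: lctd_group_def topological_group_def)

lemma Hausdorff_T: "Hausdorff_space T"
  using lctd_T by (rule lctd_space_Hausdorff)

lemma openin_carrier: "openin T (carrier G)"
  using openin_topspace[of T] topspace_T by simp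

lemma continuous_map_mult:
  "continuous_map Y T f \<Longrightarrow> continuous_map Y T g \<Longrightarrow> continuous_map Y T (\<lambda>y. f y \<otimes> g y)"
  using continuous_map_compose[OF continuous_map_pairedI continuous_mult] by (simp add: o_def)

lemma continuous_map_inverse: "continuous_map Y T f \<Longrightarrow> continuous_map Y T (\<lambda>y. inv (f y))"
  using continuous_map_compose[OF _ continuous_inv] by (simp add: o_def)

lemma homeomorphic_map_left_mult:
  assumes "g \<in> carrier G" shows "homeomorphic_map T T (\<lambda>h. g \<otimes> h)"
proof (rule homeomorphic_maps_imp_map)
  show "homeomorphic_maps T T (\<lambda>h. g \<otimes> h) (\<lambda>h. inv g \<otimes> h)"
    using assms unfolding homeomorphic_maps_def topspace_T
    by (auto intro!: continuous_map_mult simp: topspace_T m_assoc[symmetric])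
qed

lemma homeomorphic_map_right_mult:
  assumes "g \<in> carrier G" shows "homeomorphic_map T T (\<lambda>h. h \<otimes> g)"
proof (rule homeomorphic_maps_imp_map)
  show "homeomorphic_maps T T (\<lambda>h. h \<otimes> g) (\<lambda>h. h \<otimes> inv g)"
    using assms unfolding homeomorphic_maps_def topspace_T
    by (auto intro!: continuous_map_mult simp: topspace_T m_assoc)
qed

lemma l_coset_eq_image: "g <# A = (\<lambda>h. g \<otimes> h) ` A"
  by (auto simp: l_coset_def)

lemma r_coset_eq_image: "A #> g = (\<lambda>h. h \<otimes> g) ` A"
  by (auto simp: r_coset_def)

lemma compact_open_l_coset: "g \<in> carrier G \<Longrightarrow> compact_open T A \<Longrightarrow> compact_open T (g <# A)"
  unfolding l_coset_eq_image by (rule compact_open_homeomorphic_image[OF homeomorphic_map_left_mult])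

lemma compact_open_r_coset: "g \<in> carrier G \<Longrightarrow> compact_open T A \<Longrightarrow> compact_open T (A #> g)"
  unfolding r_coset_eq_image by (rule compact_open_homeomorphic_image[OF homeomorphic_map_right_mult])

lemma openin_l_coset: "g \<in> carrier G \<Longrightarrow> openin T A \<Longrightarrow> openin T (g <# A)"
  unfolding l_coset_eq_image
  using homeomorphic_map_openness[OF homeomorphic_map_left_mult] openin_subset by metis

lemma l_coset_self: "g \<in> carrier G \<Longrightarrow> \<one> \<in> A \<Longrightarrow> g \<in> g <# A"
  unfolding l_coset_eq_image by (rule image_eqI[where x = \<one>]) simp_all

lemma openin_subgroup:
  assumes S: "subgroup S G" and N: "openin T N" "\<one> \<in> N" "N \<subseteq> S"
  shows "openin T S"
proof (subst openin_subopen, intro ballI)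
  fix g assume g: "g \<in> S"
  then have gG: "g \<in> carrier G" using S by (rule subgroup.mem_carrier[rotated])
  have "g <# N \<subseteq> S" using N(3) g S by (auto simp: l_coset_def subgroup.m_closed)
  moreover have "g \<in> g <# N" using gG N(2) by (rule l_coset_self)
  ultimately show "\<exists>U. openin T U \<and> g \<in> U \<and> U \<subseteq> S" using openin_l_coset[OF gG N(1)] by blast
qed

lemma closedin_open_subgroup:
  assumes S: "subgroup S G" and "openin T S"
  shows "closedin T S"
proof -
  interpret S: subgroup S G by (rule S)
  have "carrier G - S = (\<Union>g\<in>carrier G - S. g <# S)"
  proof (intro equalityI subsetI)
    fix g assume "g \<in> carrier G - S"
    then show "g \<in> (\<Union>g\<in>carrier G - S. g <# S)" using l_coset_self[of g S] S.one_closed by blast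
  next
    fix h assume "h \<in> (\<Union>g\<in>carrier G - S. g <# S)"
    then obtain g s where gs: "g \<in> carrier G" "g \<notin> S" "s \<in> S" "h = g \<otimes> s"
      by (auto simp: l_coset_def)
    have "h \<notin> S"
    proof
      assume "h \<in> S"
      then have "h \<otimes> inv s \<in> S" using gs by simp
      then show False using gs by (simp add: m_assoc)
    qed
    then show "h \<in> carrier G - S" using gs by simp
  qed
  moreover have "openin T (\<Union>g\<in>carrier G - S. g <# S)"
    using openin_l_coset[OF _ \<open>openin T S\<close>] by (intro openin_Union) blast
  ultimately have "openin T (carrier G - S)" by simp
  then show ?thesis by (simp add: closedin_def topspace_T S.subset)
qed

definition compact_open_subgroup :: "'a set \<Rightarrow> bool" where
  "compact_open_subgroup K \<longleftrightarrow> subgroup K G \<and> compact_open T K"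

lemma compact_open_subgroupD:
  assumes "compact_open_subgroup K"
  shows "subgroup K G" "compact_open T K" "openin T K" "compactin T K" "K \<subseteq> carrier G" "\<one> \<in> K"
  using assms by (auto simp: compact_open_subgroup_def compact_open_def subgroup.one_closed
      dest: subgroup.subset)

lemma compact_open_subgroup_closed:
  assumes "compact_open_subgroup K" "g \<in> K"
  shows "g \<in> carrier G" "inv g \<in> K" "h \<in> K \<Longrightarrow> g \<otimes> h \<in> K"
  using assms by (auto simp: compact_open_subgroup_def subgroup.m_closed subgroup.m_inv_closed
      dest: subgroup.mem_carrier)

lemma compact_open_subgroupI:
  assumes S: "subgroup S G" and N: "openin T N" "\<one> \<in> N" "N \<subseteq> S" and A: "compactin T A" "S \<subseteq> A"
  shows "compact_open_subgroup S"
  unfolding compact_open_subgroup_def compact_open_def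
  using openin_subgroup[OF S N] closedin_open_subgroup[OF S] S A by (meson closed_compactin)

text \<open>This is the tube lemma around \<open>{\<one>} \<times> A\<close>, followed by an
  intersection with inverses. \<open>F\<close> is only asked to be jointly continuous and to fix
  \<open>A\<close> pointwise at \<open>\<one>\<close>, so that one proof covers left multiplication,
  group actions, and right multiplication, which is not a left action.\<close>

lemma stabilizing_neighbourhood:
  assumes cont: "continuous_map (prod_topology T X) X (\<lambda>(g, x). F g x)"
    and A: "compact_open X A" and one: "\<And>x. x \<in> A \<Longrightarrow> F \<one> x = x"
  obtains N where "openin T N" "\<one> \<in> N" "\<And>g. g \<in> N \<Longrightarrow> inv g \<in> N"
    "\<And>g x. g \<in> N \<Longrightarrow> x \<in> A \<Longrightarrow> F g x \<in> A"
proof -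
  let ?W = "{u \<in> topspace (prod_topology T X). (case u of (g, x) \<Rightarrow> F g x) \<in> A}"
  have A': "openin X A" "compactin X A" "A \<subseteq> topspace X"
    using A compact_open_subset[OF A] by (auto simp: compact_open_def)
  have "openin (prod_topology T X) ?W"
    using cont A'(1) by (rule openin_continuous_map_preimage)
  moreover have "{\<one>} \<times> A \<subseteq> ?W" using A' one by (auto simp: topspace_T)
  ultimately obtain U V where UV: "openin T U" "\<one> \<in> U" "A \<subseteq> V" "U \<times> V \<subseteq> ?W"
    using tube_lemma_right[of T X ?W A \<one>] A' by (auto simp: topspace_T)
  let ?N = "U \<inter> {g \<in> topspace T. inv g \<in> U}"
  have U: "U \<subseteq> carrier G" using openin_subset[OF UV(1)] by (simp add: topspace_T)
  show thesis
  proof (rule that[of ?N])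
    show "openin T ?N"
      using openin_continuous_map_preimage[OF continuous_inv UV(1)] UV(1) by blast
    show "\<one> \<in> ?N" using UV by (simp add: topspace_T)
    show "\<And>g. g \<in> ?N \<Longrightarrow> inv g \<in> ?N" using U by (auto simp: topspace_T)
    show "F g x \<in> A" if "g \<in> ?N" "x \<in> A" for g x
      using subsetD[OF UV(4), of "(g, x)"] subsetD[OF UV(3)] that by simp
  qed
qed

text \<open>Van Dantzig's theorem. For a compact open neighbourhood \<open>B\<close> of the identity,
  the set of \<open>g\<close> with \<open>g B = B\<close> is an open subgroup contained in \<open>B\<close>.\<close>

lemma compact_open_subgroup_basis:
  assumes "openin T W" "\<one> \<in> W"
  obtains K where "compact_open_subgroup K" "K \<subseteq> W"
proof -
  obtain B where B: "compact_open T B" "\<one> \<in> B" "B \<subseteq> W"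
    by (rule lctd_space_compact_open_basis[OF lctd_T assms])
  have BG: "B \<subseteq> carrier G" using compact_open_subset[OF B(1)] by (simp add: topspace_T)
  obtain N where N: "openin T N" "\<one> \<in> N" "\<And>g. g \<in> N \<Longrightarrow> inv g \<in> N"
      "\<And>g x. g \<in> N \<Longrightarrow> x \<in> B \<Longrightarrow> g \<otimes> x \<in> B"
    by (rule stabilizing_neighbourhood[OF continuous_mult B(1)]) (use BG in auto)
  have NG: "N \<subseteq> carrier G" using openin_subset[OF N(1)] by (simp add: topspace_T)
  let ?S = "{g \<in> carrier G. (\<forall>x\<in>B. g \<otimes> x \<in> B) \<and> (\<forall>x\<in>B. inv g \<otimes> x \<in> B)}"
  have "subgroup ?S G"
  proof
    fix g h assume gh: "g \<in> ?S" "h \<in> ?S"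
    show "g \<otimes> h \<in> ?S"
    proof -
      have "g \<otimes> h \<otimes> x = g \<otimes> (h \<otimes> x)" "inv (g \<otimes> h) \<otimes> x = inv h \<otimes> (inv g \<otimes> x)" if "x \<in> B" for x
        using that BG gh by (auto simp: m_assoc inv_mult_group subset_iff)
      then show ?thesis using gh by auto
    qed
  qed (use BG in auto)
  moreover have "N \<subseteq> ?S" using N(3,4) NG by auto
  moreover have "?S \<subseteq> B"
  proof
    fix g assume "g \<in> ?S"
    then have "g \<otimes> \<one> \<in> B" "g \<in> carrier G" using B(2) by blast+
    then show "g \<in> B" by simp
  qed
  ultimately have "compact_open_subgroup ?S"
    using compact_open_subgroupI[of ?S N B] N B(1) by (simp add: compact_open_def)
  then show thesis using \<open>?S \<subseteq> B\<close> B(3) that[of ?S] by blast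
qed

text \<open>\<open>N\<close> is the intersection of all conjugates of a small subgroup
  \<open>M\<close> by elements of \<open>K\<close>. There may be infinitely many conjugates, so
  openness is not automatic; compactness of \<open>K\<close> and the tube lemma for conjugation give
  one neighbourhood of \<open>\<one>\<close> inside all of them.\<close>

lemma normal_compact_open_subgroup:
  assumes K: "compact_open_subgroup K" and W: "openin T W" "\<one> \<in> W"
  obtains N where "compact_open_subgroup N" "N \<subseteq> K" "N \<subseteq> W"
    "\<And>k n. k \<in> K \<Longrightarrow> n \<in> N \<Longrightarrow> k \<otimes> n \<otimes> inv k \<in> N"
proof -
  note KD = compact_open_subgroupD[OF K]
  interpret K: subgroup K G by (rule KD(1))
  obtain M where M: "compact_open_subgroup M" "M \<subseteq> K \<inter> W"
    by (rule compact_open_subgroup_basis[of "K \<inter> W"]) (use KD W in auto)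
  interpret M: subgroup M G by (rule compact_open_subgroupD(1)[OF M(1)])
  let ?N = "{h \<in> carrier G. \<forall>g\<in>K. inv g \<otimes> h \<otimes> g \<in> M}"
  let ?V = "{u \<in> topspace (prod_topology T T). inv (snd u) \<otimes> fst u \<otimes> snd u \<in> M}"
  have "openin (prod_topology T T) ?V"
    by (rule openin_continuous_map_preimage[where Y = T])
      (auto intro!: continuous_map_mult continuous_map_inverse continuous_map_fst continuous_map_snd
        simp: compact_open_subgroupD(3)[OF M(1)])
  moreover have "{\<one>} \<times> K \<subseteq> ?V" by (auto simp: topspace_T)
  ultimately obtain U V where UV: "openin T U" "\<one> \<in> U" "K \<subseteq> V" "U \<times> V \<subseteq> ?V"
    using tube_lemma_right[of T T ?V K \<one>] KD(4) by (auto simp: topspace_T)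
  have UG: "U \<subseteq> carrier G" using openin_subset[OF UV(1)] by (simp add: topspace_T)
  have "subgroup ?N G"
  proof
    fix g h assume gh: "g \<in> ?N" "h \<in> ?N"
    have "inv k \<otimes> (g \<otimes> h) \<otimes> k = (inv k \<otimes> g \<otimes> k) \<otimes> (inv k \<otimes> h \<otimes> k)" if "k \<in> K" for k
    proof -
      have c: "k \<in> carrier G" "g \<in> carrier G" "h \<in> carrier G" using that gh by auto
      then have "(inv k \<otimes> g \<otimes> k) \<otimes> (inv k \<otimes> h \<otimes> k) = inv k \<otimes> g \<otimes> (k \<otimes> inv k) \<otimes> h \<otimes> k"
        by (simp add: m_assoc del: r_inv Units_r_inv)
      then show ?thesis using c by (simp add: m_assoc)
    qed
    then show "g \<otimes> h \<in> ?N" using gh by auto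
  next
    fix g assume g: "g \<in> ?N"
    have "inv k \<otimes> inv g \<otimes> k = inv (inv k \<otimes> g \<otimes> k)" if "k \<in> K" for k
      using that g by (simp add: inv_mult_group m_assoc)
    then show "inv g \<in> ?N" using g by auto
  qed auto
  moreover have "U \<subseteq> ?N"
  proof
    fix h assume "h \<in> U"
    have "inv g \<otimes> h \<otimes> g \<in> M" if "g \<in> K" for g
      using subsetD[OF UV(4), of "(h, g)"] subsetD[OF UV(3)] that \<open>h \<in> U\<close> by simp
    then show "h \<in> ?N" using \<open>h \<in> U\<close> UG by blast
  qed
  moreover have NM: "?N \<subseteq> M"
  proof
    fix h assume "h \<in> ?N"
    then have h: "h \<in> carrier G" "\<forall>g\<in>K. inv g \<otimes> h \<otimes> g \<in> M" by simp_all
    show "h \<in> M" using bspec[OF h(2) K.one_closed] h(1) by simp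
  qed
  ultimately have "compact_open_subgroup ?N"
    using compact_open_subgroupI[of ?N U M] UV compact_open_subgroupD(4)[OF M(1)] by simp
  moreover have "k \<otimes> n \<otimes> inv k \<in> ?N" if "k \<in> K" "n \<in> ?N" for k n
  proof -
    have n: "n \<in> carrier G" "\<forall>g\<in>K. inv g \<otimes> n \<otimes> g \<in> M" using \<open>n \<in> ?N\<close> by simp_all
    have k: "k \<in> carrier G" using that(1) by simp
    have "inv g \<otimes> (k \<otimes> n \<otimes> inv k) \<otimes> g \<in> M" if g: "g \<in> K" for g
    proof -
      have "inv g \<otimes> (k \<otimes> n \<otimes> inv k) \<otimes> g = inv (inv k \<otimes> g) \<otimes> n \<otimes> (inv k \<otimes> g)"
        using K.mem_carrier[OF g] k n(1) by (simp add: inv_mult_group m_assoc)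
      moreover have "inv k \<otimes> g \<in> K" using g \<open>k \<in> K\<close> by simp
      ultimately show ?thesis using bspec[OF n(2), of "inv k \<otimes> g"] by simp
    qed
    then show ?thesis using k n(1) by simp
  qed
  moreover have "?N \<subseteq> K" "?N \<subseteq> W" using subset_trans[OF NM] M(2) by simp_all
  ultimately show thesis by (intro that[of ?N])
qed

lemma compact_open_subgroup_conjugate:
  assumes K: "compact_open_subgroup K" and g: "g \<in> carrier G"
  shows "compact_open_subgroup (g <# K #> inv g)"
proof -
  interpret K: subgroup K G by (rule compact_open_subgroupD(1)[OF K])
  have "subgroup (g <# K #> inv g) G"
    using g by (rule subgroup_conjugation_is_surj2) unfold_locales
  then show ?thesis
    using compact_open_subgroupD(2)[OF K] g
    by (simp add: compact_open_subgroup_def compact_open_l_coset compact_open_r_coset)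
qed

end

section \<open>Continuous actions\<close>

locale lctd_action = lctd_topological_group G T for G (structure) and T +
  fixes X :: "'x topology" and a :: "'a \<Rightarrow> 'x \<Rightarrow> 'x"
  assumes lctd_X: "lctd_space X" and continuous_action: "continuous_action G T X a"
begin

lemma Hausdorff_X: "Hausdorff_space X"
  using lctd_X by (rule lctd_space_Hausdorff)

lemma group_action: "group_action G (topspace X) a"
  and continuous_map_action: "continuous_map (prod_topology T X) X (\<lambda>(g, z). a g z)"
  using continuous_action by (auto simp: continuous_action_def)

lemma action_closed [simp]: "g \<in> carrier G \<Longrightarrow> z \<in> topspace X \<Longrightarrow> a g z \<in> topspace X"
  using group_action.element_image[OF group_action] by blast

lemma action_one [simp]: "z \<in> topspace X \<Longrightarrow> a \<one> z = z"
  using group_action.id_eq_one[OF group_action] by (metis restrict_apply')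

lemma action_mult:
  "g \<in> carrier G \<Longrightarrow> h \<in> carrier G \<Longrightarrow> z \<in> topspace X \<Longrightarrow> a (g \<otimes> h) z = a g (a h z)"
  using group_action.composition_rule[OF group_action] by blast

lemma action_inv [simp]:
  assumes "g \<in> carrier G" "z \<in> topspace X"
  shows "a (inv g) (a g z) = z" "a g (a (inv g) z) = z"
  using assms by (simp_all add: action_mult[symmetric])

lemma continuous_map_act:
  "continuous_map Y T f \<Longrightarrow> continuous_map Y X h \<Longrightarrow> continuous_map Y X (\<lambda>y. a (f y) (h y))"
  using continuous_map_compose[OF continuous_map_pairedI continuous_map_action] by (simp add: o_def)

lemma homeomorphic_map_action:
  assumes "g \<in> carrier G" shows "homeomorphic_map X X (a g)"
proof (rule homeomorphic_maps_imp_map)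
  show "homeomorphic_maps X X (a g) (a (inv g))"
    using assms continuous_map_act[of X "\<lambda>_. g" "\<lambda>z. z"]
      continuous_map_act[of X "\<lambda>_. inv g" "\<lambda>z. z"]
    by (simp add: homeomorphic_maps_def topspace_T)
qed

lemma mem_action_image:
  assumes g: "g \<in> carrier G" and "B \<subseteq> topspace X" and z: "z \<in> topspace X"
  shows "z \<in> a g ` B \<longleftrightarrow> a (inv g) z \<in> B"
proof
  assume "a (inv g) z \<in> B"
  moreover have "z = a g (a (inv g) z)" using g z by simp
  ultimately show "z \<in> a g ` B" by (rule rev_image_eqI)
qed (use assms in \<open>auto simp: subset_iff\<close>)

definition partial_orbit :: "'a set \<Rightarrow> 'x \<Rightarrow> 'x set" where
  "partial_orbit K z = (\<lambda>k. a k z) ` K"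

lemma partial_orbit_carrier: "partial_orbit (carrier G) z = orbit G a z"
  by (auto simp: partial_orbit_def orbit_def)

lemma partial_orbit_subset: "K \<subseteq> carrier G \<Longrightarrow> z \<in> topspace X \<Longrightarrow> partial_orbit K z \<subseteq> topspace X"
  by (auto simp: partial_orbit_def)

lemma compactin_partial_orbit:
  assumes "compactin T K" "z \<in> topspace X" shows "compactin X (partial_orbit K z)"
  unfolding partial_orbit_def
  using assms continuous_map_act[of T "\<lambda>g. g" "\<lambda>_. z"] by (intro image_compactin) auto

lemma partial_orbit_self: "subgroup K G \<Longrightarrow> z \<in> topspace X \<Longrightarrow> z \<in> partial_orbit K z"
  unfolding partial_orbit_def by (rule image_eqI[where x = \<one>]) (simp_all add: subgroup.one_closed)

lemma partial_orbit_eq: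
  assumes K: "subgroup K G" and z: "z \<in> topspace X" and w: "w \<in> partial_orbit K z"
  shows "partial_orbit K w = partial_orbit K z"
proof -
  interpret K: subgroup K G by (rule K)
  obtain k where k: "k \<in> K" "w = a k z" using w by (auto simp: partial_orbit_def)
  have "a h w \<in> partial_orbit K z" if "h \<in> K" for h
    unfolding partial_orbit_def using that k z
    by (intro image_eqI[where x = "h \<otimes> k"]) (simp_all add: action_mult)
  moreover have "a h z \<in> partial_orbit K w" if "h \<in> K" for h
    unfolding partial_orbit_def using that k z
    by (intro image_eqI[where x = "h \<otimes> inv k"]) (simp_all add: action_mult)
  ultimately show ?thesis by (auto simp: partial_orbit_def)
qed

lemma partial_orbit_eq_iff:
  assumes K: "subgroup K G" and "z \<in> topspace X" "w \<in> topspace X"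
  shows "partial_orbit K z = partial_orbit K w \<longleftrightarrow> w \<in> partial_orbit K z"
  using assms partial_orbit_eq partial_orbit_self by metis

lemma partial_orbit_disjoint:
  assumes "subgroup K G" "z \<in> topspace X" "w \<in> topspace X"
    and "partial_orbit K z \<noteq> partial_orbit K w"
  shows "partial_orbit K z \<inter> partial_orbit K w = {}"
  using assms partial_orbit_eq by blast

text \<open>An orbit through another point can be brought back to the base point at the price of
  conjugating the group. This price is what later shows up as a modular character.\<close>

lemma partial_orbit_conjugate:
  assumes "g \<in> carrier G" "K \<subseteq> carrier G" "z \<in> topspace X"
  shows "partial_orbit (g <# K #> inv g) (a g z) = a g ` partial_orbit K z"
proof -
  have "a (g \<otimes> k \<otimes> inv g) (a g z) = a g (a k z)" if "k \<in> K" for k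
    using assms that by (simp add: action_mult subset_iff)
  then show ?thesis
    by (simp add: partial_orbit_def l_coset_eq_image r_coset_eq_image image_image)
qed

lemma function_action_in_test_functions:
  assumes g: "g \<in> carrier G" and f: "f \<in> test_functions X"
  shows "function_action G a X g f \<in> test_functions X"
proof (rule test_functionsI[of X "a g ` {z. f z \<noteq> 0}"])
  have "compactin X {z. f z \<noteq> 0}"
    using test_functions_support[OF f] by (simp add: compact_open_def)
  then show "compactin X (a g ` {z. f z \<noteq> 0})"
    using homeomorphic_map_action[OF g] homeomorphic_imp_continuous_map image_compactin by blast
next
  fix z assume z: "z \<notin> a g ` {z. f z \<noteq> 0}"
  show "function_action G a X g f z = 0"
  proof (cases "z \<in> topspace X")
    case True
    then have "z = a g (a (inv g) z)" using g by simp
    then show ?thesis using z True by (auto simp: function_action_def)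
  qed (simp add: function_action_def)
next
  fix z assume z: "z \<in> topspace X"
  have "a (inv g) z \<in> topspace X" using g z by simp
  then obtain U c where U: "openin X U" "a (inv g) z \<in> U" "\<And>y. y \<in> U \<Longrightarrow> f y = c"
    by (rule test_functions_locally_constant[OF f]) blast
  have "continuous_map X X (a (inv g))"
    using homeomorphic_map_action[of "inv g"] g homeomorphic_imp_continuous_map by simp
  then have "openin X {y \<in> topspace X. a (inv g) y \<in> U}"
    using U(1) by (rule openin_continuous_map_preimage)
  then show "\<exists>U c. openin X U \<and> z \<in> U \<and> (\<forall>y\<in>U. function_action G a X g f y = c)"
    using U z by (intro exI[of _ "{y \<in> topspace X. a (inv g) y \<in> U}"] exI[of _ c])
      (auto simp: function_action_def)
qed

lemma function_action_mult:
  assumes "g \<in> carrier G" "h \<in> carrier G"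
  shows "function_action G a X (g \<otimes> h) f = function_action G a X g (function_action G a X h f)"
  using assms by (auto simp: function_action_def fun_eq_iff inv_mult_group action_mult)

lemma function_action_one:
  "f \<in> test_functions X \<Longrightarrow> function_action G a X \<one> f = f"
  by (auto simp: function_action_def fun_eq_iff test_functions_outside)

lemma function_action_inv:
  assumes "g \<in> carrier G" "f \<in> test_functions X"
  shows "function_action G a X g (function_action G a X (inv g) f) = f"
    "function_action G a X (inv g) (function_action G a X g f) = f"
  using assms by (simp_all add: function_action_mult[symmetric] function_action_one)

definition invariant_under :: "'a set \<Rightarrow> ('x \<Rightarrow> complex) \<Rightarrow> bool" where
  "invariant_under K f \<longleftrightarrow> (\<forall>k\<in>K. \<forall>z\<in>topspace X. f (a k z) = f z)"

lemma invariant_underD: "invariant_under K f \<Longrightarrow> k \<in> K \<Longrightarrow> z \<in> topspace X \<Longrightarrow> f (a k z) = f z"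
  by (simp add: invariant_under_def)

lemma invariant_under_mono: "invariant_under K f \<Longrightarrow> L \<subseteq> K \<Longrightarrow> invariant_under L f"
  by (auto simp: invariant_under_def)

lemma function_action_invariant:
  assumes K: "subgroup K G" "k \<in> K" and f: "f \<in> test_functions X" "invariant_under K f"
  shows "function_action G a X k f = f"
proof
  fix z show "function_action G a X k f z = f z"
    using invariant_underD[OF f(2) subgroup.m_inv_closed[OF K], of z] test_functions_outside[OF f(1), of z]
    by (simp add: function_action_def)
qed

lemma invariant_under_function_action:
  assumes g: "g \<in> carrier G" and K: "K \<subseteq> carrier G" and f: "invariant_under K f"
  shows "invariant_under (g <# K #> inv g) (function_action G a X g f)"
  unfolding invariant_under_def
proof (intro ballI)
  fix h z assume h: "h \<in> g <# K #> inv g" and z: "z \<in> topspace X"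
  then obtain k where k: "k \<in> K" "h = g \<otimes> k \<otimes> inv g"
    by (auto simp: l_coset_def r_coset_def)
  have kG: "k \<in> carrier G" using k(1) K by blast
  have "a (inv g) (a h z) = a k (a (inv g) z)"
    using g kG z unfolding k(2) by (simp add: action_mult)
  moreover have "f (a k (a (inv g) z)) = f (a (inv g) z)"
    using invariant_underD[OF f k(1)] g z by simp
  ultimately show "function_action G a X g f (a h z) = function_action G a X g f z"
    using g kG z k(2) by (simp add: function_action_def)
qed

text \<open>Each of the finitely many nonzero levels is compact open and hence has a stabilizing
  neighbourhood of \<open>\<one>\<close>; \<open>K\<close> is chosen inside their intersection. The
  zero level is not compact and is treated indirectly: if \<open>k\<close> moved a zero to a nonzero
  value, \<open>inv k\<close> would have to preserve that value on the way back.\<close>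

lemma test_function_invariant:
  assumes f: "f \<in> test_functions X" and W: "openin T W" "\<one> \<in> W"
  obtains K where "compact_open_subgroup K" "K \<subseteq> W" "invariant_under K f"
proof -
  have level: "compact_open X {z. f z = c}" if "c \<noteq> 0" for c
    using test_functions_vimage_compact_open[OF f, of "{c}"] that by simp
  have ex: "\<exists>N. openin T N \<and> \<one> \<in> N \<and> (\<forall>g\<in>N. inv g \<in> N) \<and> (\<forall>g\<in>N. \<forall>z. f z = c \<longrightarrow> f (a g z) = c)"
    if c: "c \<noteq> 0" for c
  proof -
    have "a \<one> z = z" if "z \<in> {z. f z = c}" for z
      using that compact_open_subset[OF level[OF c]] by (intro action_one) blast
    then obtain N where "openin T N" "\<one> \<in> N" "\<And>g. g \<in> N \<Longrightarrow> inv g \<in> N"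
        "\<And>g z. g \<in> N \<Longrightarrow> z \<in> {z. f z = c} \<Longrightarrow> a g z \<in> {z. f z = c}"
      by (rule stabilizing_neighbourhood[OF continuous_map_action level[OF c]]) blast+
    then show ?thesis by (intro exI[of _ N]) simp
  qed
  define N where "N c = (SOME N. openin T N \<and> \<one> \<in> N \<and> (\<forall>g\<in>N. inv g \<in> N) \<and>
      (\<forall>g\<in>N. \<forall>z. f z = c \<longrightarrow> f (a g z) = c))" for c
  have N: "openin T (N c) \<and> \<one> \<in> N c \<and> (\<forall>g\<in>N c. inv g \<in> N c) \<and>
      (\<forall>g\<in>N c. \<forall>z. f z = c \<longrightarrow> f (a g z) = c)" if "c \<noteq> 0" for c
    unfolding N_def using ex[OF that] by (rule someI_ex)
  let ?N = "\<Inter>(insert W (N ` (range f - {0})))"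
  have "openin T ?N"
    using test_functions_finite_range[OF f] N W(1) by (intro openin_Inter) auto
  moreover have "\<one> \<in> ?N" using W(2) N by simp
  ultimately obtain K where K: "compact_open_subgroup K" "K \<subseteq> ?N"
    by (rule compact_open_subgroup_basis)
  have level: "f (a k z) = f z" if "k \<in> K" "f z \<noteq> 0" for k z
  proof -
    have "N (f z) \<in> insert W (N ` (range f - {0}))" using that(2) by simp
    then have "k \<in> N (f z)" using K(2) that(1) by blast
    then show ?thesis using N[OF that(2)] by simp
  qed
  have "f (a k z) = f z" if k: "k \<in> K" and z: "z \<in> topspace X" for k z
  proof (cases "f z = 0")
    case True
    have "f (a (inv k) (a k z)) = f (a k z)" if "f (a k z) \<noteq> 0"
      using compact_open_subgroup_closed(2)[OF K(1) k] that by (rule level)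
    moreover have "a (inv k) (a k z) = z"
      using compact_open_subgroup_closed(1)[OF K(1) k] z by simp
    ultimately show ?thesis using True by (cases "f (a k z) = 0") simp_all
  next
    case False
    with k show ?thesis by (rule level)
  qed
  then have "invariant_under K f" by (simp add: invariant_under_def)
  with K show thesis by (intro that[of K]) simp_all
qed

end

text \<open>Every compact piece of the group is covered by finitely many of the open cosets of
  \<open>K\<close>. This countability is what sigma-compactness contributes to the Baire
  argument.\<close>

lemma (in lctd_topological_group) countable_cosets:
  assumes "sigma_compact_space T" and K: "compact_open_subgroup K"
  obtains D where "countable D" "D \<subseteq> carrier G" "carrier G = (\<Union>d\<in>D. d <# K)"
proof -
  obtain C :: "nat \<Rightarrow> _" where C: "\<And>n. compactin T (C n)" "topspace T = (\<Union>n. C n)"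
    using assms(1) unfolding sigma_compact_space_def by blast
  have "\<exists>F. finite F \<and> F \<subseteq> carrier G \<and> C n \<subseteq> (\<Union>d\<in>F. d <# K)" for n
  proof -
    have "\<exists>\<F>. finite \<F> \<and> \<F> \<subseteq> (\<lambda>d. d <# K) ` carrier G \<and> C n \<subseteq> \<Union>\<F>"
    proof (rule compactinD[OF C(1)])
      show "openin T U" if "U \<in> (\<lambda>d. d <# K) ` carrier G" for U
        using that openin_l_coset[OF _ compact_open_subgroupD(3)[OF K]] by blast
      show "C n \<subseteq> (\<Union>d\<in>carrier G. d <# K)"
      proof
        fix g assume "g \<in> C n"
        then have "g \<in> carrier G" using C(2) topspace_T by blast
        then have "g \<in> g <# K" using compact_open_subgroupD(6)[OF K] by (rule l_coset_self)
        with \<open>g \<in> carrier G\<close> show "g \<in> (\<Union>d\<in>carrier G. d <# K)" by (rule UN_I)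
      qed
    qed
    then obtain \<F> where \<F>: "finite \<F>" "\<F> \<subseteq> (\<lambda>d. d <# K) ` carrier G" "C n \<subseteq> \<Union>\<F>" by blast
    show ?thesis using finite_subset_image[OF \<F>(1,2)] \<F>(3) by blast
  qed
  then obtain F where F: "\<And>n. finite (F n) \<and> F n \<subseteq> carrier G \<and> C n \<subseteq> (\<Union>d\<in>F n. d <# K)"
    by metis
  show thesis
  proof (rule that[of "\<Union>n. F n"])
    show "countable (\<Union>n. F n)" using F by (simp add: countable_finite)
    show "(\<Union>n. F n) \<subseteq> carrier G" using F by blast
    have "d <# K \<subseteq> carrier G" if "d \<in> carrier G" for d
      using that compact_open_subgroupD(5)[OF K] by (rule l_coset_subset_G[rotated])
    then have 1: "(\<Union>d\<in>\<Union>n. F n. d <# K) \<subseteq> carrier G" using F by blast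
    have 2: "g \<in> (\<Union>d\<in>\<Union>n. F n. d <# K)" if "g \<in> carrier G" for g
    proof -
      have "g \<in> (\<Union>n. C n)" using that C(2) topspace_T by simp
      then obtain n where n: "g \<in> C n" by blast
      have "C n \<subseteq> (\<Union>d\<in>F n. d <# K)" using F[of n] by simp
      then obtain d where "d \<in> F n" "g \<in> d <# K" using n by blast
      then show ?thesis by (intro UN_I[of d]) auto
    qed
    show "carrier G = (\<Union>d\<in>\<Union>n. F n. d <# K)" by (rule equalityI[OF subsetI[OF 2] 1])
  qed
qed

text \<open>Baire's theorem produces a translate of some \<open>K y\<close> with nonempty interior in \<open>C\<close>.\<close>

lemma (in lctd_action) open_partial_orbit:
  assumes sigma: "sigma_compact_space T" and K: "compact_open_subgroup K"
    and C: "C \<subseteq> topspace X" "locally_compact_space (subtopology X C)" "C \<noteq> {}"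
    and stable: "\<And>g z. g \<in> carrier G \<Longrightarrow> z \<in> C \<Longrightarrow> a g z \<in> C"
    and Y: "countable Y" "Y \<subseteq> C" "C \<subseteq> (\<Union>y\<in>Y. orbit G a y)"
  obtains y where "y \<in> Y" "openin (subtopology X C) (partial_orbit K y)"
proof -
  note KD = compact_open_subgroupD[OF K]
  interpret K: subgroup K G by (rule KD(1))
  obtain D where D: "countable D" "D \<subseteq> carrier G" "carrier G = (\<Union>d\<in>D. d <# K)"
    by (rule countable_cosets[OF sigma K])
  let ?C = "subtopology X C"
  let ?\<G> = "(\<lambda>(d, y). a d ` partial_orbit K y) ` (D \<times> Y)"
  have topC: "topspace ?C = C" using C(1) by auto
  have Htop: "Hausdorff_space ?C" using Hausdorff_X by (rule Hausdorff_space_subtopology)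
  have sub: "a d ` partial_orbit K y \<subseteq> C" if "d \<in> carrier G" "y \<in> C" for d y
    using that stable by (auto simp: partial_orbit_def)
  have "\<Union>?\<G> = C"
  proof
    show "\<Union>?\<G> \<subseteq> C" using sub D(2) Y(2) by blast
    show "C \<subseteq> \<Union>?\<G>"
    proof
      fix z assume "z \<in> C"
      then obtain y g where y: "y \<in> Y" "g \<in> carrier G" "z = a g y"
        using Y(3) by (auto simp: orbit_def)
      then obtain d k where d: "d \<in> D" "k \<in> K" "g = d \<otimes> k"
        using D(3) by (auto simp: l_coset_def)
      have "y \<in> topspace X" using y Y(2) C(1) by blast
      then have "z = a d (a k y)" using y d D(2) by (simp add: action_mult subset_iff)
      then have "z \<in> a d ` partial_orbit K y" using d(2) by (simp add: partial_orbit_def)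
      then show "z \<in> \<Union>?\<G>" using d(1) y(1) by auto
    qed
  qed
  have closed: "closedin ?C A" if A: "A \<in> ?\<G>" for A
  proof -
    obtain d y where dy: "d \<in> D" "y \<in> Y" "A = a d ` partial_orbit K y" using A by auto
    have d: "d \<in> carrier G" and y: "y \<in> C" using dy D(2) Y(2) by auto
    have "compactin X A"
      unfolding dy(3) using homeomorphic_map_action[OF d] y C(1) KD(4)
      by (intro image_compactin[OF compactin_partial_orbit] homeomorphic_imp_continuous_map) auto
    then have "compactin ?C A" using sub[OF d y] dy(3) by (simp add: compactin_subtopology)
    then show ?thesis by (rule compactin_imp_closedin[OF Htop])
  qed
  have "\<exists>A\<in>?\<G>. ?C interior_of A \<noteq> {}"
  proof (rule ccontr)
    assume "\<not> ?thesis"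
    then have interior: "?C interior_of A = {}" if "A \<in> ?\<G>" for A using that by blast
    have "?C interior_of \<Union>?\<G> = {}"
    proof (rule Baire_category_alt)
      show "completely_metrizable_space ?C \<or> locally_compact_space ?C \<and> regular_space ?C"
        using C(2) locally_compact_Hausdorff_imp_regular_space[OF C(2) Htop] by simp
      show "countable ?\<G>" using D(1) Y(1) by (intro countable_image countable_SIGMA)
      show "closedin ?C A \<and> ?C interior_of A = {}" if "A \<in> ?\<G>" for A
        using closed[OF that] interior[OF that] by simp
    qed
    then show False
      using \<open>\<Union>?\<G> = C\<close> C(3) interior_of_topspace[of ?C] topC by simp
  qed
  then obtain d y z where dy: "d \<in> D" "y \<in> Y" and z: "z \<in> ?C interior_of (a d ` partial_orbit K y)"
    by auto
  have d: "d \<in> carrier G" and y: "y \<in> C" "y \<in> topspace X" using dy D(2) Y(2) C(1) by auto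
  obtain V where V: "openin ?C V" "z \<in> V" "V \<subseteq> a d ` partial_orbit K y"
    using z interior_of_subset openin_interior_of by (metis (no_types))
  obtain W where W: "openin X W" "V = W \<inter> C" using V(1) by (auto simp: openin_subtopology)
  obtain k0 where k0: "k0 \<in> K" "z = a d (a k0 y)" using V(2,3) by (auto simp: partial_orbit_def)
  have "openin ?C (partial_orbit K y)"
  proof (subst openin_subopen, intro ballI)
    fix w assume "w \<in> partial_orbit K y"
    then obtain k where k: "k \<in> K" "w = a k y" by (auto simp: partial_orbit_def)
    \<comment> \<open>This \<open>g\<close> carries the interior point \<open>z\<close>, which is
      \<open>d k0 y\<close>, to the given point \<open>w\<close>, which is \<open>k y\<close>, and
      maps the translate \<open>d K y\<close> back onto \<open>K y\<close>. Openness near one point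
      of the translate thus becomes openness of \<open>K y\<close> near each of its points.\<close>
    define g where "g = k \<otimes> inv k0 \<otimes> inv d"
    have g: "g \<in> carrier G" using k k0 d by (simp add: g_def)
    have gd: "a g (a d v) = a (k \<otimes> inv k0) v" if "v \<in> topspace X" for v
      using that k k0 d unfolding g_def by (simp add: action_mult)
    have "w = a g z" using k k0 y gd[of "a k0 y"] by (simp add: action_mult)
    have "openin X (a g ` W)"
      using homeomorphic_map_openness[OF homeomorphic_map_action[OF g]] W(1) openin_subset by blast
    then have "openin ?C (a g ` W \<inter> C)" by (auto simp: openin_subtopology)
    moreover have "w \<in> a g ` W \<inter> C"
      using \<open>w = a g z\<close> V(2) W(2) g stable[of g z] by auto
    moreover have "a g ` W \<inter> C \<subseteq> partial_orbit K y"
    proof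
      fix u assume u: "u \<in> a g ` W \<inter> C"
      then obtain v where v: "v \<in> W" "u = a g v" by blast
      have vX: "v \<in> topspace X" using v(1) openin_subset[OF W(1)] by blast
      then have "v = a (inv g) u" using v(2) g by simp
      then have "v \<in> C" using stable[of "inv g" u] g u by simp
      then have "v \<in> a d ` partial_orbit K y" using v(1) W(2) V(3) by blast
      then obtain l where l: "l \<in> K" "v = a d (a l y)" by (auto simp: partial_orbit_def)
      have "u = a (k \<otimes> inv k0 \<otimes> l) y"
        using v(2) l gd[of "a l y"] y k k0 by (simp add: action_mult)
      then show "u \<in> partial_orbit K y" using k k0 l by (simp add: partial_orbit_def)
    qed
    ultimately show "\<exists>S. openin ?C S \<and> w \<in> S \<and> S \<subseteq> partial_orbit K y" by blast
  qed
  with dy(2) show thesis by (rule that)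
qed

section \<open>Radon measures from contents on compact open sets\<close>

text \<open>Finite additivity is a sufficient axiom here because compactness turns any countable
  open cover of a compact open set into a finite one, so countable subadditivity comes for
  free.\<close>

locale compact_open_content =
  fixes T :: "'a topology" and m :: "'a set \<Rightarrow> real"
  assumes lctd: "lctd_space T"
    and nonneg: "compact_open T A \<Longrightarrow> 0 \<le> m A"
    and additive: "compact_open T A \<Longrightarrow> compact_open T B \<Longrightarrow> A \<inter> B = {} \<Longrightarrow> m (A \<union> B) = m A + m B"
begin

lemma Hausdorff: "Hausdorff_space T"
  using lctd by (rule lctd_space_Hausdorff)

lemma content_empty [simp]: "m {} = 0"
  using additive[of "{}" "{}"] by simp

lemma content_mono:
  assumes "compact_open T A" "compact_open T B" "A \<subseteq> B" shows "m A \<le> m B"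
proof -
  have "compact_open T (B - A)" using Hausdorff assms(2,1) by (rule compact_open_diff)
  moreover have "A \<union> (B - A) = B" using assms(3) by blast
  ultimately show ?thesis using additive[of A "B - A"] nonneg[of "B - A"] assms(1) by simp
qed

lemma content_subadditive:
  assumes "compact_open T A" "compact_open T B" shows "m (A \<union> B) \<le> m A + m B"
proof -
  have "compact_open T (B - A)" using Hausdorff assms(2,1) by (rule compact_open_diff)
  then have "m (A \<union> (B - A)) = m A + m (B - A)" using assms(1) by (intro additive) auto
  moreover have "m (B - A) \<le> m B" using \<open>compact_open T (B - A)\<close> assms(2) by (intro content_mono) auto
  ultimately show ?thesis by simp
qed

lemma content_finite_subadditive:
  assumes "finite I" "\<And>i. i \<in> I \<Longrightarrow> compact_open T (A i)"
  shows "m (\<Union>i\<in>I. A i) \<le> (\<Sum>i\<in>I. m (A i))"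
  using assms
proof (induction I rule: finite_induct)
  case (insert i I)
  have "m (A i \<union> (\<Union>i\<in>I. A i)) \<le> m (A i) + m (\<Union>i\<in>I. A i)"
    using insert by (intro content_subadditive compact_open_Union) auto
  then show ?case using insert by simp
qed simp

text \<open>Open sets are measured from inside by compact open sets, and then arbitrary sets from
  outside by open sets. This order builds in exactly the two regularity properties required of a
  Haar measure.\<close>

definition inner_content :: "'a set \<Rightarrow> ennreal" where
  "inner_content U = (SUP A\<in>{A. compact_open T A \<and> A \<subseteq> U}. ennreal (m A))"

definition outer_content :: "'a set \<Rightarrow> ennreal" where
  "outer_content E = (INF U\<in>{U. openin T U \<and> E \<subseteq> U}. inner_content U)"

lemma inner_content_upper: "compact_open T A \<Longrightarrow> A \<subseteq> U \<Longrightarrow> ennreal (m A) \<le> inner_content U"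
  unfolding inner_content_def by (intro SUP_upper) simp

lemma inner_content_least:
  "(\<And>A. compact_open T A \<Longrightarrow> A \<subseteq> U \<Longrightarrow> ennreal (m A) \<le> c) \<Longrightarrow> inner_content U \<le> c"
  unfolding inner_content_def by (intro SUP_least) simp

lemma inner_content_mono: "U \<subseteq> V \<Longrightarrow> inner_content U \<le> inner_content V"
  by (intro inner_content_least inner_content_upper) auto

lemma inner_content_compact_open: "compact_open T A \<Longrightarrow> inner_content A = ennreal (m A)"
  by (intro antisym inner_content_least inner_content_upper ennreal_leI content_mono) auto

lemma outer_content_lower: "openin T U \<Longrightarrow> E \<subseteq> U \<Longrightarrow> outer_content E \<le> inner_content U"
  unfolding outer_content_def by (intro INF_lower) simp

lemma outer_content_greatest:
  "(\<And>U. openin T U \<Longrightarrow> E \<subseteq> U \<Longrightarrow> c \<le> inner_content U) \<Longrightarrow> c \<le> outer_content E"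
  unfolding outer_content_def by (intro INF_greatest) simp

lemma outer_content_openin: "openin T U \<Longrightarrow> outer_content U = inner_content U"
  by (intro antisym outer_content_lower outer_content_greatest inner_content_mono) auto

lemma outer_content_mono: "E \<subseteq> F \<Longrightarrow> outer_content E \<le> outer_content F"
  by (intro outer_content_greatest outer_content_lower) auto

lemma outer_content_compact_open: "compact_open T A \<Longrightarrow> outer_content A = ennreal (m A)"
  by (simp add: outer_content_openin inner_content_compact_open compact_open_def)

lemma inner_content_countably_subadditive:
  fixes U :: "nat \<Rightarrow> 'a set"
  assumes U: "\<And>n. openin T (U n)"
  shows "inner_content (\<Union>n. U n) \<le> (\<Sum>n. inner_content (U n))"
proof (rule inner_content_least)
  fix C assume C: "compact_open T C" "C \<subseteq> (\<Union>n. U n)"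
  obtain \<B> where \<B>: "finite \<B>" "C \<subseteq> \<Union>\<B>"
      "\<And>B. B \<in> \<B> \<Longrightarrow> compact_open T B \<and> B \<subseteq> (\<Union>n. U n) \<and> (\<exists>n. B \<subseteq> U n)"
  proof (rule compact_open_cover[of T C "\<Union>n. U n" "\<lambda>B. \<exists>n. B \<subseteq> U n"])
    show "compactin T C" "C \<subseteq> (\<Union>n. U n)" using C by (simp_all add: compact_open_def)
    show "openin T (\<Union>n. U n)" using U by (intro openin_Union) auto
    fix z assume "z \<in> C"
    then obtain n where n: "z \<in> U n" using C(2) by blast
    obtain B where "compact_open T B" "z \<in> B" "B \<subseteq> U n"
      by (rule lctd_space_compact_open_basis[OF lctd U n])
    then show "\<exists>B. compact_open T B \<and> z \<in> B \<and> B \<subseteq> (\<Union>n. U n) \<and> (\<exists>n. B \<subseteq> U n)" by blast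
  qed blast
  define N where "N B = (SOME n. B \<subseteq> U n)" for B
  have N: "B \<subseteq> U (N B)" if "B \<in> \<B>" for B
    unfolding N_def using \<B>(3)[OF that] by (intro someI_ex[of "\<lambda>n. B \<subseteq> U n"]) simp
  \<comment> \<open>Pieces with the same chosen index are merged, so that each \<open>U n\<close> is
    charged only once in the final sum.\<close>
  define A where "A n = \<Union>{B \<in> \<B>. N B = n}" for n
  have A: "compact_open T (A n)" for n
    unfolding A_def using \<B>(1,3) by (intro compact_open_Union) auto
  have AU: "A n \<subseteq> U n" for n unfolding A_def using N by blast
  have "C \<subseteq> (\<Union>n\<in>N ` \<B>. A n)" unfolding A_def using \<B>(2) by blast
  then have "m C \<le> m (\<Union>n\<in>N ` \<B>. A n)"
    using C(1) A \<B>(1) by (intro content_mono compact_open_Union) auto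
  also have "\<dots> \<le> (\<Sum>n\<in>N ` \<B>. m (A n))"
    using A \<B>(1) by (intro content_finite_subadditive) auto
  finally have "ennreal (m C) \<le> ennreal (\<Sum>n\<in>N ` \<B>. m (A n))" by (rule ennreal_leI)
  also have "\<dots> = (\<Sum>n\<in>N ` \<B>. ennreal (m (A n)))"
    using nonneg[OF A] by (intro sum_ennreal[symmetric]) auto
  also have "\<dots> \<le> (\<Sum>n\<in>N ` \<B>. inner_content (U n))"
    using A AU by (intro sum_mono inner_content_upper)
  also have "\<dots> \<le> (\<Sum>n. inner_content (U n))"
    using \<B>(1) by (intro sum_le_suminf) auto
  finally show "ennreal (m C) \<le> (\<Sum>n. inner_content (U n))" .
qed

lemma outer_content_close:
  assumes "outer_content E < e"
  shows "\<exists>U. openin T U \<and> E \<subseteq> U \<and> inner_content U < e"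
  using assms unfolding outer_content_def INF_less_iff by auto

lemma outer_measure_space_outer_content: "outer_measure_space (Pow (topspace T)) outer_content"
  unfolding outer_measure_space_def
proof (intro conjI)
  show "positive (Pow (topspace T)) outer_content"
    using outer_content_compact_open[of "{}"] by (simp add: positive_def)
  show "increasing (Pow (topspace T)) outer_content"
    by (auto simp: increasing_def intro: outer_content_mono)
  show "countably_subadditive (Pow (topspace T)) outer_content"
    unfolding countably_subadditive_def
  proof (intro allI impI)
    fix A :: "nat \<Rightarrow> 'a set"
    show "outer_content (\<Union>i. A i) \<le> (\<Sum>i. outer_content (A i))"
    proof (rule ennreal_le_epsilon)
      fix e :: real assume e: "0 < e" "(\<Sum>n. outer_content (A n)) < top_class.top"
      \<comment> \<open>The error is distributed as \<open>e / 2^(n+1)\<close>. Finiteness of the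
        sum makes each summand finite, which is what the strict inequality requires.\<close>
      then have *: "outer_content (A n) < outer_content (A n) + e * (1/2)^Suc n" for n
        by (auto simp add: less_top dest!: ennreal_suminf_lessD)
      have "\<forall>n. \<exists>U. openin T U \<and> A n \<subseteq> U \<and> inner_content U < outer_content (A n) + e * (1/2)^Suc n"
        by (intro allI outer_content_close[OF *])
      from choice[OF this] obtain U where "\<forall>n. openin T (U n) \<and> A n \<subseteq> U n \<and>
          inner_content (U n) < outer_content (A n) + e * (1/2)^Suc n"
        by blast
      then have U: "\<And>n. openin T (U n)" "\<And>n. A n \<subseteq> U n"
          "\<And>n. inner_content (U n) < outer_content (A n) + e * (1/2)^Suc n"
        by blast+
      have "outer_content (\<Union>i. A i) \<le> inner_content (\<Union>i. U i)"
        using U(1,2) by (intro outer_content_lower openin_Union) auto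
      also have "\<dots> \<le> (\<Sum>n. inner_content (U n))"
        using U(1) by (rule inner_content_countably_subadditive)
      also have "\<dots> \<le> (\<Sum>n. outer_content (A n) + e * (1/2) ^ Suc n)"
        using U(3) by (intro suminf_le less_imp_le) auto
      also have "\<dots> = (\<Sum>n. outer_content (A n)) + (\<Sum>n. ennreal e * ennreal ((1/2) ^ Suc n))"
        using e(1) by (subst suminf_add[symmetric])
          (auto simp del: ennreal_suminf_cmult simp add: ennreal_mult[symmetric])
      also have "\<dots> = (\<Sum>n. outer_content (A n)) + e"
        unfolding ennreal_suminf_cmult
        by (subst suminf_ennreal_eq[OF zero_le_power power_half_series]) auto
      finally show "outer_content (\<Union>i. A i) \<le> (\<Sum>n. outer_content (A n)) + e" .
    qed
  qed
qed

text \<open>For an open \<open>V\<close> around \<open>E\<close>, first \<open>V \<inter> U\<close>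
  is approximated from inside by a compact open \<open>A\<close>. As \<open>A\<close> is closed,
  \<open>V - A\<close> is an open set containing \<open>V - U\<close>, and it is approximated by a
  compact open \<open>B\<close>. Then \<open>A\<close> and \<open>B\<close> are disjoint subsets of
  \<open>V\<close>, and additivity bounds the sum of their contents by the content of
  \<open>V\<close>.\<close>

lemma openin_in_lambda_system:
  assumes U: "openin T U"
  shows "U \<in> lambda_system (topspace T) (Pow (topspace T)) outer_content"
proof -
  have sub: "subadditive (Pow (topspace T)) outer_content"
    using outer_measure_space_outer_content unfolding outer_measure_space_def
    by (auto intro!: ring_of_sets.countably_subadditive_subadditive algebra.axioms(1) algebra_Pow)
  have "outer_content (E \<inter> U) + outer_content (E - U) = outer_content E" if E: "E \<subseteq> topspace T" for E
  proof (rule antisym)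
    show "outer_content (E \<inter> U) + outer_content (E - U) \<le> outer_content E"
    proof (rule outer_content_greatest)
      fix V assume V: "openin T V" "E \<subseteq> V"
      have "outer_content (E \<inter> U) + outer_content (E - U) \<le> inner_content (V \<inter> U) + outer_content (V - U)"
        using V U by (intro add_mono outer_content_lower outer_content_mono) auto
      also have "\<dots> = (SUP A\<in>{A. compact_open T A \<and> A \<subseteq> V \<inter> U}. ennreal (m A) + outer_content (V - U))"
        unfolding inner_content_def
        by (intro ennreal_SUP_add_left[symmetric]) (auto intro: exI[of _ "{}"])
      also have "\<dots> \<le> inner_content V"
      proof (intro SUP_least)
        fix A assume "A \<in> {A. compact_open T A \<and> A \<subseteq> V \<inter> U}"
        then have A: "compact_open T A" "A \<subseteq> V" "A \<subseteq> U" by auto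
        have "openin T (V - A)"
          using V(1) compact_open_closedin[OF Hausdorff A(1)] by blast
        then have "outer_content (V - U) \<le> inner_content (V - A)"
          using A by (intro outer_content_lower) auto
        then have "ennreal (m A) + outer_content (V - U) \<le> ennreal (m A) + inner_content (V - A)"
          by (rule add_left_mono)
        also have "\<dots> = (SUP B\<in>{B. compact_open T B \<and> B \<subseteq> V - A}. ennreal (m A) + ennreal (m B))"
          unfolding inner_content_def
          by (intro ennreal_SUP_add_right) (auto intro: exI[of _ "{}"])
        also have "\<dots> \<le> inner_content V"
        proof (intro SUP_least)
          fix B assume "B \<in> {B. compact_open T B \<and> B \<subseteq> V - A}"
          then have B: "compact_open T B" "B \<subseteq> V - A" by auto
          have "ennreal (m A) + ennreal (m B) = ennreal (m (A \<union> B))"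
            using A B nonneg by (subst additive) (auto simp: ennreal_plus)
          also have "\<dots> \<le> inner_content V"
            using A B by (intro inner_content_upper compact_open_Un) auto
          finally show "ennreal (m A) + ennreal (m B) \<le> inner_content V" .
        qed
        finally show "ennreal (m A) + outer_content (V - U) \<le> inner_content V" .
      qed
      finally show "outer_content (E \<inter> U) + outer_content (E - U) \<le> inner_content V" .
    qed
    have "outer_content ((E \<inter> U) \<union> (E - U)) \<le> outer_content (E \<inter> U) + outer_content (E - U)"
      using E by (intro subadditiveD[OF sub]) auto
    moreover have "(E \<inter> U) \<union> (E - U) = E" by blast
    ultimately show "outer_content E \<le> outer_content (E \<inter> U) + outer_content (E - U)" by simp
  qed
  then show ?thesis
    using openin_subset[OF U] by (simp add: algebra.lambda_system_eq[OF algebra_Pow])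
qed

definition content_measure :: "'a measure" where
  "content_measure =
     measure_of (topspace T) (sigma_sets (topspace T) {U. openin T U}) outer_content"

lemma open_sets_Pow: "{U. openin T U} \<subseteq> Pow (topspace T)"
  using openin_subset by blast

lemma sets_content_measure:
  "sets content_measure = sigma_sets (topspace T) {U. openin T U}"
  unfolding content_measure_def
  by (rule sigma_algebra.sets_measure_of_eq[OF sigma_algebra_sigma_sets[OF open_sets_Pow]])

lemma sigma_algebra_open_sets:
  "sigma_algebra (topspace T) (sigma_sets (topspace T) {U. openin T U})"
  by (rule sigma_algebra_sigma_sets[OF open_sets_Pow])

lemma emeasure_content_measure:
  assumes "E \<in> sets content_measure" shows "emeasure content_measure E = outer_content E"
proof -
  let ?L = "lambda_system (topspace T) (Pow (topspace T)) outer_content"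
  let ?\<S> = "sigma_sets (topspace T) {U. openin T U}"
  have ms: "measure_space (topspace T) ?L outer_content"
    by (rule sigma_algebra.caratheodory_lemma[OF sigma_algebra_Pow outer_measure_space_outer_content])
  then have L: "sigma_algebra (topspace T) ?L" and ca: "countably_additive ?L outer_content"
    by (simp_all add: measure_space_def)
  have "?\<S> \<subseteq> ?L"
    using openin_in_lambda_system by (intro sigma_algebra.sigma_sets_subset[OF L]) auto
  then have "countably_additive ?\<S> outer_content"
    using ca unfolding countably_additive_def by (meson order_trans subsetD)
  moreover have "positive ?\<S> outer_content"
    using outer_content_compact_open[of "{}"] by (simp add: positive_def)
  moreover have "E \<in> ?\<S>" using assms sets_content_measure by simp
  ultimately show ?thesis
    unfolding content_measure_def by (intro emeasure_measure_of_sigma[OF sigma_algebra_open_sets])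
qed

lemma openin_sets_content_measure: "openin T U \<Longrightarrow> U \<in> sets content_measure"
  unfolding sets_content_measure by (rule sigma_sets.Basic) simp

lemma emeasure_content_measure_compact_open:
  "compact_open T A \<Longrightarrow> emeasure content_measure A = ennreal (m A)"
  using outer_content_compact_open[of A] emeasure_content_measure[of A]
    openin_sets_content_measure[of A]
  by (simp add: compact_open_def)

lemma emeasure_content_measure_compactin:
  assumes "compactin T K" shows "emeasure content_measure K < \<infinity>"
proof -
  obtain A where A: "compact_open T A" "K \<subseteq> A"
    by (rule lctd_space_compact_open_between[OF lctd assms openin_topspace
          compactin_subset_topspace[OF assms]])
  have "emeasure content_measure K \<le> emeasure content_measure A"
    using A by (intro emeasure_mono openin_sets_content_measure) (auto simp: compact_open_def)
  also have "\<dots> < \<infinity>" using A(1) by (simp add: emeasure_content_measure_compact_open)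
  finally show ?thesis .
qed

lemma content_measure_outer_regular:
  assumes "E \<in> sets content_measure"
  shows "emeasure content_measure E =
    (INF U\<in>{U. openin T U \<and> E \<subseteq> U}. emeasure content_measure U)"
proof -
  have "(INF U\<in>{U. openin T U \<and> E \<subseteq> U}. emeasure content_measure U) =
      (INF U\<in>{U. openin T U \<and> E \<subseteq> U}. inner_content U)"
    by (intro INF_cong)
      (auto simp: emeasure_content_measure openin_sets_content_measure outer_content_openin)
  then show ?thesis
    using emeasure_content_measure[OF assms] by (simp add: outer_content_def)
qed

lemma content_measure_inner_regular:
  assumes U: "openin T U"
  shows "emeasure content_measure U =
    (SUP K\<in>{K. compactin T K \<and> K \<subseteq> U}. emeasure content_measure K)"
proof (rule antisym)
  have "emeasure content_measure U = inner_content U"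
    using U by (simp add: emeasure_content_measure openin_sets_content_measure outer_content_openin)
  also have "\<dots> \<le> (SUP K\<in>{K. compactin T K \<and> K \<subseteq> U}. emeasure content_measure K)"
  proof (rule inner_content_least)
    fix A assume "compact_open T A" "A \<subseteq> U"
    then show "ennreal (m A) \<le> (SUP K\<in>{K. compactin T K \<and> K \<subseteq> U}. emeasure content_measure K)"
      by (intro SUP_upper2[of A])
        (auto simp: emeasure_content_measure_compact_open, simp add: compact_open_def)
  qed
  finally show "emeasure content_measure U \<le>
      (SUP K\<in>{K. compactin T K \<and> K \<subseteq> U}. emeasure content_measure K)" .
  show "(SUP K\<in>{K. compactin T K \<and> K \<subseteq> U}. emeasure content_measure K) \<le> emeasure content_measure U"
    using openin_sets_content_measure[OF U] by (intro SUP_least emeasure_mono) auto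
qed

lemma homeomorphic_image_sets:
  assumes t: "homeomorphic_map T T t" and E: "E \<in> sets content_measure"
  shows "t ` E \<in> sets content_measure"
  using E unfolding sets_content_measure
proof (induction rule: sigma_sets.induct)
  case (Basic U)
  then show ?case
    using homeomorphic_map_openness[OF t openin_subset] by (intro sigma_sets.Basic) simp
next
  case Empty
  then show ?case by (simp add: sigma_sets.Empty)
next
  case (Compl E)
  have "E \<subseteq> topspace T" using Compl(1) sigma_sets_into_sp[OF open_sets_Pow] by blast
  moreover have "inj_on t (topspace T)" "t ` topspace T = topspace T"
    using t by (auto simp: homeomorphic_eq_everything_map)
  ultimately have "t ` (topspace T - E) = topspace T - t ` E"
    using inj_on_image_set_diff[of t "topspace T" "topspace T" E] by auto
  then show ?case using sigma_sets.Compl[OF Compl(2)] by simp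
next
  case (Union E)
  then show ?case unfolding image_UN by (intro sigma_sets.Union)
qed

lemma outer_content_scale_le:
  assumes t: "homeomorphic_map T T t" and c: "0 < c"
    and scale: "\<And>A. compact_open T A \<Longrightarrow> m (t ` A) = c * m A"
    and E: "E \<subseteq> topspace T"
  shows "outer_content (t ` E) \<le> ennreal c * outer_content E"
proof -
  have t': "t ` topspace T = topspace T" "inj_on t (topspace T)"
    using t by (auto simp: homeomorphic_eq_everything_map)
  obtain t1 where "homeomorphic_maps T T t t1" using t homeomorphic_map_maps by blast
  then have t1: "homeomorphic_map T T t1" "\<And>x. x \<in> topspace T \<Longrightarrow> t (t1 x) = x"
      "\<And>x. x \<in> topspace T \<Longrightarrow> t1 (t x) = x"
    using homeomorphic_maps_map by (auto simp: homeomorphic_maps_map)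
  have "ennreal (1 / c) * outer_content (t ` E) \<le> outer_content E"
  proof (rule outer_content_greatest)
    fix U assume U: "openin T U" "E \<subseteq> U"
    have UT: "U \<subseteq> topspace T" using openin_subset[OF U(1)] .
    have "openin T (t ` U)" using homeomorphic_map_openness[OF t UT] U(1) by simp
    then have "outer_content (t ` E) \<le> inner_content (t ` U)"
      using U(2) by (intro outer_content_lower) auto
    also have "\<dots> \<le> ennreal c * inner_content U"
    proof (rule inner_content_least)
      fix A assume A: "compact_open T A" "A \<subseteq> t ` U"
      have AT: "A \<subseteq> topspace T" using compact_open_subset[OF A(1)] .
      have B: "compact_open T (t1 ` A)" using t1(1) A(1) by (rule compact_open_homeomorphic_image)
      have "t ` t1 ` A = A" using t1(2) AT by (simp add: image_image subset_iff)
      then have "ennreal (m A) = ennreal c * ennreal (m (t1 ` A))"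
        using scale[OF B] c nonneg[OF B] by (simp add: ennreal_mult)
      also have "t1 ` A \<subseteq> U"
      proof
        fix y assume "y \<in> t1 ` A"
        then obtain u where "u \<in> U" "y = t1 (t u)" using A(2) by blast
        then show "y \<in> U" using t1(3) UT by auto
      qed
      then have "ennreal c * ennreal (m (t1 ` A)) \<le> ennreal c * inner_content U"
        using B by (intro mult_left_mono inner_content_upper) auto
      finally show "ennreal (m A) \<le> ennreal c * inner_content U" .
    qed
    finally have "ennreal (1 / c) * outer_content (t ` E) \<le> ennreal (1 / c) * (ennreal c * inner_content U)"
      by (rule mult_left_mono) simp
    also have "\<dots> = inner_content U"
      using c by (simp add: mult.assoc[symmetric] ennreal_mult[symmetric])
    finally show "ennreal (1 / c) * outer_content (t ` E) \<le> inner_content U" .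
  qed
  then have "ennreal c * (ennreal (1 / c) * outer_content (t ` E)) \<le> ennreal c * outer_content E"
    by (rule mult_left_mono) simp
  then show ?thesis using c by (simp add: mult.assoc[symmetric] ennreal_mult[symmetric])
qed

text \<open>The missing inequality is the upper bound applied to the inverse homeomorphism with
  factor \<open>1 / c\<close>. The result serves left translations, with \<open>c = 1\<close>, and
  right translations, where \<open>c\<close> becomes the value of the modular character.\<close>

lemma emeasure_content_measure_scale:
  assumes t: "homeomorphic_map T T t" and c: "0 < c"
    and scale: "\<And>A. compact_open T A \<Longrightarrow> m (t ` A) = c * m A"
    and E: "E \<in> sets content_measure"
  shows "emeasure content_measure (t ` E) = ennreal c * emeasure content_measure E"
proof -
  have ET: "E \<subseteq> topspace T"
    using E sigma_sets_into_sp[OF open_sets_Pow] unfolding sets_content_measure by blast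
  obtain t1 where "homeomorphic_maps T T t t1" using t homeomorphic_map_maps by blast
  then have t1: "homeomorphic_map T T t1" "\<And>x. x \<in> topspace T \<Longrightarrow> t (t1 x) = x"
      "\<And>x. x \<in> topspace T \<Longrightarrow> t1 (t x) = x"
    by (auto simp: homeomorphic_maps_map)
  have "m (t1 ` A) = 1 / c * m A" if A: "compact_open T A" for A
  proof -
    have "t ` t1 ` A = A" using t1(2) compact_open_subset[OF A] by (force simp: image_image)
    then show ?thesis
      using scale[OF compact_open_homeomorphic_image[OF t1(1) A]] c by (simp add: field_simps)
  qed
  moreover have "t ` E \<subseteq> topspace T" using t ET by (auto simp: homeomorphic_eq_everything_map)
  ultimately have "outer_content (t1 ` t ` E) \<le> ennreal (1 / c) * outer_content (t ` E)"
    using t1(1) c by (intro outer_content_scale_le) auto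
  moreover have "t1 ` t ` E = E" using t1(3) ET by (force simp: image_image)
  ultimately have "ennreal c * outer_content E \<le> ennreal c * (ennreal (1 / c) * outer_content (t ` E))"
    by (intro mult_left_mono) auto
  also have "\<dots> = outer_content (t ` E)"
    using c by (simp add: mult.assoc[symmetric] ennreal_mult[symmetric])
  finally have "outer_content (t ` E) = ennreal c * outer_content E"
    using outer_content_scale_le[OF t c scale ET] by (intro antisym) auto
  then show ?thesis
    using E homeomorphic_image_sets[OF t E] by (simp add: emeasure_content_measure)
qed

end

section \<open>Haar measure and the modular character\<close>

context lctd_topological_group
begin

text \<open>For a subgroup \<open>K\<close> this expresses that \<open>C\<close> is a union of left
  cosets of \<open>K\<close>, or equivalently that \<open>C\<close> is stable under right
  multiplication by \<open>K\<close>.\<close>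

definition adapted :: "'a set \<Rightarrow> 'a set \<Rightarrow> bool" where
  "adapted K C \<longleftrightarrow> (\<forall>g\<in>C. g <# K \<subseteq> C)"

definition coset_count :: "'a set \<Rightarrow> 'a set \<Rightarrow> nat" where
  "coset_count C K = card ((\<lambda>g. g <# K) ` C)"

lemma adapted_mono: "adapted K C \<Longrightarrow> L \<subseteq> K \<Longrightarrow> adapted L C"
  unfolding adapted_def l_coset_def by blast

lemma adapted_Un: "adapted K C \<Longrightarrow> adapted K D \<Longrightarrow> adapted K (C \<union> D)"
  unfolding adapted_def by blast

lemma adapted_subgroup:
  assumes "subgroup K G" "subgroup L G" "L \<subseteq> K" shows "adapted L K"
  using assms subgroup.m_closed[OF assms(1)] unfolding adapted_def l_coset_def by blast

lemma l_coset_l_coset: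
  "g \<in> carrier G \<Longrightarrow> h \<in> carrier G \<Longrightarrow> K \<subseteq> carrier G \<Longrightarrow> g <# (h <# K) = (g \<otimes> h) <# K"
  by (rule lcos_m_assoc[symmetric, symmetric])

lemma adapted_l_coset:
  assumes "adapted K C" "g \<in> carrier G" "C \<subseteq> carrier G" "K \<subseteq> carrier G"
  shows "adapted K (g <# C)"
  unfolding adapted_def
proof
  fix h assume "h \<in> g <# C"
  then obtain c where c: "c \<in> C" "h = g \<otimes> c" by (auto simp: l_coset_def)
  then have "h <# K = g <# (c <# K)" using assms by (simp add: l_coset_l_coset subset_iff)
  moreover have "c <# K \<subseteq> C" using assms(1) c(1) by (simp add: adapted_def)
  ultimately show "h <# K \<subseteq> g <# C" unfolding l_coset_eq_image by (simp add: image_mono)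
qed

lemma l_coset_eq:
  assumes K: "subgroup K G" and g: "g \<in> carrier G" and h: "h \<in> g <# K"
  shows "h <# K = g <# K"
proof -
  interpret K: subgroup K G by (rule K)
  obtain k where k: "k \<in> K" "h = g \<otimes> k" using h by (auto simp: l_coset_def)
  have "h \<otimes> l \<in> g <# K" if "l \<in> K" for l
    unfolding l_coset_eq_image using k g that
    by (intro image_eqI[where x = "k \<otimes> l"]) (simp_all add: m_assoc)
  moreover have "g \<otimes> l \<in> h <# K" if "l \<in> K" for l
    unfolding l_coset_eq_image using k g that
    by (intro image_eqI[where x = "inv k \<otimes> l"]) (simp_all add: m_assoc[symmetric], simp add: m_assoc)
  ultimately show ?thesis by (auto simp: l_coset_eq_image[of g] l_coset_eq_image[of h])
qed

lemma l_cosets_disjoint: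
  assumes K: "subgroup K G" and "g \<in> carrier G" "h \<in> carrier G" "g <# K \<noteq> h <# K"
  shows "(g <# K) \<inter> (h <# K) = {}"
  using assms l_coset_eq by blast

lemma finite_l_cosets:
  assumes K: "compact_open_subgroup K" and C: "compactin T C"
  shows "finite ((\<lambda>g. (g <# K) :: 'a set) ` C)"
proof -
  note KD = compact_open_subgroupD[OF K]
  have CG: "C \<subseteq> carrier G" using compactin_subset_topspace[OF C] topspace_T by simp
  have "\<exists>\<F>. finite \<F> \<and> \<F> \<subseteq> (\<lambda>d. d <# K) ` C \<and> C \<subseteq> \<Union>\<F>"
  proof (rule compactinD[OF C])
    show "openin T U" if "U \<in> (\<lambda>d. d <# K) ` C" for U
      using that openin_l_coset[OF _ KD(3)] CG by blast
    show "C \<subseteq> (\<Union>d\<in>C. d <# K)"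
      using CG l_coset_self[OF _ KD(6)] by blast
  qed
  then obtain \<F> where \<F>: "finite \<F>" "\<F> \<subseteq> (\<lambda>d. d <# K) ` C" "C \<subseteq> \<Union>\<F>" by blast
  have "g <# K \<in> \<F>" if g: "g \<in> C" for g
  proof -
    obtain D where "D \<in> \<F>" "g \<in> D" using \<F>(3) g by blast
    moreover obtain d where "d \<in> C" "D = d <# K" using \<F>(2) \<open>D \<in> \<F>\<close> by blast
    ultimately show ?thesis using l_coset_eq[OF KD(1), of d g] CG by auto
  qed
  then have "(\<lambda>g. g <# K) ` C \<subseteq> \<F>" by blast
  then show ?thesis using \<F>(1) finite_subset by blast
qed

lemma Union_l_cosets:
  assumes "adapted K C" "C \<subseteq> carrier G" "\<one> \<in> K"
  shows "(\<Union>g\<in>C. g <# K) = C"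
proof
  show "(\<Union>g\<in>C. g <# K) \<subseteq> C" using assms(1) by (auto simp: adapted_def)
  show "C \<subseteq> (\<Union>g\<in>C. g <# K)"
  proof
    fix g assume g: "g \<in> C"
    then have "g \<in> g <# K" using assms(2,3) by (intro l_coset_self) auto
    with g show "g \<in> (\<Union>g\<in>C. g <# K)" by (rule UN_I)
  qed
qed

text \<open>Additivity is only required on sets adapted to \<open>K\<close>, so that the lemma applies both to
  contents and to counting cosets of a smaller subgroup.\<close>

lemma additive_eq_coset_count:
  fixes m :: "'a set \<Rightarrow> real"
  assumes K: "compact_open_subgroup K" and C: "compact_open T C" "adapted K C"
    and empty: "m {} = 0" and left: "\<And>g. g \<in> carrier G \<Longrightarrow> m (g <# K) = m K"
    and add: "\<And>A B. compact_open T A \<Longrightarrow> compact_open T B \<Longrightarrow> adapted K A \<Longrightarrow> adapted K B \<Longrightarrow>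
      A \<inter> B = {} \<Longrightarrow> m (A \<union> B) = m A + m B"
  shows "m C = coset_count C K * m K"
proof -
  note KD = compact_open_subgroupD[OF K]
  have CG: "C \<subseteq> carrier G" using compact_open_subset[OF C(1)] topspace_T by simp
  have adapted_coset: "adapted K (g <# K)" if "g \<in> carrier G" for g
    using that KD by (intro adapted_l_coset adapted_subgroup) auto
  have "m (\<Union>\<D>) = card \<D> * m K" if "finite \<D>" "\<D> \<subseteq> (\<lambda>g. g <# K) ` C" for \<D>
    using that
  proof (induction \<D> rule: finite_induct)
    case (insert D \<D>)
    obtain g where g: "g \<in> C" "D = g <# K" using insert(4) by blast
    have gG: "g \<in> carrier G" using g CG by blast
    have \<D>: "compact_open T E \<and> adapted K E \<and> D \<inter> E = {}" if E: "E \<in> \<D>" for E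
    proof -
      obtain h where h: "h \<in> C" "E = h <# K" using insert(4) E by blast
      have hG: "h \<in> carrier G" using h CG by blast
      have "E \<noteq> D" using insert(2) E by blast
      then show ?thesis
        using l_cosets_disjoint[OF KD(1) gG hG] adapted_coset[OF hG] compact_open_l_coset[OF hG KD(2)]
        unfolding g(2) h(2) by simp
    qed
    have "m (D \<union> \<Union>\<D>) = m D + m (\<Union>\<D>)"
    proof (rule add)
      show "compact_open T D" unfolding g(2) by (rule compact_open_l_coset[OF gG KD(2)])
      show "compact_open T (\<Union>\<D>)" using \<D> insert(1) by (intro compact_open_Union) auto
      show "adapted K D" unfolding g(2) by (rule adapted_coset[OF gG])
      show "adapted K (\<Union>\<D>)" using \<D> unfolding adapted_def by blast
      show "D \<inter> \<Union>\<D> = {}" using \<D> by blast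
    qed
    then show ?case using insert left[OF gG] g(2) by (simp add: algebra_simps)
  qed (simp add: empty)
  from this[of "(\<lambda>g. g <# K) ` C"] show ?thesis
    using finite_l_cosets[OF K, of C] C Union_l_cosets[OF C(2) CG KD(6)]
    by (simp add: coset_count_def compact_open_def)
qed

lemma coset_count_l_coset:
  assumes "g \<in> carrier G" "C \<subseteq> carrier G" "K \<subseteq> carrier G"
  shows "coset_count (g <# C) K = coset_count C K"
proof -
  have "(\<lambda>h. h <# K) ` (g <# C) = (\<lambda>D. g <# D) ` (\<lambda>h. h <# K) ` C"
    unfolding l_coset_eq_image[of g C] image_image
    using assms by (intro image_cong) (simp_all add: l_coset_l_coset subset_iff)
  moreover have "inj_on (\<lambda>D. g <# D) ((\<lambda>h. h <# K) ` C)"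
  proof (rule inj_on_inverseI[where g = "\<lambda>D. inv g <# D"])
    fix D assume "D \<in> (\<lambda>h. h <# K) ` C"
    then obtain h where "h \<in> C" "D = h <# K" by blast
    then have "D \<subseteq> carrier G" using l_coset_subset_G[OF assms(3)] assms(2) by blast
    then show "inv g <# (g <# D) = D" using assms(1) by (simp add: lcos_m_assoc lcos_mult_one)
  qed
  ultimately show ?thesis by (simp add: coset_count_def card_image)
qed

lemma coset_count_Un:
  assumes K: "compact_open_subgroup K" and A: "compact_open T A" "adapted K A"
    and B: "compact_open T B" "adapted K B" and disj: "A \<inter> B = {}"
  shows "coset_count (A \<union> B) K = coset_count A K + coset_count B K"
proof -
  note KD = compact_open_subgroupD[OF K]
  have AG: "A \<subseteq> carrier G" and BG: "B \<subseteq> carrier G"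
    using compact_open_subset A(1) B(1) topspace_T by auto
  have "(\<lambda>g. g <# K) ` A \<inter> (\<lambda>g. g <# K) ` B = {}"
  proof (rule ccontr)
    assume "\<not> ?thesis"
    then obtain g h where gh: "g \<in> A" "h \<in> B" "g <# K = h <# K" by blast
    have "g \<in> g <# K" using gh(1) AG KD(6) by (intro l_coset_self) auto
    moreover have "h <# K \<subseteq> B" using B(2) gh(2) by (simp add: adapted_def)
    ultimately show False using gh disj by blast
  qed
  then show ?thesis
    using finite_l_cosets[OF K] A(1) B(1)
    by (simp add: coset_count_def image_Un card_Un_disjoint compact_open_def)
qed

text \<open>Counting cosets of \<open>L\<close> is left invariant and additive on sets adapted to
  \<open>K\<close>, hence is itself a multiple of counting cosets of \<open>K\<close>. This is the
  multiplicativity of the index.\<close>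

lemma coset_count_trans:
  assumes K: "compact_open_subgroup K" and L: "compact_open_subgroup L" "L \<subseteq> K"
    and C: "compact_open T C" "adapted K C"
  shows "real (coset_count C L) = real (coset_count C K) * real (coset_count K L)"
proof (rule additive_eq_coset_count[where m = "\<lambda>A. real (coset_count A L)", OF K C])
  show "real (coset_count (g <# K) L) = real (coset_count K L)" if "g \<in> carrier G" for g
    using that compact_open_subgroupD(5)[OF K] compact_open_subgroupD(5)[OF L(1)]
    by (simp add: coset_count_l_coset)
  show "real (coset_count (A \<union> B) L) = real (coset_count A L) + real (coset_count B L)"
    if "compact_open T A" "compact_open T B" "adapted K A" "adapted K B" "A \<inter> B = {}" for A B
    using coset_count_Un[OF L(1) that(1) adapted_mono[OF that(3) L(2)] that(2)
        adapted_mono[OF that(4) L(2)] that(5)] by simp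
qed (simp add: coset_count_def)

lemma coset_count_pos:
  assumes "compact_open_subgroup K" "compactin T C" "C \<noteq> {}"
  shows "0 < coset_count C K"
  using finite_l_cosets[OF assms(1,2)] assms(3) by (simp add: coset_count_def card_gt_0_iff)

text \<open>The stabilizing neighbourhood is taken for right multiplication
  \<open>x \<otimes> g\<close>, and a compact open subgroup is then chosen inside it.\<close>

lemma adapted_compact_open_subgroup:
  assumes C: "compact_open T C" and K0: "compact_open_subgroup K0"
  obtains K where "compact_open_subgroup K" "K \<subseteq> K0" "adapted K C"
proof -
  have "continuous_map (prod_topology T T) T (\<lambda>u. snd u \<otimes> fst u)"
    by (intro continuous_map_mult continuous_map_fst continuous_map_snd)
  then have cont: "continuous_map (prod_topology T T) T (\<lambda>(g, x). x \<otimes> g)"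
    by (simp add: case_prod_unfold)
  have CG: "C \<subseteq> carrier G" using compact_open_subset[OF C] topspace_T by simp
  then have one: "x \<otimes> \<one> = x" if "x \<in> C" for x using that by (simp add: subset_iff)
  obtain N where N: "openin T N" "\<one> \<in> N" "\<And>g x. g \<in> N \<Longrightarrow> x \<in> C \<Longrightarrow> x \<otimes> g \<in> C"
    by (rule stabilizing_neighbourhood[OF cont C one]) blast+
  have "openin T (N \<inter> K0)" "\<one> \<in> N \<inter> K0"
    using N compact_open_subgroupD[OF K0] by auto
  then obtain K where K: "compact_open_subgroup K" "K \<subseteq> N \<inter> K0"
    by (rule compact_open_subgroup_basis)
  have "adapted K C"
    unfolding adapted_def l_coset_def using K(2) N(3) by blast
  with K show thesis by (intro that[of K]) auto
qed

text \<open>This is Haar measure normalized by giving \<open>K0\<close> mass 1. Since arbitrarily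
  small compact open subgroups exist, the quotient of covering numbers that usually needs a limit is
  already exact for every sufficiently small \<open>K\<close>.\<close>

definition haar_content :: "'a set \<Rightarrow> 'a set \<Rightarrow> real" where
  "haar_content K0 C =
     (let K = SOME K. compact_open_subgroup K \<and> K \<subseteq> K0 \<and> adapted K C
      in real (coset_count C K) / real (coset_count K0 K))"

text \<open>Two admissible subgroups are compared through a third one inside both. Refining
  multiplies numerator and denominator by the same index, so the arbitrary choice in the definition
  does no harm.\<close>

lemma haar_content_eq:
  assumes K0: "compact_open_subgroup K0" and C: "compact_open T C"
    and K: "compact_open_subgroup K" "K \<subseteq> K0" "adapted K C"
  shows "haar_content K0 C = real (coset_count C K) / real (coset_count K0 K)"
proof -
  define L where "L = (SOME K. compact_open_subgroup K \<and> K \<subseteq> K0 \<and> adapted K C)"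
  have L: "compact_open_subgroup L \<and> L \<subseteq> K0 \<and> adapted L C"
    unfolding L_def by (rule someI[of _ K]) (use K in simp)
  note D = compact_open_subgroupD
  have "openin T (K \<inter> L)" "\<one> \<in> K \<inter> L" using D[OF K(1)] D[of L] L by auto
  then obtain N where N: "compact_open_subgroup N" "N \<subseteq> K \<inter> L"
    by (rule compact_open_subgroup_basis)
  have *: "real (coset_count C M) / real (coset_count K0 M) =
      real (coset_count C N) / real (coset_count K0 N)"
    if M: "compact_open_subgroup M" "M \<subseteq> K0" "adapted M C" "N \<subseteq> M" for M
  proof -
    have "real (coset_count C N) = real (coset_count C M) * real (coset_count M N)"
      by (rule coset_count_trans[OF M(1) N(1) M(4) C M(3)])
    moreover have "real (coset_count K0 N) = real (coset_count K0 M) * real (coset_count M N)"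
      using M by (intro coset_count_trans[OF M(1) N(1) M(4) D(2)[OF K0]] adapted_subgroup D[OF K0] D)
    moreover have "0 < coset_count M N"
      using D[OF M(1)] by (intro coset_count_pos[OF N(1)]) auto
    ultimately show ?thesis by simp
  qed
  have "haar_content K0 C = real (coset_count C L) / real (coset_count K0 L)"
    by (simp add: haar_content_def L_def Let_def)
  also have "\<dots> = real (coset_count C N) / real (coset_count K0 N)" using L N by (intro *) auto
  also have "\<dots> = real (coset_count C K) / real (coset_count K0 K)" using K N by (intro *[symmetric]) auto
  finally show ?thesis .
qed

lemma haar_content_nonneg: "0 \<le> haar_content K0 C"
  by (simp add: haar_content_def Let_def)

lemma haar_content_Un:
  assumes K0: "compact_open_subgroup K0"
    and A: "compact_open T A" and B: "compact_open T B" and disj: "A \<inter> B = {}"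
  shows "haar_content K0 (A \<union> B) = haar_content K0 A + haar_content K0 B"
proof -
  obtain L where L: "compact_open_subgroup L" "L \<subseteq> K0" "adapted L A"
    by (rule adapted_compact_open_subgroup[OF A K0])
  obtain K where K: "compact_open_subgroup K" "K \<subseteq> L" "adapted K B"
    by (rule adapted_compact_open_subgroup[OF B L(1)])
  have KA: "adapted K A" using L(3) K(2) by (rule adapted_mono)
  have "K \<subseteq> K0" using K(2) L(2) by (rule order_trans)
  then show ?thesis
    using haar_content_eq[OF K0 A K(1) _ KA] haar_content_eq[OF K0 B K(1) _ K(3)]
      haar_content_eq[OF K0 compact_open_Un[OF A B] K(1) _ adapted_Un[OF KA K(3)]]
      coset_count_Un[OF K(1) A KA B K(3) disj]
    by (simp add: add_divide_distrib)
qed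

lemma haar_content_empty: "compact_open_subgroup K0 \<Longrightarrow> haar_content K0 {} = 0"
  using haar_content_Un[of K0 "{}" "{}"] by simp

lemma haar_content_l_coset:
  assumes K0: "compact_open_subgroup K0" and A: "compact_open T A" and g: "g \<in> carrier G"
  shows "haar_content K0 (g <# A) = haar_content K0 A"
proof -
  obtain K where K: "compact_open_subgroup K" "K \<subseteq> K0" "adapted K A"
    by (rule adapted_compact_open_subgroup[OF A K0])
  have sub: "A \<subseteq> carrier G" "K \<subseteq> carrier G"
    using compact_open_subset[OF A] topspace_T compact_open_subgroupD(5)[OF K(1)] by auto
  show ?thesis
    using haar_content_eq[OF K0 A K]
      haar_content_eq[OF K0 compact_open_l_coset[OF g A] K(1,2) adapted_l_coset[OF K(3) g sub]]
      coset_count_l_coset[OF g sub] by simp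
qed

lemma haar_content_pos:
  assumes K0: "compact_open_subgroup K0" and A: "compact_open T A" "A \<noteq> {}"
  shows "0 < haar_content K0 A"
proof -
  obtain K where K: "compact_open_subgroup K" "K \<subseteq> K0" "adapted K A"
    by (rule adapted_compact_open_subgroup[OF A(1) K0])
  have "0 < coset_count A K" using K(1) A by (intro coset_count_pos) (auto simp: compact_open_def)
  moreover have "0 < coset_count K0 K"
    using K(1) compact_open_subgroupD[OF K0] by (intro coset_count_pos) auto
  ultimately show ?thesis using haar_content_eq[OF K0 A(1) K] by simp
qed

lemma haar_content_base:
  assumes K0: "compact_open_subgroup K0" shows "haar_content K0 K0 = 1"
proof -
  note D = compact_open_subgroupD[OF K0]
  have "adapted K0 K0" using D(1) by (intro adapted_subgroup) auto
  moreover have "0 < coset_count K0 K0" using D by (intro coset_count_pos[OF K0]) auto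
  ultimately show ?thesis using haar_content_eq[OF K0 D(2) K0] by simp
qed

lemma haar_content_eq_coset_count:
  assumes K0: "compact_open_subgroup K0" and K: "compact_open_subgroup K"
    and C: "compact_open T C" "adapted K C"
  shows "haar_content K0 C = real (coset_count C K) * haar_content K0 K"
proof (rule additive_eq_coset_count[where m = "haar_content K0", OF K C haar_content_empty[OF K0]])
  show "haar_content K0 (g <# K) = haar_content K0 K" if "g \<in> carrier G" for g
    by (rule haar_content_l_coset[OF K0 compact_open_subgroupD(2)[OF K] that])
qed (rule haar_content_Un[OF K0])

text \<open>For one small \<open>K\<close>, both \<open>m\<close> and \<open>haar_content K0\<close>
  on the sets \<open>C\<close> and \<open>K0\<close> are the number of cosets times a constant. It
  is applied to right translates of the Haar content and to the restriction of an arbitrary Haar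
  measure to compact open sets.\<close>

lemma left_invariant_content_unique:
  fixes m :: "'a set \<Rightarrow> real"
  assumes K0: "compact_open_subgroup K0" and C: "compact_open T C"
    and add: "\<And>A B. compact_open T A \<Longrightarrow> compact_open T B \<Longrightarrow> A \<inter> B = {} \<Longrightarrow> m (A \<union> B) = m A + m B"
    and left: "\<And>g A. g \<in> carrier G \<Longrightarrow> compact_open T A \<Longrightarrow> m (g <# A) = m A"
  shows "m C = haar_content K0 C * m K0"
proof -
  obtain K where K: "compact_open_subgroup K" "K \<subseteq> K0" "adapted K C"
    by (rule adapted_compact_open_subgroup[OF C K0])
  note D = compact_open_subgroupD
  have empty: "m {} = 0" using add[of "{}" "{}"] by simp
  have count: "m A = coset_count A K * m K" if "compact_open T A" "adapted K A" for A
    using that by (intro additive_eq_coset_count[OF K(1)] empty add left D(2)[OF K(1)])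
  have "adapted K K0" using K(2) by (intro adapted_subgroup D[OF K0] D[OF K(1)])
  then have "m K0 = coset_count K0 K * m K" using D(2)[OF K0] by (intro count)
  moreover have "0 < coset_count K0 K" using D[OF K0] by (intro coset_count_pos[OF K(1)]) auto
  ultimately show ?thesis
    using count[OF C K(3)] haar_content_eq[OF K0 C K] by simp
qed

text \<open>Right translation commutes with left translation, so the content of
  \<open>C #> g\<close> is again a left invariant content in \<open>C\<close>. By uniqueness it is a
  multiple of the original one, and evaluation at \<open>K0\<close> identifies the factor.\<close>

lemma haar_content_r_coset:
  assumes K0: "compact_open_subgroup K0" and C: "compact_open T C" and g: "g \<in> carrier G"
  shows "haar_content K0 (C #> g) = haar_content K0 (K0 #> g) * haar_content K0 C"
proof -
  have "haar_content K0 (C #> g) = haar_content K0 C * haar_content K0 (K0 #> g)"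
  proof (rule left_invariant_content_unique[OF K0 C])
    fix A B assume A: "compact_open T A" and B: "compact_open T B" and disj: "A \<inter> B = {}"
    have sub: "A \<subseteq> carrier G" "B \<subseteq> carrier G" using compact_open_subset A B topspace_T by auto
    have "(A #> g) \<inter> (B #> g) = {}"
    proof (rule ccontr)
      assume "\<not> ?thesis"
      then obtain x y where "x \<in> A" "y \<in> B" "x \<otimes> g = y \<otimes> g" by (auto simp: r_coset_def)
      then have "x = y" using g sub by (simp add: subset_iff)
      then show False using \<open>x \<in> A\<close> \<open>y \<in> B\<close> disj by blast
    qed
    then have "haar_content K0 ((A #> g) \<union> (B #> g)) = haar_content K0 (A #> g) + haar_content K0 (B #> g)"
      using A B g by (intro haar_content_Un[OF K0] compact_open_r_coset)
    then show "haar_content K0 ((A \<union> B) #> g) = haar_content K0 (A #> g) + haar_content K0 (B #> g)"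
      by (simp add: r_coset_eq_image image_Un)
  next
    fix h A assume h: "h \<in> carrier G" and A: "compact_open T A"
    have "A \<subseteq> carrier G" using compact_open_subset[OF A] topspace_T by simp
    then have "(h <# A) #> g = h <# (A #> g)" using g h by (simp add: coset_assoc)
    then show "haar_content K0 ((h <# A) #> g) = haar_content K0 (A #> g)"
      using haar_content_l_coset[OF K0 compact_open_r_coset[OF g A] h] by simp
  qed
  then show ?thesis by simp
qed

section \<open>From the Haar content to Haar measures and the modular character\<close>

lemma compact_open_content_haar:
  "compact_open_subgroup K0 \<Longrightarrow> compact_open_content T (haar_content K0)"
  by unfold_locales (simp_all add: lctd_T haar_content_nonneg haar_content_Un)

text \<open>The existential has the shape that occurs inside \<open>modular_character\<close>. Left
  invariance of the content measure and its behaviour under right translation are both instances of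
  the scaling lemma, with factors 1 and \<open>haar_content K0 (K0 #> g)\<close>.\<close>

lemma exists_haar_measure:
  assumes K0: "compact_open_subgroup K0" and g: "g \<in> carrier G"
  shows "\<exists>\<mu>. left_haar_measure G T \<mu> \<and> (\<forall>E\<in>sets \<mu>.
    emeasure \<mu> (E #> g) = ennreal (haar_content K0 (K0 #> g)) * emeasure \<mu> E)"
proof -
  interpret compact_open_content T "haar_content K0" by (rule compact_open_content_haar[OF K0])
  note D = compact_open_subgroupD[OF K0]
  have "left_haar_measure G T content_measure"
    unfolding left_haar_measure_def
  proof (intro conjI allI impI ballI)
    show "sets content_measure = sets (sigma (topspace T) {U. openin T U})"
      using open_sets_Pow by (simp add: sets_content_measure)
    have "emeasure content_measure K0 = 1"
      using D(2) by (simp add: emeasure_content_measure_compact_open haar_content_base[OF K0])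
    moreover have "emeasure content_measure K0 \<le> emeasure content_measure (space content_measure)"
      using openin_sets_content_measure[OF D(3)] by (intro emeasure_mono sets.sets_into_space) auto
    ultimately show "emeasure content_measure (space content_measure) \<noteq> 0" by auto
    show "emeasure content_measure K < \<infinity>" if "compactin T K" for K
      using that by (rule emeasure_content_measure_compactin)
    show "emeasure content_measure E =
        (INF U\<in>{U. openin T U \<and> E \<subseteq> U}. emeasure content_measure U)"
      if "E \<in> sets content_measure" for E
      using that by (rule content_measure_outer_regular)
    show "emeasure content_measure U =
        (SUP K\<in>{K. compactin T K \<and> K \<subseteq> U}. emeasure content_measure K)" if "openin T U" for U
      using that by (rule content_measure_inner_regular)
    show "emeasure content_measure (h <# E) = emeasure content_measure E"
      if "h \<in> carrier G" "E \<in> sets content_measure" for h E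
      using emeasure_content_measure_scale[OF homeomorphic_map_left_mult[OF that(1)], of 1 E]
        that haar_content_l_coset[OF K0] by (simp add: l_coset_eq_image)
  qed
  moreover have "emeasure content_measure (E #> g) =
      ennreal (haar_content K0 (K0 #> g)) * emeasure content_measure E"
    if "E \<in> sets content_measure" for E
    unfolding r_coset_eq_image[of E]
  proof (rule emeasure_content_measure_scale[OF homeomorphic_map_right_mult[OF g] _ _ that])
    show "0 < haar_content K0 (K0 #> g)"
      using D(6) compact_open_r_coset[OF g D(2)] by (intro haar_content_pos[OF K0]) (auto simp: r_coset_def)
    show "haar_content K0 ((\<lambda>h. h \<otimes> g) ` A) = haar_content K0 (K0 #> g) * haar_content K0 A"
      if "compact_open T A" for A
      using haar_content_r_coset[OF K0 that g] by (simp add: r_coset_eq_image)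
  qed
  ultimately show ?thesis by blast
qed

lemma left_haar_measureD:
  assumes \<mu>: "left_haar_measure G T \<mu>"
  shows "sets \<mu> = sets (sigma (topspace T) {U. openin T U})" "space \<mu> = topspace T"
    "emeasure \<mu> (topspace T) \<noteq> 0" "compactin T K \<Longrightarrow> emeasure \<mu> K < \<infinity>"
    "openin T U \<Longrightarrow> U \<in> sets \<mu>"
    "openin T U \<Longrightarrow> emeasure \<mu> U = (SUP K\<in>{K. compactin T K \<and> K \<subseteq> U}. emeasure \<mu> K)"
    "g \<in> carrier G \<Longrightarrow> E \<in> sets \<mu> \<Longrightarrow> emeasure \<mu> (g <# E) = emeasure \<mu> E"
proof -
  have Pow: "{U. openin T U} \<subseteq> Pow (topspace T)" using openin_subset by blast
  show sets: "sets \<mu> = sets (sigma (topspace T) {U. openin T U})"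
    using \<mu> unfolding left_haar_measure_def by (elim conjE)
  show space: "space \<mu> = topspace T"
    using sets_eq_imp_space_eq[OF sets] Pow by (simp add: space_measure_of)
  show "emeasure \<mu> (topspace T) \<noteq> 0"
    using \<mu> unfolding left_haar_measure_def space by (elim conjE)
  show "openin T U \<Longrightarrow> U \<in> sets \<mu>"
    unfolding sets sets_measure_of[OF Pow] by (intro sigma_sets.Basic) simp
  show "compactin T K \<Longrightarrow> emeasure \<mu> K < \<infinity>"
    using \<mu> unfolding left_haar_measure_def by blast
  show "openin T U \<Longrightarrow> emeasure \<mu> U = (SUP K\<in>{K. compactin T K \<and> K \<subseteq> U}. emeasure \<mu> K)"
    using \<mu> unfolding left_haar_measure_def by blast
  show "g \<in> carrier G \<Longrightarrow> E \<in> sets \<mu> \<Longrightarrow> emeasure \<mu> (g <# E) = emeasure \<mu> E"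
    using \<mu> unfolding left_haar_measure_def by blast
qed

lemma haar_measure_compact_open:
  assumes \<mu>: "left_haar_measure G T \<mu>" and K0: "compact_open_subgroup K0"
    and C: "compact_open T C"
  shows "measure \<mu> C = haar_content K0 C * measure \<mu> K0" "emeasure \<mu> C = ennreal (measure \<mu> C)"
proof -
  have fin: "emeasure \<mu> A < \<infinity>" and sets: "A \<in> sets \<mu>" if "compact_open T A" for A
    using left_haar_measureD(4,5)[OF \<mu>] that by (auto simp: compact_open_def)
  show "emeasure \<mu> C = ennreal (measure \<mu> C)"
    using fin[OF C] by (simp add: emeasure_eq_ennreal_measure less_top)
  show "measure \<mu> C = haar_content K0 C * measure \<mu> K0"
  proof (rule left_invariant_content_unique[OF K0 C])
    fix A B assume "compact_open T A" "compact_open T B" "A \<inter> B = {}"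
    then show "measure \<mu> (A \<union> B) = measure \<mu> A + measure \<mu> B"
      using sets fin by (intro measure_Union) (auto simp: less_top)
  next
    fix g A assume "g \<in> carrier G" "compact_open T A"
    then show "measure \<mu> (g <# A) = measure \<mu> A"
      using left_haar_measureD(7)[OF \<mu>] sets by (simp add: measure_def)
  qed
qed

text \<open>If \<open>K0\<close> were null, so would be every compact open set by uniqueness, then
  every compact set by monotonicity, and finally the whole group by inner regularity, against the
  nontriviality of \<open>\<mu>\<close>.\<close>

lemma haar_measure_pos:
  assumes \<mu>: "left_haar_measure G T \<mu>" and K0: "compact_open_subgroup K0"
  shows "0 < measure \<mu> K0"
proof (rule ccontr)
  assume "\<not> 0 < measure \<mu> K0"
  then have "measure \<mu> K0 = 0" using measure_nonneg[of \<mu> K0] by linarith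
  then have zero: "emeasure \<mu> A = 0" if "compact_open T A" for A
    using haar_measure_compact_open[OF \<mu> K0 that] by simp
  have "emeasure \<mu> K = 0" if K: "compactin T K" for K
  proof -
    obtain A where A: "compact_open T A" "K \<subseteq> A"
      by (rule lctd_space_compact_open_between[OF lctd_T K openin_topspace
            compactin_subset_topspace[OF K]])
    then have "emeasure \<mu> K \<le> emeasure \<mu> A"
      using left_haar_measureD(5)[OF \<mu>] by (intro emeasure_mono) (auto simp: compact_open_def)
    then show ?thesis using zero[OF A(1)] by simp
  qed
  then have "(SUP K\<in>{K. compactin T K \<and> K \<subseteq> topspace T}. emeasure \<mu> K) \<le> 0"
    by (intro SUP_least) simp
  then have "emeasure \<mu> (topspace T) \<le> 0"
    using left_haar_measureD(6)[OF \<mu> openin_topspace] by simp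
  then show False using left_haar_measureD(3)[OF \<mu>] by simp
qed

text \<open>This evaluates the definite description. Existence is witnessed by the measure built
  from the content; for uniqueness the scaling law is tested on \<open>K0\<close>, whose measure is
  finite and positive. From here on the modular character is a ratio of coset counts.\<close>

lemma modular_character_eq:
  assumes K0: "compact_open_subgroup K0" and g: "g \<in> carrier G"
  shows "modular_character G T g = haar_content K0 (K0 #> g)"
  unfolding modular_character_def
proof (rule the_equality)
  note D = compact_open_subgroupD[OF K0]
  have Kg: "compact_open T (K0 #> g)" using g D(2) by (rule compact_open_r_coset)
  show "0 < haar_content K0 (K0 #> g) \<and> (\<exists>\<mu>. left_haar_measure G T \<mu> \<and> (\<forall>E\<in>sets \<mu>.
      emeasure \<mu> (E #> g) = ennreal (haar_content K0 (K0 #> g)) * emeasure \<mu> E))"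
    using exists_haar_measure[OF K0 g] Kg D(6)
    by (auto intro!: haar_content_pos[OF K0] simp: r_coset_def)
  fix c assume "0 < c \<and> (\<exists>\<mu>. left_haar_measure G T \<mu> \<and>
      (\<forall>E\<in>sets \<mu>. emeasure \<mu> (E #> g) = ennreal c * emeasure \<mu> E))"
  then obtain \<mu> where c: "0 < c" and \<mu>: "left_haar_measure G T \<mu>"
    and scale: "\<forall>E\<in>sets \<mu>. emeasure \<mu> (E #> g) = ennreal c * emeasure \<mu> E" by blast
  have "K0 \<in> sets \<mu>" using left_haar_measureD(5)[OF \<mu> D(3)] .
  then have "ennreal (measure \<mu> (K0 #> g)) = ennreal (c * measure \<mu> K0)"
    using scale c haar_measure_compact_open(2)[OF \<mu> K0 Kg] haar_measure_compact_open(2)[OF \<mu> K0 D(2)]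
    by (simp add: ennreal_mult)
  then have "measure \<mu> (K0 #> g) = c * measure \<mu> K0" using c by simp
  then show "c = haar_content K0 (K0 #> g)"
    using haar_measure_compact_open(1)[OF \<mu> K0 Kg] haar_measure_pos[OF \<mu> K0] by simp
qed

lemma haar_content_modular:
  assumes K0: "compact_open_subgroup K0" and C: "compact_open T C" and g: "g \<in> carrier G"
  shows "haar_content K0 (C #> g) = modular_character G T g * haar_content K0 C"
  using haar_content_r_coset[OF K0 C g] modular_character_eq[OF K0 g] by simp

text \<open>Translating the conjugate on the right by \<open>g\<close> turns it into
  \<open>g <# K\<close>, which has the content of \<open>K\<close>. So the left half of a
  conjugation is free and the right half costs the modular character; this is the source of
  \<open>\<delta>\<close> below.\<close>

lemma haar_content_conjugate:
  assumes K0: "compact_open_subgroup K0" and K: "compact_open_subgroup K" and g: "g \<in> carrier G"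
  shows "modular_character G T g * haar_content K0 (g <# K #> inv g) = haar_content K0 K"
proof -
  note D = compact_open_subgroupD[OF K]
  have L: "compact_open T (g <# K #> inv g)"
    using compact_open_subgroupD(2)[OF compact_open_subgroup_conjugate[OF K g]] .
  have "g <# K #> inv g #> g = g <# K"
    using D(5) g l_coset_subset_G[OF D(5) g] by (simp add: coset_mult_assoc coset_mult_one)
  then show ?thesis
    using haar_content_modular[OF K0 L g] haar_content_l_coset[OF K0 D(2) g] by simp
qed

lemma exists_compact_open_subgroup:
  obtains K where "compact_open_subgroup K"
  by (rule compact_open_subgroup_basis[OF openin_carrier one_closed that])

lemma modular_character_pos:
  assumes g: "g \<in> carrier G" shows "0 < modular_character G T g"
proof -
  obtain K0 where K0: "compact_open_subgroup K0" by (rule exists_compact_open_subgroup)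
  note D = compact_open_subgroupD[OF K0]
  show ?thesis
    unfolding modular_character_eq[OF K0 g]
    using compact_open_r_coset[OF g D(2)] D(6)
    by (intro haar_content_pos[OF K0]) (auto simp: r_coset_def)
qed

end

section \<open>Closed subgroups\<close>

lemma (in lctd_topological_group) compact_open_subgroup_Int:
  assumes K: "compact_open_subgroup K" and L: "compact_open_subgroup L"
  shows "compact_open_subgroup (K \<inter> L)"
  using subgroups_Inter_pair[of K L] compact_open_Int[OF Hausdorff_T, of K L] K L
  by (simp add: compact_open_subgroup_def)

lemma (in lctd_topological_group) lctd_closed_subgroup:
  assumes S: "subgroup S G" and closed: "closedin T S"
  shows "lctd_topological_group (G\<lparr>carrier := S\<rparr>) (subtopology T S)"
proof -
  interpret S: group "G\<lparr>carrier := S\<rparr>" using S by (rule subgroup_imp_group)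
  have SG: "S \<subseteq> carrier G" using S by (rule subgroup.subset)
  have top: "topspace (subtopology T S) = S" using SG topspace_T by auto
  have "continuous_map (prod_topology (subtopology T S) (subtopology T S)) T (\<lambda>(g, h). g \<otimes> h)"
    unfolding prod_topology_subtopology by (intro continuous_map_from_subtopology continuous_mult)
  moreover have "g \<otimes> h \<in> S" if "g \<in> S" "h \<in> S" for g h using S that by (rule subgroup.m_closed)
  ultimately have mult: "continuous_map (prod_topology (subtopology T S) (subtopology T S)) (subtopology T S)
      (\<lambda>(g, h). g \<otimes> h)"
    by (auto simp: continuous_map_in_subtopology top)
  have "continuous_map (subtopology T S) (subtopology T S) (\<lambda>g. inv g)"
    using continuous_map_from_subtopology[OF continuous_inv] subgroup.m_inv_closed[OF S]
    by (auto simp: continuous_map_in_subtopology top)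
  then have inv: "continuous_map (subtopology T S) (subtopology T S) (\<lambda>g. inv\<^bsub>G\<lparr>carrier := S\<rparr>\<^esub> g)"
  proof (rule continuous_map_eq)
    fix g assume "g \<in> topspace (subtopology T S)"
    then have "g \<in> S" unfolding top .
    then show "inv g = inv\<^bsub>G\<lparr>carrier := S\<rparr>\<^esub> g" by (rule m_inv_consistent[OF S, symmetric])
  qed
  show ?thesis
    by unfold_locales (use mult inv top S.group_axioms lctd_space_closed_subtopology[OF lctd_T closed]
      in \<open>simp add: lctd_group_def topological_group_def\<close>)
qed

lemma (in lctd_action) action_closed_subgroup:
  assumes S: "subgroup S G" and closed: "closedin T S"
  shows "lctd_action (G\<lparr>carrier := S\<rparr>) (subtopology T S) X a"
proof -
  interpret S: lctd_topological_group "G\<lparr>carrier := S\<rparr>" "subtopology T S"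
    using S closed by (rule lctd_closed_subgroup)
  have "group_hom G (BijGroup (topspace X)) a" using group_action by (simp add: group_action_def)
  then have "group_hom (G\<lparr>carrier := S\<rparr>) (BijGroup (topspace X)) a"
    using subgroup.subset[OF S] S.group_axioms
    by (auto simp: group_hom_def group_hom_axioms_def hom_def Pi_iff subset_iff)
  then have "group_action (G\<lparr>carrier := S\<rparr>) (topspace X) a" by (simp add: group_action_def)
  moreover have "continuous_map (prod_topology (subtopology T S) X) X (\<lambda>(g, z). a g z)"
  proof -
    have "prod_topology (subtopology T S) X = subtopology (prod_topology T X) (S \<times> topspace X)"
      using prod_topology_subtopology(1)[of T S X] by simp
    then show ?thesis using continuous_map_from_subtopology[OF continuous_map_action] by simp
  qed
  ultimately show ?thesis by unfold_locales (simp_all add: lctd_X continuous_action_def)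
qed

lemma (in lctd_action) stabilizer_closed_subgroup:
  assumes z: "z \<in> topspace X"
  shows "subgroup (stabilizer G a z) G" "closedin T (stabilizer G a z)"
proof -
  show "subgroup (stabilizer G a z) G"
    using group_action z by (rule group_action.stabilizer_subgroup)
  have "closedin X {z}" using Hausdorff_X z by (simp add: closedin_Hausdorff_singleton)
  moreover have "continuous_map T X (\<lambda>g. a g z)"
    using continuous_map_act[of T "\<lambda>g. g" "\<lambda>_. z"] z by simp
  ultimately have "closedin T {g \<in> topspace T. a g z \<in> {z}}"
    by (intro closedin_continuous_map_preimage)
  then show "closedin T (stabilizer G a z)" by (simp add: stabilizer_def topspace_T)
qed

lemma (in lctd_topological_group) compact_open_subgroup_closed_subgroup:
  assumes K: "compact_open_subgroup K" and S: "subgroup S G" and closed: "closedin T S"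
  shows "lctd_topological_group.compact_open_subgroup (G\<lparr>carrier := S\<rparr>) (subtopology T S) (K \<inter> S)"
proof -
  interpret S: lctd_topological_group "G\<lparr>carrier := S\<rparr>" "subtopology T S"
    using S closed by (rule lctd_closed_subgroup)
  note D = compact_open_subgroupD[OF K]
  have "subgroup (K \<inter> S) (G\<lparr>carrier := S\<rparr>)"
    using subgroup_incl[OF subgroups_Inter_pair[OF D(1) S] S] by simp
  moreover have "compact_open (subtopology T S) (K \<inter> S)"
    using D(3) compact_Int_closedin[OF D(4) closed]
    by (auto simp: compact_open_def compactin_subtopology openin_subtopology)
  ultimately show ?thesis by (simp add: S.compact_open_subgroup_def)
qed

section \<open>Counting the \<open>N\<close>-orbits inside a \<open>K\<close>-orbit\<close>

lemma card_image_eq_if_same_fibers: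
  assumes "\<And>x y. x \<in> A \<Longrightarrow> y \<in> A \<Longrightarrow> f x = f y \<longleftrightarrow> g x = g y"
  shows "card (f ` A) = card (g ` A)"
proof (rule bij_betw_same_card)
  show "bij_betw (\<lambda>u. g (inv_into A f u)) (f ` A) (g ` A)"
    unfolding bij_betw_def
  proof
    have eq: "g (inv_into A f (f x)) = g x" if "x \<in> A" for x
      using assms[of "inv_into A f (f x)" x] inv_into_into[of "f x" f A] f_inv_into_f[of "f x" f A] that
      by simp
    show "inj_on (\<lambda>u. g (inv_into A f u)) (f ` A)"
      by (rule inj_onI) (use eq assms in auto)
    show "(\<lambda>u. g (inv_into A f u)) ` f ` A = g ` A"
      using eq by (simp add: image_image)
  qed
qed

lemma card_eq_card_image_times_fiber:
  assumes "finite A" "\<And>x. x \<in> A \<Longrightarrow> card {y \<in> A. f y = f x} = n"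
  shows "card A = card (f ` A) * n"
proof -
  have "card A = (\<Sum>u\<in>f ` A. card {y \<in> A. f y = u})"
    using sum.image_gen[OF assms(1), of "\<lambda>_. 1 :: nat" f] by simp
  also have "\<dots> = (\<Sum>u\<in>f ` A. n)" using assms(2) by (intro sum.cong) auto
  finally show ?thesis by simp
qed

text \<open>Applying the normality hypothesis to \<open>k\<close> and to \<open>inv k\<close> shows
  that conjugation by \<open>k\<close> maps \<open>N\<close> onto itself. Consequently all
  \<open>N\<close>-orbits inside \<open>K z\<close> are translates of a single one.\<close>

lemma (in lctd_action) partial_orbit_normal:
  assumes K: "subgroup K G" and N: "N \<subseteq> carrier G"
    and normal: "\<And>k n. k \<in> K \<Longrightarrow> n \<in> N \<Longrightarrow> k \<otimes> n \<otimes> inv k \<in> N"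
    and k: "k \<in> K" and z: "z \<in> topspace X"
  shows "partial_orbit N (a k z) = a k ` partial_orbit N z"
proof -
  interpret K: subgroup K G by (rule K)
  have kG: "k \<in> carrier G" using k by simp
  have "k <# N #> inv k = N"
  proof
    show "k <# N #> inv k \<subseteq> N" using normal[OF k] by (auto simp: l_coset_def r_coset_def)
    show "N \<subseteq> k <# N #> inv k"
    proof
      fix n assume n: "n \<in> N"
      have nG: "n \<in> carrier G" using n N by blast
      have "inv k \<otimes> n \<otimes> k \<in> N" using normal[OF K.m_inv_closed[OF k] n] kG by simp
      moreover have "n = k \<otimes> (inv k \<otimes> n \<otimes> k) \<otimes> inv k"
        using kG nG by (simp add: m_assoc) (simp add: m_assoc[symmetric])
      ultimately show "n \<in> k <# N #> inv k"
        unfolding l_coset_eq_image r_coset_eq_image image_image by (rule rev_image_eqI)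
    qed
  qed
  then show ?thesis using partial_orbit_conjugate[OF kG N z] by simp
qed

text \<open>The orbit map sends the cosets of \<open>N\<close> in \<open>K\<close> onto the \<open>N\<close>-orbits in \<open>K z\<close>, and all its
  fibers have the size of the coset space of \<open>N \<inter> S\<close> in \<open>K \<inter> S\<close>, where \<open>S\<close> is the stabilizer.\<close>

lemma (in lctd_action) coset_count_eq_orbits_times_stabilizer:
  assumes K: "compact_open_subgroup K" and N: "compact_open_subgroup N" "N \<subseteq> K"
    and normal: "\<And>k n. k \<in> K \<Longrightarrow> n \<in> N \<Longrightarrow> k \<otimes> n \<otimes> inv k \<in> N"
    and z: "z \<in> topspace X"
  defines "S \<equiv> stabilizer G a z"
  shows "coset_count K N =
    card (partial_orbit N ` partial_orbit K z) * card ((\<lambda>t. t <# (N \<inter> S)) ` (K \<inter> S))"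
proof -
  note KD = compact_open_subgroupD[OF K] and ND = compact_open_subgroupD[OF N(1)]
  interpret K: subgroup K G by (rule KD(1))
  interpret N: subgroup N G by (rule ND(1))
  interpret S: subgroup S G unfolding S_def by (rule stabilizer_closed_subgroup(1)[OF z])
  have stab: "a s z = z" if "s \<in> S" for s using that unfolding S_def stabilizer_def by blast
  let ?D = "(\<lambda>g. (g <# N) :: 'a set) ` K"
  let ?F = "\<lambda>D. (\<lambda>g. a g z) ` D"
  have F: "?F (g <# N) = partial_orbit N (a g z)" if g: "g \<in> K" for g
  proof -
    have "?F (g <# N) = a g ` partial_orbit N z"
      unfolding l_coset_eq_image partial_orbit_def image_image
      by (rule image_cong[OF refl]) (simp add: action_mult g z)
    then show ?thesis using partial_orbit_normal[OF KD(1) ND(5) normal g z] by simp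
  qed
  have "?F ` ?D = partial_orbit N ` partial_orbit K z"
    using F by (simp add: image_image partial_orbit_def)
  moreover have "card {E \<in> ?D. ?F E = ?F D} = card ((\<lambda>t. t <# (N \<inter> S)) ` (K \<inter> S))" if D: "D \<in> ?D" for D
  proof -
    obtain r where r: "r \<in> K" "D = r <# N" using D by blast
    have eq_iff: "g <# N = h <# N \<longleftrightarrow> inv g \<otimes> h \<in> N" if "g \<in> K" "h \<in> K" for g h
    proof
      assume "g <# N = h <# N"
      then have "h \<in> g <# N" using l_coset_self[of h N] that by simp
      then obtain n where "n \<in> N" "h = g \<otimes> n" by (auto simp: l_coset_def)
      then show "inv g \<otimes> h \<in> N" using that by (simp add: m_assoc[symmetric])
    next
      assume n: "inv g \<otimes> h \<in> N"
      have "h = g \<otimes> (inv g \<otimes> h)" using that by (simp add: m_assoc[symmetric])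
      then have "h \<in> g <# N" using n unfolding l_coset_eq_image by (rule rev_image_eqI[rotated])
      then show "g <# N = h <# N" using l_coset_eq[OF ND(1), of g h] that by simp
    qed
    have "{E \<in> ?D. ?F E = ?F D} = (\<lambda>t. (r \<otimes> t) <# N) ` (K \<inter> S)"
    proof (intro equalityI subsetI)
      fix E assume "E \<in> {E \<in> ?D. ?F E = ?F D}"
      then obtain g where g: "g \<in> K" "E = g <# N" "?F (g <# N) = ?F (r <# N)" using r(2) by blast
      have "a g z \<in> ?F (g <# N)" using l_coset_self[of g N] g(1) by simp
      then obtain n where n: "n \<in> N" "a g z = a (r \<otimes> n) z"
        unfolding g(3) by (auto simp: l_coset_def)
      \<comment> \<open>\<open>r \<otimes> n\<close> and \<open>g\<close> move \<open>z\<close> to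
        the same point, so \<open>s\<close> lies in the stabilizer. Normality then moves
        \<open>n\<close> past \<open>s\<close>, which shows that \<open>r \<otimes> s\<close> and
        \<open>g\<close> span the same coset of \<open>N\<close>.\<close>
      define s where "s = inv (r \<otimes> n) \<otimes> g"
      have nK: "n \<in> K" using n N(2) by blast
      have sK: "s \<in> K" using r g nK by (simp add: s_def)
      have "a s z = a (inv (r \<otimes> n)) (a g z)" using r g nK z by (simp add: s_def action_mult)
      then have "a s z = z" using r nK z unfolding n(2) by (simp del: inv_mult_group)
      then have sS: "s \<in> S" using K.mem_carrier[OF sK] unfolding S_def stabilizer_def by blast
      have "s = inv n \<otimes> inv r \<otimes> g" using r g nK by (simp add: s_def inv_mult_group)
      then have "n \<otimes> s = inv r \<otimes> g" using r g nK by (simp add: m_assoc[symmetric])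
      then have "inv (r \<otimes> s) \<otimes> g = inv s \<otimes> n \<otimes> s"
        using r g nK sK by (simp add: inv_mult_group m_assoc)
      also have "\<dots> \<in> N" using normal[OF K.m_inv_closed[OF sK] n(1)] sK by simp
      finally have "(r \<otimes> s) <# N = g <# N" using r sK g by (simp add: eq_iff)
      then show "E \<in> (\<lambda>t. (r \<otimes> t) <# N) ` (K \<inter> S)" using sK sS g(2) by blast
    next
      fix E assume "E \<in> (\<lambda>t. (r \<otimes> t) <# N) ` (K \<inter> S)"
      then obtain t where t: "t \<in> K" "t \<in> S" "E = (r \<otimes> t) <# N" by blast
      have "?F E = ?F D"
        using t r F[of "r \<otimes> t"] F[of r] z stab[of t] by (simp add: action_mult)
      then show "E \<in> {E \<in> ?D. ?F E = ?F D}" using t r by simp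
    qed
    \<comment> \<open>The common factor \<open>r\<close> cancels, and
      \<open>inv t \<otimes> u\<close> lies in \<open>S\<close> anyway, so membership in
      \<open>N\<close> and in \<open>N \<inter> S\<close> define the same equivalence on
      \<open>K \<inter> S\<close>.\<close>
    moreover have "card ((\<lambda>t. (r \<otimes> t) <# N) ` (K \<inter> S)) = card ((\<lambda>t. t <# (N \<inter> S)) ` (K \<inter> S))"
    proof (rule card_image_eq_if_same_fibers)
      fix t u assume tu: "t \<in> K \<inter> S" "u \<in> K \<inter> S"
      have NS: "subgroup (N \<inter> S) G" by (intro subgroups_Inter_pair N.subgroup_axioms S.subgroup_axioms)
      interpret NS: subgroup "N \<inter> S" G by (rule NS)
      have "(r \<otimes> t) <# N = (r \<otimes> u) <# N \<longleftrightarrow> inv t \<otimes> u \<in> N"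
        using tu r eq_iff[of "r \<otimes> t" "r \<otimes> u"]
        by (simp add: inv_mult_group m_assoc) (simp add: m_assoc[symmetric])
      also have "\<dots> \<longleftrightarrow> inv t \<otimes> u \<in> N \<inter> S" using tu by simp
      also have "\<dots> \<longleftrightarrow> t <# (N \<inter> S) = u <# (N \<inter> S)"
      proof
        assume n: "inv t \<otimes> u \<in> N \<inter> S"
        have "u = t \<otimes> (inv t \<otimes> u)" using tu by (simp add: m_assoc[symmetric])
        then have "u \<in> t <# (N \<inter> S)" using n unfolding l_coset_eq_image by (rule rev_image_eqI[rotated])
        then show "t <# (N \<inter> S) = u <# (N \<inter> S)" using l_coset_eq[OF NS, of t u] tu by simp
      next
        assume "t <# (N \<inter> S) = u <# (N \<inter> S)"
        then have "u \<in> t <# (N \<inter> S)" using l_coset_self[of u "N \<inter> S"] tu by simp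
        then obtain n where "n \<in> N \<inter> S" "u = t \<otimes> n" by (auto simp: l_coset_def)
        then show "inv t \<otimes> u \<in> N \<inter> S" using tu by (simp add: m_assoc[symmetric])
      qed
      finally show "(r \<otimes> t) <# N = (r \<otimes> u) <# N \<longleftrightarrow> t <# (N \<inter> S) = u <# (N \<inter> S)" .
    qed
    ultimately show ?thesis by simp
  qed
  ultimately show ?thesis
    using card_eq_card_image_times_fiber[OF finite_l_cosets[OF N(1) KD(4)], of ?F]
    by (simp add: coset_count_def)
qed

section \<open>Frobenius reciprocity on a stratum\<close>

locale lctd_fibration = lctd_topological_group G T + X: lctd_action G T X a + Q: lctd_action G T Q b
  for G (structure) and T :: "'a topology" and X :: "'x topology" and a and Q :: "'o topology" and b +
  fixes p :: "'x \<Rightarrow> 'o"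
  assumes continuous_p: "continuous_map X Q p"
    and equivariant: "g \<in> carrier G \<Longrightarrow> z \<in> topspace X \<Longrightarrow> p (a g z) = b g (p z)"
begin

lemma p_closed [simp]: "z \<in> topspace X \<Longrightarrow> p z \<in> topspace Q"
  using continuous_map_image_subset_topspace[OF continuous_p] by blast

definition cutoff :: "('x \<Rightarrow> complex) \<Rightarrow> 'o set \<Rightarrow> 'x \<Rightarrow> complex" where
  "cutoff f B = (\<lambda>z. if p z \<in> B then f z else 0)"

lemma cutoff_in_test_functions:
  assumes f: "f \<in> test_functions X" and B: "compact_open Q B"
  shows "cutoff f B \<in> test_functions X"
proof -
  let ?B = "{z \<in> topspace X. p z \<in> B}"
  have "openin X ?B" "closedin X ?B"
    using B compact_open_closedin[OF Q.Hausdorff_X B]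
    by (auto simp: compact_open_def intro!: openin_continuous_map_preimage[OF continuous_p]
        closedin_continuous_map_preimage[OF continuous_p])
  then have "(\<lambda>z. if z \<in> ?B then f z else 0) \<in> test_functions X"
    using f by (intro test_functions_cutoff)
  moreover have "(\<lambda>z. if z \<in> ?B then f z else 0) = cutoff f B"
    using test_functions_outside[OF f] by (auto simp: cutoff_def fun_eq_iff)
  ultimately show ?thesis by simp
qed

lemma cutoff_function_action:
  assumes g: "g \<in> carrier G" and B: "B \<subseteq> topspace Q"
  shows "cutoff (function_action G a X g f) (b g ` B) = function_action G a X g (cutoff f B)"
proof
  fix z
  show "cutoff (function_action G a X g f) (b g ` B) z = function_action G a X g (cutoff f B) z"
  proof (cases "z \<in> topspace X")
    case z: True
    have "p z \<in> b g ` B \<longleftrightarrow> b (inv g) (p z) \<in> B"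
      using g B z by (intro Q.mem_action_image) simp_all
    then show ?thesis using g z by (simp add: cutoff_def function_action_def equivariant)
  qed (simp add: cutoff_def function_action_def)
qed

end

text \<open>\<open>V\<close> is the part of the base over which \<open>\<xi>\<close> is already
  known to vanish, so that \<open>\<xi>\<close> only sees its closed stable complement.
  \<open>V\<close> is empty when \<open>\<xi>\<close> is compared with its extension over the open
  orbit, and grows by one orbit at a time in the vanishing argument.\<close>

locale stratum = lctd_fibration G T X a Q b p
  for G (structure) and T :: "'a topology" and X :: "'x topology" and a and Q :: "'o topology" and b
    and p :: "'x \<Rightarrow> 'o" +
  fixes V :: "'o set" and \<xi> :: "('x \<Rightarrow> complex) \<Rightarrow> complex"
  assumes V_open: "openin Q V"
    and V_stable: "g \<in> carrier G \<Longrightarrow> q \<in> topspace Q - V \<Longrightarrow> b g q \<notin> V"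
    and \<xi>_distribution: "\<xi> \<in> distributions X"
    and \<xi>_invariant: "g \<in> carrier G \<Longrightarrow> f \<in> test_functions X \<Longrightarrow> \<xi> (function_action G a X g f) = \<xi> f"
    and \<xi>_vanish: "f \<in> test_functions X \<Longrightarrow> (\<And>z. z \<in> topspace X \<Longrightarrow> p z \<notin> V \<Longrightarrow> f z = 0) \<Longrightarrow> \<xi> f = 0"
begin

abbreviation C where "C \<equiv> topspace Q - V"

abbreviation QC where "QC \<equiv> subtopology Q C"

lemma C_closed: "closedin Q C" using V_open by blast

lemma C_action: "g \<in> carrier G \<Longrightarrow> q \<in> C \<Longrightarrow> b g q \<in> C"
  using V_stable by simp

lemma \<xi>_eqI:
  assumes "f \<in> test_functions X" "h \<in> test_functions X"
    and "\<And>z. z \<in> topspace X \<Longrightarrow> p z \<notin> V \<Longrightarrow> f z = h z"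
  shows "\<xi> f = \<xi> h"
  using \<xi>_vanish[OF test_functions_diff[OF assms(1,2)]] assms(3)
    distributions_diff[OF \<xi>_distribution assms(1,2)] by simp

text \<open>\<open>slice f W\<close> is the value of \<open>\<xi>\<close> on the restriction of \<open>f\<close> to the preimage of \<open>W \<subseteq> C\<close>. It
  makes sense because \<open>\<xi>\<close> vanishes over \<open>V\<close>, so that \<open>W\<close> may be thickened to an open set of \<open>Q\<close>.\<close>

definition slice :: "('x \<Rightarrow> complex) \<Rightarrow> 'o set \<Rightarrow> complex" where
  "slice f W = \<xi> (cutoff f (SOME B. compact_open Q B \<and> B \<inter> C = W))"

lemma slice_eq:
  assumes f: "f \<in> test_functions X" and B: "compact_open Q B" "B \<inter> C = W"
  shows "slice f W = \<xi> (cutoff f B)"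
proof -
  define B' where "B' = (SOME B. compact_open Q B \<and> B \<inter> C = W)"
  have B': "compact_open Q B' \<and> B' \<inter> C = W" unfolding B'_def by (rule someI[of _ B]) (use B in simp)
  have "p z \<in> B' \<longleftrightarrow> p z \<in> B" if "z \<in> topspace X" "p z \<notin> V" for z
  proof -
    have "p z \<in> C" using that by simp
    then show ?thesis using B(2) B' by blast
  qed
  then have "\<xi> (cutoff f B') = \<xi> (cutoff f B)"
    using B B' f by (intro \<xi>_eqI cutoff_in_test_functions) (auto simp: cutoff_def)
  then show ?thesis by (simp add: slice_def B'_def)
qed

lemma thicken:
  assumes "compact_open QC W" obtains B where "compact_open Q B" "B \<inter> C = W"
  using compact_open_extend[OF Q.lctd_X assms] by blast

lemma slice_cong:
  assumes f: "f \<in> test_functions X" and h: "h \<in> test_functions X" and W: "compact_open QC W"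
    and eq: "\<And>z. z \<in> topspace X \<Longrightarrow> p z \<in> W \<Longrightarrow> f z = h z"
  shows "slice f W = slice h W"
proof -
  obtain B where B: "compact_open Q B" "B \<inter> C = W" using W by (rule thicken)
  have "cutoff f B z = cutoff h B z" if "z \<in> topspace X" "p z \<notin> V" for z
  proof (cases "p z \<in> B")
    case True
    then have "p z \<in> W" using that B(2) by auto
    then show ?thesis using eq that by (simp add: cutoff_def)
  qed (simp add: cutoff_def)
  then have "\<xi> (cutoff f B) = \<xi> (cutoff h B)"
    using f h B(1) by (intro \<xi>_eqI cutoff_in_test_functions)
  then show ?thesis using slice_eq[OF f B] slice_eq[OF h B] by simp
qed

lemma slice_add:
  assumes f: "f \<in> test_functions X" and h: "h \<in> test_functions X" and W: "compact_open QC W"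
  shows "slice (\<lambda>z. f z + h z) W = slice f W + slice h W"
proof -
  obtain B where B: "compact_open Q B" "B \<inter> C = W" using W by (rule thicken)
  have "cutoff (\<lambda>z. f z + h z) B = (\<lambda>z. cutoff f B z + cutoff h B z)"
    by (auto simp: cutoff_def)
  then show ?thesis
    using slice_eq[OF f B] slice_eq[OF h B] slice_eq[OF test_functions_add[OF f h] B]
      distributions_add[OF \<xi>_distribution cutoff_in_test_functions[OF f B(1)]
        cutoff_in_test_functions[OF h B(1)]] by simp
qed

lemma slice_cmult:
  assumes f: "f \<in> test_functions X" and W: "compact_open QC W"
  shows "slice (\<lambda>z. c * f z) W = c * slice f W"
proof -
  obtain B where B: "compact_open Q B" "B \<inter> C = W" using W by (rule thicken)
  have "cutoff (\<lambda>z. c * f z) B = (\<lambda>z. c * cutoff f B z)"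
    by (auto simp: cutoff_def)
  then show ?thesis
    using slice_eq[OF f B] slice_eq[OF test_functions_cmult[OF f] B]
      distributions_cmult[OF \<xi>_distribution cutoff_in_test_functions[OF f B(1)]] by simp
qed

lemma slice_empty:
  assumes f: "f \<in> test_functions X" shows "slice f {} = 0"
proof -
  have "cutoff f {} = (\<lambda>z. 0)" by (simp add: cutoff_def)
  then show ?thesis
    using slice_eq[OF f compact_open_empty] distributions_zero[OF \<xi>_distribution] by simp
qed

lemma slice_Un:
  assumes f: "f \<in> test_functions X" and W: "compact_open QC W" "compact_open QC W'" and disj: "W \<inter> W' = {}"
  shows "slice f (W \<union> W') = slice f W + slice f W'"
proof -
  obtain B where B: "compact_open Q B" "B \<inter> C = W" using W(1) by (rule thicken)
  obtain B' where B': "compact_open Q B'" "B' \<inter> C = W'" using W(2) by (rule thicken)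
  \<comment> \<open>Thickenings of disjoint sets may still overlap inside \<open>V\<close>; removing
    \<open>B\<close> from \<open>B'\<close> makes them disjoint without changing their traces on the
    complement.\<close>
  have D: "compact_open Q (B' - B)" using Q.Hausdorff_X B'(1) B(1) by (rule compact_open_diff)
  have "(B' - B) \<inter> C = W'" "(B \<union> (B' - B)) \<inter> C = W \<union> W'" using B(2) B'(2) disj by blast+
  moreover have "cutoff f (B \<union> (B' - B)) = (\<lambda>z. cutoff f B z + cutoff f (B' - B) z)"
    by (auto simp: cutoff_def)
  ultimately show ?thesis
    using slice_eq[OF f B] slice_eq[OF f D] slice_eq[OF f compact_open_Un[OF B(1) D]]
      distributions_add[OF \<xi>_distribution cutoff_in_test_functions[OF f B(1)]
        cutoff_in_test_functions[OF f D]] by simp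
qed

lemma slice_Union:
  assumes f: "f \<in> test_functions X" and "finite \<O>" "\<And>W. W \<in> \<O> \<Longrightarrow> compact_open QC W" "disjoint \<O>"
  shows "slice f (\<Union>\<O>) = (\<Sum>W\<in>\<O>. slice f W)"
  using assms(2-)
proof (induction \<O> rule: finite_induct)
  case (insert W \<O>)
  have "A \<inter> W = {}" if "A \<in> \<O>" for A
    using insert(2,5) that unfolding disjoint_def by fastforce
  then have "W \<inter> \<Union>\<O> = {}" by blast
  moreover have "compact_open QC (\<Union>\<O>)" using insert by (intro compact_open_Union) auto
  moreover have "disjoint \<O>" using insert(5) by (simp add: pairwise_insert)
  ultimately show ?case using insert slice_Un[OF f, of W "\<Union>\<O>"] by simp
qed (simp add: slice_empty[OF f])

lemma action_image_Int_C:
  assumes g: "g \<in> carrier G" and B: "B \<subseteq> topspace Q"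
  shows "b g ` B \<inter> C = b g ` (B \<inter> C)"
proof (rule Set.set_eqI)
  fix q
  show "q \<in> b g ` B \<inter> C \<longleftrightarrow> q \<in> b g ` (B \<inter> C)"
  proof (cases "q \<in> topspace Q")
    case q: True
    have "b (inv g) q \<in> C" if "q \<in> C" using C_action[OF inv_closed[OF g] that] .
    moreover have "q \<in> C" if "b (inv g) q \<in> C" using C_action[OF g that] g q by simp
    ultimately have "q \<in> C \<longleftrightarrow> b (inv g) q \<in> C" by blast
    moreover have "B \<inter> C \<subseteq> topspace Q" using B by blast
    ultimately show ?thesis
      using Q.mem_action_image[OF g B q] Q.mem_action_image[OF g _ q, of "B \<inter> C"] by blast
  next
    case False
    then show ?thesis using g B by auto
  qed
qed

lemma compact_open_QC_image:
  assumes g: "g \<in> carrier G" and W: "compact_open QC W"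
  shows "compact_open QC (b g ` W)"
proof -
  obtain B where B: "compact_open Q B" "B \<inter> C = W" using W by (rule thicken)
  have gB: "compact_open Q (b g ` B)"
    using Q.homeomorphic_map_action[OF g] B(1) by (rule compact_open_homeomorphic_image)
  have eq: "b g ` W = b g ` B \<inter> C"
    using action_image_Int_C[OF g compact_open_subset[OF B(1)]] B(2) by simp
  moreover have "compactin Q (b g ` B \<inter> C)"
    using gB C_closed by (auto simp: compact_open_def intro: compact_Int_closedin)
  moreover have "openin QC (b g ` B \<inter> C)"
    using gB by (intro openin_subtopology_Int) (simp add: compact_open_def)
  ultimately show ?thesis by (simp add: compact_open_def compactin_subtopology)
qed

lemma slice_function_action:
  assumes f: "f \<in> test_functions X" and g: "g \<in> carrier G" and W: "compact_open QC W"
  shows "slice (function_action G a X g f) (b g ` W) = slice f W"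
proof -
  obtain B where B: "compact_open Q B" "B \<inter> C = W" using W by (rule thicken)
  have BQ: "B \<subseteq> topspace Q" using B(1) by (rule compact_open_subset)
  have gf: "function_action G a X g f \<in> test_functions X" using g f by (rule X.function_action_in_test_functions)
  have gB: "compact_open Q (b g ` B)"
    using Q.homeomorphic_map_action[OF g] B(1) by (rule compact_open_homeomorphic_image)
  have "b g ` B \<inter> C = b g ` W" using action_image_Int_C[OF g BQ] B(2) by simp
  then have "slice (function_action G a X g f) (b g ` W) = \<xi> (function_action G a X g (cutoff f B))"
    using slice_eq[OF gf gB] cutoff_function_action[OF g BQ] by simp
  also have "\<dots> = \<xi> (cutoff f B)" using g cutoff_in_test_functions[OF f B(1)] by (rule \<xi>_invariant)
  finally show ?thesis using slice_eq[OF f B] by simp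
qed

lemma \<xi>_eq_slice:
  assumes f: "f \<in> test_functions X" and W: "compact_open QC W"
    and zero: "\<And>z. z \<in> topspace X \<Longrightarrow> p z \<in> C - W \<Longrightarrow> f z = 0"
  shows "\<xi> f = slice f W"
proof -
  obtain B where B: "compact_open Q B" "B \<inter> C = W" using W by (rule thicken)
  have "f z = cutoff f B z" if "z \<in> topspace X" "p z \<notin> V" for z
    using zero[of z] that B(2) by (auto simp: cutoff_def)
  then have "\<xi> f = \<xi> (cutoff f B)"
    using f B(1) by (intro \<xi>_eqI cutoff_in_test_functions)
  then show ?thesis using slice_eq[OF f B] by simp
qed

end

text \<open>Openness is demanded for all compact open \<open>K\<close> at once: arbitrarily small
  cells must be available, so that each test function is invariant under the group whose cells cut
  it up.\<close>

locale stratum_orbit = stratum G T X a Q b p V \<xi>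
  for G (structure) and T :: "'a topology" and X :: "'x topology" and a and Q :: "'o topology" and b
    and p :: "'x \<Rightarrow> 'o" and V \<xi> +
  fixes y :: 'o
  assumes y: "y \<in> topspace Q" "y \<notin> V"
    and orbit_open: "compact_open_subgroup K \<Longrightarrow> openin (subtopology Q (topspace Q - V)) (Q.partial_orbit K y)"
begin

lemma y_in_C: "y \<in> C" using y by simp

lemma orbit_subset_C: "orbit G b y \<subseteq> C"
  using C_action y_in_C by (auto simp: orbit_def)

lemma compact_open_base_orbit:
  assumes K: "compact_open_subgroup K" shows "compact_open QC (Q.partial_orbit K y)"
proof -
  have "Q.partial_orbit K y \<subseteq> C"
    using C_action[OF _ y_in_C] compact_open_subgroupD(5)[OF K] by (auto simp: Q.partial_orbit_def)
  then show ?thesis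
    using orbit_open[OF K] Q.compactin_partial_orbit[OF compact_open_subgroupD(4)[OF K] y(1)]
    by (simp add: compact_open_def compactin_subtopology)
qed

lemma partial_orbit_translate:
  assumes K: "compact_open_subgroup K" and h: "h \<in> carrier G"
  shows "Q.partial_orbit K (b h y) = b h ` Q.partial_orbit (inv h <# K #> h) y"
proof -
  have KG: "K \<subseteq> carrier G" using compact_open_subgroupD(5)[OF K] .
  have L: "inv h <# K #> h \<subseteq> carrier G"
    using compact_open_subgroupD(5)[OF compact_open_subgroup_conjugate[OF K inv_closed[OF h]]] h by simp
  have "h <# (inv h <# K #> h) #> inv h = K"
    using h KG by (rule subgroup_conjugation_is_surj0)
  then show ?thesis using Q.partial_orbit_conjugate[OF h L y(1)] by simp
qed

lemma compact_open_orbit: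
  assumes K: "compact_open_subgroup K" and q: "q \<in> orbit G b y"
  shows "compact_open QC (Q.partial_orbit K q)"
proof -
  obtain h where h: "h \<in> carrier G" "q = b h y" using q by (auto simp: orbit_def)
  have "compact_open_subgroup (inv h <# K #> h)"
    using compact_open_subgroup_conjugate[OF K inv_closed[OF h(1)]] h(1) by simp
  then show ?thesis
    unfolding h(2) partial_orbit_translate[OF K h(1)]
    by (intro compact_open_QC_image[OF h(1)] compact_open_base_orbit)
qed

lemma finite_partial_orbits:
  assumes K: "compact_open_subgroup K" and A: "compactin Q A" "A \<subseteq> orbit G b y"
  shows "finite (Q.partial_orbit K ` A)"
proof -
  note KD = compact_open_subgroupD[OF K]
  have AC: "A \<subseteq> C" using A(2) orbit_subset_C by blast
  then have AQ: "A \<subseteq> topspace Q" by blast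
  have "\<exists>\<F>. finite \<F> \<and> \<F> \<subseteq> Q.partial_orbit K ` A \<and> A \<subseteq> \<Union>\<F>"
  proof (rule compactinD)
    show "compactin QC A" using A(1) AC by (simp add: compactin_subtopology)
    show "openin QC U" if U: "U \<in> Q.partial_orbit K ` A" for U
    proof -
      obtain q where "q \<in> A" "U = Q.partial_orbit K q" using U by blast
      then show ?thesis using compact_open_orbit[OF K, of q] A(2) by (auto simp: compact_open_def)
    qed
    show "A \<subseteq> \<Union> (Q.partial_orbit K ` A)"
      using Q.partial_orbit_self[OF KD(1)] AQ by blast
  qed
  then obtain \<F> where \<F>: "finite \<F>" "\<F> \<subseteq> Q.partial_orbit K ` A" "A \<subseteq> \<Union>\<F>" by blast
  have "Q.partial_orbit K q \<in> \<F>" if q: "q \<in> A" for q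
  proof -
    obtain U where U: "U \<in> \<F>" "q \<in> U" using \<F>(3) q by blast
    obtain r where r: "r \<in> A" "U = Q.partial_orbit K r" using \<F>(2) U(1) by blast
    have "Q.partial_orbit K q = U"
      unfolding r(2) using r AQ U(2) by (intro Q.partial_orbit_eq[OF KD(1)]) auto
    then show ?thesis using U(1) by simp
  qed
  then have "Q.partial_orbit K ` A \<subseteq> \<F>" by blast
  then show ?thesis using \<F>(1) finite_subset by blast
qed

lemma disjoint_partial_orbits:
  assumes K: "subgroup K G" and A: "A \<subseteq> topspace Q"
  shows "disjoint (Q.partial_orbit K ` A)"
  unfolding disjoint_def
proof (intro ballI impI)
  fix U W assume U: "U \<in> Q.partial_orbit K ` A" and W: "W \<in> Q.partial_orbit K ` A" and "U \<noteq> W"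
  obtain u where u: "u \<in> A" "U = Q.partial_orbit K u" using U by blast
  obtain w where w: "w \<in> A" "W = Q.partial_orbit K w" using W by blast
  show "U \<inter> W = {}"
    using \<open>U \<noteq> W\<close> u w A unfolding u(2) w(2) by (intro Q.partial_orbit_disjoint[OF K]) auto
qed

lemma slice_partial_orbits:
  assumes f: "f \<in> test_functions X" and K: "compact_open_subgroup K"
    and A: "compactin Q A" "A \<subseteq> orbit G b y"
  shows "slice f (\<Union>(Q.partial_orbit K ` A)) = (\<Sum>W\<in>Q.partial_orbit K ` A. slice f W)"
proof (rule slice_Union[OF f finite_partial_orbits[OF K A]])
  show "compact_open QC W" if W: "W \<in> Q.partial_orbit K ` A" for W
    using W compact_open_orbit[OF K] A(2) by blast
  have "A \<subseteq> topspace Q" using A(1) by (rule compactin_subset_topspace)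
  then show "disjoint (Q.partial_orbit K ` A)"
    by (rule disjoint_partial_orbits[OF compact_open_subgroupD(1)[OF K]])
qed

text \<open>The image of the compact support meets the complement of \<open>V\<close> in a compact
  subset \<open>A\<close> of the orbit, so finitely many of the open cells \<open>K q\<close> cover
  it. Over the rest of the complement \<open>f\<close> vanishes, so these cells account for all of
  \<open>\<xi> f\<close>.\<close>

lemma \<xi>_eq_sum_slices:
  assumes f: "f \<in> test_functions X" and K: "compact_open_subgroup K"
    and supp: "\<And>z. z \<in> topspace X \<Longrightarrow> f z \<noteq> 0 \<Longrightarrow> p z \<in> V \<union> orbit G b y"
  defines "A \<equiv> p ` {z. f z \<noteq> 0} \<inter> C"
  shows "\<xi> f = (\<Sum>W\<in>Q.partial_orbit K ` A. slice f W)"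
    and "finite (Q.partial_orbit K ` A)" "A \<subseteq> orbit G b y"
proof -
  have supp_top: "z \<in> topspace X" if "f z \<noteq> 0" for z using that test_functions_outside[OF f] by blast
  have "compactin Q (p ` {z. f z \<noteq> 0})"
    using test_functions_support[OF f] image_compactin[OF _ continuous_p] by (simp add: compact_open_def)
  then have A: "compactin Q A" unfolding A_def using C_closed by (rule compact_Int_closedin)
  show A': "A \<subseteq> orbit G b y"
  proof
    fix q assume "q \<in> A"
    then obtain z where "f z \<noteq> 0" "q = p z" "q \<notin> V" unfolding A_def by blast
    then show "q \<in> orbit G b y" using supp[OF supp_top] by blast
  qed
  show fin: "finite (Q.partial_orbit K ` A)" using K A A' by (rule finite_partial_orbits)
  have "compact_open QC W" if W: "W \<in> Q.partial_orbit K ` A" for W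
    using W compact_open_orbit[OF K] A' by blast
  then have U: "compact_open QC (\<Union>(Q.partial_orbit K ` A))"
    using fin by (intro compact_open_Union)
  have "\<xi> f = slice f (\<Union>(Q.partial_orbit K ` A))"
  proof (rule \<xi>_eq_slice[OF f U])
    fix z assume z: "z \<in> topspace X" "p z \<in> C - \<Union>(Q.partial_orbit K ` A)"
    show "f z = 0"
    proof (rule ccontr)
      assume "f z \<noteq> 0"
      then have "p z \<in> A" using z unfolding A_def by blast
      moreover have "p z \<in> Q.partial_orbit K (p z)"
        using Q.partial_orbit_self[OF compact_open_subgroupD(1)[OF K]] z(1) by simp
      ultimately show False using z(2) by blast
    qed
  qed
  then show "\<xi> f = (\<Sum>W\<in>Q.partial_orbit K ` A. slice f W)"
    using slice_partial_orbits[OF f K A A'] by simp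
qed

text \<open>Normality makes the \<open>N\<close>-cells inside \<open>K y\<close> translates of
  \<open>N y\<close> by elements of \<open>K\<close>. As \<open>f\<close> and \<open>\<xi>\<close>
  are both invariant under \<open>K\<close>, each of these cells contributes the same
  amount.\<close>

lemma slice_normal_subgroup:
  assumes f: "f \<in> test_functions X" "X.invariant_under K f"
    and K: "compact_open_subgroup K" and N: "compact_open_subgroup N" "N \<subseteq> K"
    and normal: "\<And>k n. k \<in> K \<Longrightarrow> n \<in> N \<Longrightarrow> k \<otimes> n \<otimes> inv k \<in> N"
  shows "slice f (Q.partial_orbit K y) =
    of_nat (card (Q.partial_orbit N ` Q.partial_orbit K y)) * slice f (Q.partial_orbit N y)"
proof -
  note KD = compact_open_subgroupD[OF K] and ND = compact_open_subgroupD[OF N(1)]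
  let ?A = "Q.partial_orbit K y"
  have A: "compactin Q ?A" "?A \<subseteq> orbit G b y" "?A \<subseteq> topspace Q"
    using Q.compactin_partial_orbit[OF KD(4) y(1)] Q.partial_orbit_subset[OF KD(5) y(1)] KD(5)
    by (auto simp: Q.partial_orbit_def orbit_def)
  have translate: "Q.partial_orbit N (b k y) = b k ` Q.partial_orbit N y" if "k \<in> K" for k
    using Q.partial_orbit_normal[OF KD(1) ND(5) normal that y(1)] .
  have "\<Union>(Q.partial_orbit N ` ?A) = ?A"
  proof
    show "?A \<subseteq> \<Union>(Q.partial_orbit N ` ?A)"
      using Q.partial_orbit_self[OF ND(1)] A(3) by blast
    have "Q.partial_orbit N q \<subseteq> ?A" if q: "q \<in> ?A" for q
    proof -
      have "Q.partial_orbit N q \<subseteq> Q.partial_orbit K q" using N(2) by (auto simp: Q.partial_orbit_def)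
      also have "\<dots> = ?A" using KD(1) y(1) q by (rule Q.partial_orbit_eq)
      finally show ?thesis .
    qed
    then show "\<Union>(Q.partial_orbit N ` ?A) \<subseteq> ?A" by blast
  qed
  then have "slice f ?A = (\<Sum>W\<in>Q.partial_orbit N ` ?A. slice f W)"
    using slice_partial_orbits[OF f(1) N(1) A(1,2)] by simp
  also have "\<dots> = (\<Sum>W\<in>Q.partial_orbit N ` ?A. slice f (Q.partial_orbit N y))"
  proof (rule sum.cong[OF refl])
    fix W assume "W \<in> Q.partial_orbit N ` ?A"
    then obtain k where k: "k \<in> K" "W = b k ` Q.partial_orbit N y"
      using translate by (auto simp: Q.partial_orbit_def[of K])
    have "k \<in> carrier G" using k(1) KD(5) by blast
    then show "slice f W = slice f (Q.partial_orbit N y)"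
      using slice_function_action[OF f(1) _ compact_open_base_orbit[OF N(1)], of k]
        X.function_action_invariant[OF KD(1) k(1) f] k(2) by simp
  qed
  finally show ?thesis by simp
qed

end

section \<open>Restriction to a fiber and the normalized functional on it\<close>

context lctd_fibration
begin

definition fiber_restrict :: "'o \<Rightarrow> ('x \<Rightarrow> complex) \<Rightarrow> 'x \<Rightarrow> complex" where
  "fiber_restrict y f = (\<lambda>z. if z \<in> topspace X \<and> p z = y then f z else 0)"

lemma topspace_fiber: "topspace (fiber X p y) = {z \<in> topspace X. p z = y}"
  by (auto simp: fiber_def)

lemma fiber_restrict_in_test_functions:
  assumes y: "y \<in> topspace Q" and f: "f \<in> test_functions X"
  shows "fiber_restrict y f \<in> test_functions (fiber X p y)"
proof -
  have "closedin Q {y}" using Q.Hausdorff_X y by (simp add: closedin_Hausdorff_singleton)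
  then have "closedin X {z \<in> topspace X. p z \<in> {y}}"
    by (rule closedin_continuous_map_preimage[OF continuous_p])
  then show ?thesis
    using test_functions_restrict[OF f, of "{z \<in> topspace X. p z = y}"]
    by (simp add: fiber_restrict_def fiber_def)
qed

text \<open>\<open>distribution_action\<close> and \<open>function_action\<close> each take an
  inverse, formed in the stabilizer as a group of its own. Both inverses agree with those of the
  ambient group, so acting on the fiber is the restriction of acting on the whole space.\<close>

lemma fiber_restrict_function_action:
  assumes y: "y \<in> topspace Q" and s: "s \<in> stabilizer G b y"
  shows "function_action (G\<lparr>carrier := stabilizer G b y\<rparr>) a (fiber X p y)
      (inv\<^bsub>G\<lparr>carrier := stabilizer G b y\<rparr>\<^esub> s) (fiber_restrict y f) =
    fiber_restrict y (function_action G a X (inv s) f)"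
proof
  fix z
  let ?S = "stabilizer G b y"
  have S: "subgroup ?S G" using y by (rule Q.stabilizer_closed_subgroup(1))
  have sG: "s \<in> carrier G" and sy: "b s y = y" using s by (auto simp: stabilizer_def)
  have inv1: "inv\<^bsub>G\<lparr>carrier := ?S\<rparr>\<^esub> s = inv s" using S s by (rule m_inv_consistent)
  have "inv\<^bsub>G\<lparr>carrier := ?S\<rparr>\<^esub> (inv s) = inv (inv s)"
    using S subgroup.m_inv_closed[OF S s] by (rule m_inv_consistent)
  then have inv2: "inv\<^bsub>G\<lparr>carrier := ?S\<rparr>\<^esub> (inv\<^bsub>G\<lparr>carrier := ?S\<rparr>\<^esub> s) = s" using inv1 sG by simp
  show "function_action (G\<lparr>carrier := ?S\<rparr>) a (fiber X p y) (inv\<^bsub>G\<lparr>carrier := ?S\<rparr>\<^esub> s) (fiber_restrict y f) z =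
      fiber_restrict y (function_action G a X (inv s) f) z"
    unfolding function_action_def inv2 fiber_restrict_def topspace_fiber
    using sG sy by (simp add: equivariant)
qed

end

text \<open>The normalization \<open>\<nu>\<close> has to scale under passage to a normal subgroup
  exactly as slices of invariant functions do; then the quotient does not depend on
  \<open>K\<close>. Its failure to be invariant under conjugation by the stabilizer is recorded in
  \<open>\<delta>\<close>. It is complex valued because one of its two instances is a volume taken
  with respect to a distribution.\<close>

locale normalized_orbit = stratum_orbit G T X a Q b p V \<xi> y
  for G (structure) and T :: "'a topology" and X :: "'x topology" and a and Q :: "'o topology" and b
    and p :: "'x \<Rightarrow> 'o" and V \<xi> y +
  fixes \<nu> :: "'a set \<Rightarrow> complex" and \<delta> :: "'a \<Rightarrow> complex"
  assumes \<nu>_nonzero: "compact_open_subgroup K \<Longrightarrow> \<nu> K \<noteq> 0"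
    and \<nu>_index: "compact_open_subgroup K \<Longrightarrow> compact_open_subgroup N \<Longrightarrow> N \<subseteq> K \<Longrightarrow>
      (\<And>k n. k \<in> K \<Longrightarrow> n \<in> N \<Longrightarrow> k \<otimes> n \<otimes> inv k \<in> N) \<Longrightarrow>
      \<nu> K = of_nat (card (Q.partial_orbit N ` Q.partial_orbit K y)) * \<nu> N"
    and \<nu>_conjugate: "compact_open_subgroup K \<Longrightarrow> s \<in> stabilizer G b y \<Longrightarrow>
      \<delta> s * \<nu> (s <# K #> inv s) = \<nu> K"
begin

definition F where "F = {z \<in> topspace X. p z = y}"

lemma fiber_eq: "fiber X p y = subtopology X F"
  by (simp add: fiber_def F_def)

abbreviation restr :: "('x \<Rightarrow> complex) \<Rightarrow> 'x \<Rightarrow> complex" where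
  "restr \<equiv> fiber_restrict y"

lemma restr_def: "restr f = (\<lambda>z. if z \<in> F then f z else 0)"
  by (simp add: fiber_restrict_def F_def)

lemma restr_in_test_functions: "f \<in> test_functions X \<Longrightarrow> restr f \<in> test_functions (fiber X p y)"
  using y(1) by (rule fiber_restrict_in_test_functions)

lemma extend_from_fiber:
  assumes \<phi>: "\<phi> \<in> test_functions (fiber X p y)"
  obtains f K where "f \<in> test_functions X" "restr f = \<phi>" "compact_open_subgroup K" "X.invariant_under K f"
proof -
  obtain f where f: "f \<in> test_functions X" "\<And>z. z \<in> F \<Longrightarrow> f z = \<phi> z"
    by (rule test_functions_extend[OF X.lctd_X \<phi>[unfolded fiber_eq]]) blast
  have "restr f = \<phi>"
    using f(2) test_functions_outside[OF \<phi>] topspace_fiber by (auto simp: restr_def F_def fun_eq_iff)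
  moreover obtain K where "compact_open_subgroup K" "X.invariant_under K f"
    by (rule X.test_function_invariant[OF f(1) openin_carrier one_closed])
  ultimately show thesis using f(1) that by blast
qed

text \<open>\<open>L\<close> may fail to be normal in \<open>K\<close>, so both are compared with a
  subgroup \<open>N\<close> of \<open>L\<close> that is normal in \<open>K\<close> and therefore
  also normalized by \<open>L\<close>. The number of \<open>N\<close>-cells is nonzero because it
  divides the nonzero \<open>\<nu>\<close>.\<close>

lemma slice_ratio_subgroup:
  assumes f: "f \<in> test_functions X" "X.invariant_under K f"
    and K: "compact_open_subgroup K" and L: "compact_open_subgroup L" "L \<subseteq> K"
  shows "slice f (Q.partial_orbit K y) / \<nu> K = slice f (Q.partial_orbit L y) / \<nu> L"
proof -
  note LD = compact_open_subgroupD[OF L(1)]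
  obtain N where N: "compact_open_subgroup N" "N \<subseteq> K" "N \<subseteq> L"
      "\<And>k n. k \<in> K \<Longrightarrow> n \<in> N \<Longrightarrow> k \<otimes> n \<otimes> inv k \<in> N"
    by (rule normal_compact_open_subgroup[OF K LD(3,6)]) blast
  have ratio: "slice f (Q.partial_orbit M y) / \<nu> M = slice f (Q.partial_orbit N y) / \<nu> N"
    if M: "compact_open_subgroup M" "M \<subseteq> K" "N \<subseteq> M" for M
  proof -
    have normal: "k \<otimes> n \<otimes> inv k \<in> N" if "k \<in> M" "n \<in> N" for k n
      using N(4) M(2) that by blast
    have inv: "X.invariant_under M f" using f(2) M(2) by (rule X.invariant_under_mono)
    have s: "slice f (Q.partial_orbit M y) =
        of_nat (card (Q.partial_orbit N ` Q.partial_orbit M y)) * slice f (Q.partial_orbit N y)"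
      by (rule slice_normal_subgroup[OF f(1) inv M(1) N(1) M(3) normal])
    have n: "\<nu> M = of_nat (card (Q.partial_orbit N ` Q.partial_orbit M y)) * \<nu> N"
      by (rule \<nu>_index[OF M(1) N(1) M(3) normal])
    have "(of_nat (card (Q.partial_orbit N ` Q.partial_orbit M y)) :: complex) \<noteq> 0"
      using n \<nu>_nonzero[OF M(1)] by (metis mult_zero_left)
    then show ?thesis unfolding s n by simp
  qed
  show ?thesis using ratio[OF K order_refl N(2)] ratio[OF L N(3)] by simp
qed

text \<open>A function on the fiber is extended to the whole space, and the slice over a cell around
  \<open>y\<close> is divided by the size of the cell. Both the extension and the cell are arbitrary
  choices, justified only afterwards by \<open>\<zeta>_restr\<close>.\<close>

definition \<zeta> :: "('x \<Rightarrow> complex) \<Rightarrow> complex" where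
  "\<zeta> = (\<lambda>\<phi>\<in>test_functions (fiber X p y).
     let (f, K) = SOME (f, K). f \<in> test_functions X \<and> restr f = \<phi> \<and>
       compact_open_subgroup K \<and> X.invariant_under K f
     in slice f (Q.partial_orbit K y) / \<nu> K)"

text \<open>Two extensions with the same restriction to the fiber over \<open>y\<close>, both
  invariant under \<open>K' \<inter> K\<close>, agree over the entire cell of that group at
  \<open>y\<close>. Their slices there coincide, and the ratio lemma leads back to the original
  groups.\<close>

lemma \<zeta>_restr:
  assumes f: "f \<in> test_functions X" and K: "compact_open_subgroup K" and inv: "X.invariant_under K f"
  shows "\<zeta> (restr f) = slice f (Q.partial_orbit K y) / \<nu> K"
proof -
  define P where "P = (\<lambda>(f', K'). f' \<in> test_functions X \<and> restr f' = restr f \<and>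
       compact_open_subgroup K' \<and> X.invariant_under K' f')"
  obtain f' K' where fK: "(SOME u. P u) = (f', K')" by (cases "SOME u. P u")
  have "P (SOME u. P u)" by (rule someI[of P "(f, K)"]) (use f K inv in \<open>simp add: P_def\<close>)
  then have f': "f' \<in> test_functions X" "restr f' = restr f"
    and K': "compact_open_subgroup K'" "X.invariant_under K' f'"
    unfolding fK by (simp_all add: P_def)
  have "\<zeta> (restr f) = slice f' (Q.partial_orbit K' y) / \<nu> K'"
    using restr_in_test_functions[OF f] fK by (simp add: \<zeta>_def P_def)
  also have M: "compact_open_subgroup (K' \<inter> K)" using K'(1) K by (rule compact_open_subgroup_Int)
  have "slice f' (Q.partial_orbit K' y) / \<nu> K' = slice f' (Q.partial_orbit (K' \<inter> K) y) / \<nu> (K' \<inter> K)"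
    by (rule slice_ratio_subgroup[OF f'(1) K'(2,1) M]) simp
  also have "slice f' (Q.partial_orbit (K' \<inter> K) y) = slice f (Q.partial_orbit (K' \<inter> K) y)"
  proof (rule slice_cong[OF f'(1) f compact_open_base_orbit[OF M]])
    fix z assume z: "z \<in> topspace X" "p z \<in> Q.partial_orbit (K' \<inter> K) y"
    then obtain k where k: "k \<in> K'" "k \<in> K" "p z = b k y" by (auto simp: Q.partial_orbit_def)
    have kG: "k \<in> carrier G" using compact_open_subgroup_closed(1)[OF K k(2)] .
    define w where "w = a (inv k) z"
    have w: "w \<in> topspace X" "z = a k w" using kG z(1) by (simp_all add: w_def)
    have "p w = y" using kG z(1) k(3) y(1) by (simp add: w_def equivariant)
    then have "w \<in> F" using w(1) by (simp add: F_def)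
    then have "f' w = f w" using fun_cong[OF f'(2), of w] by (simp add: restr_def)
    then show "f' z = f z"
      unfolding w(2) using X.invariant_underD[OF inv k(2) w(1)] X.invariant_underD[OF K'(2) k(1) w(1)]
      by simp
  qed
  also have "slice f (Q.partial_orbit (K' \<inter> K) y) / \<nu> (K' \<inter> K) = slice f (Q.partial_orbit K y) / \<nu> K"
    by (rule slice_ratio_subgroup[OF f inv K M, symmetric]) simp
  finally show ?thesis .
qed

lemma \<zeta>_distribution: "\<zeta> \<in> distributions (fiber X p y)"
proof (rule distributionsI)
  show "\<phi> \<notin> test_functions (fiber X p y) \<Longrightarrow> \<zeta> \<phi> = undefined" for \<phi> by (simp add: \<zeta>_def)
next
  fix \<phi> \<psi> assume \<phi>: "\<phi> \<in> test_functions (fiber X p y)" and \<psi>: "\<psi> \<in> test_functions (fiber X p y)"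
  obtain f K where f: "f \<in> test_functions X" "restr f = \<phi>" "compact_open_subgroup K" "X.invariant_under K f"
    using \<phi> by (rule extend_from_fiber)
  obtain h L where h: "h \<in> test_functions X" "restr h = \<psi>" "compact_open_subgroup L" "X.invariant_under L h"
    using \<psi> by (rule extend_from_fiber)
  let ?M = "K \<inter> L"
  have M: "compact_open_subgroup ?M" using f(3) h(3) by (rule compact_open_subgroup_Int)
  have inv: "X.invariant_under ?M f" "X.invariant_under ?M h" "X.invariant_under ?M (\<lambda>z. f z + h z)"
    using f(4) h(4) by (auto simp: X.invariant_under_def)
  have "restr (\<lambda>z. f z + h z) = (\<lambda>z. \<phi> z + \<psi> z)"
    by (auto simp: restr_def fun_eq_iff f(2)[symmetric] h(2)[symmetric])
  then show "\<zeta> (\<lambda>z. \<phi> z + \<psi> z) = \<zeta> \<phi> + \<zeta> \<psi>"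
    using \<zeta>_restr[OF f(1) M inv(1)] \<zeta>_restr[OF h(1) M inv(2)]
      \<zeta>_restr[OF test_functions_add[OF f(1) h(1)] M inv(3)]
      slice_add[OF f(1) h(1) compact_open_base_orbit[OF M]] f(2) h(2)
    by (simp add: add_divide_distrib)
next
  fix c \<phi> assume \<phi>: "\<phi> \<in> test_functions (fiber X p y)"
  obtain f K where f: "f \<in> test_functions X" "restr f = \<phi>" "compact_open_subgroup K" "X.invariant_under K f"
    using \<phi> by (rule extend_from_fiber)
  have inv: "X.invariant_under K (\<lambda>z. c * f z)" using f(4) by (simp add: X.invariant_under_def)
  have "restr (\<lambda>z. c * f z) = (\<lambda>z. c * \<phi> z)" by (auto simp: restr_def fun_eq_iff f(2)[symmetric])
  then show "\<zeta> (\<lambda>z. c * \<phi> z) = c * \<zeta> \<phi>"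
    using \<zeta>_restr[OF f(1,3,4)] \<zeta>_restr[OF test_functions_cmult[OF f(1)] f(3) inv]
      slice_cmult[OF f(1) compact_open_base_orbit[OF f(3)]] f(2)
    by simp
qed

text \<open>Translating back by \<open>h\<close> turns any cell of the orbit into a cell at the base
  point of the conjugated group. Hence \<open>\<zeta>\<close> determines every slice over the orbit,
  and so all of \<open>\<xi>\<close> on this stratum.\<close>

lemma slice_orbit:
  assumes f: "f \<in> test_functions X" and K: "compact_open_subgroup K" and inv: "X.invariant_under K f"
    and h: "h \<in> carrier G"
  shows "slice f (Q.partial_orbit K (b h y)) =
    \<zeta> (restr (function_action G a X (inv h) f)) * \<nu> (inv h <# K #> h)"
proof -
  let ?f = "function_action G a X (inv h) f" and ?K = "inv h <# K #> h"
  have f': "?f \<in> test_functions X" using h f by (intro X.function_action_in_test_functions) auto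
  have K': "compact_open_subgroup ?K"
    using compact_open_subgroup_conjugate[OF K inv_closed[OF h]] h by simp
  have inv': "X.invariant_under ?K ?f"
    using X.invariant_under_function_action[OF inv_closed[OF h] compact_open_subgroupD(5)[OF K] inv] h
    by simp
  have "slice f (Q.partial_orbit K (b h y)) = slice (function_action G a X h ?f) (b h ` Q.partial_orbit ?K y)"
    using X.function_action_inv(1)[OF h f] partial_orbit_translate[OF K h] by simp
  also have "\<dots> = slice ?f (Q.partial_orbit ?K y)"
    by (rule slice_function_action[OF f' h compact_open_base_orbit[OF K']])
  also have "\<dots> = \<zeta> (restr ?f) * \<nu> ?K"
    using \<zeta>_restr[OF f' K' inv'] \<nu>_nonzero[OF K'] by simp
  finally show ?thesis .
qed

text \<open>For \<open>s\<close> in the stabilizer the cell at \<open>b s y\<close> is the cell at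
  \<open>y\<close>, so its slice can be computed directly or by translation along \<open>s\<close>.
  Comparing the two normalizations leaves the factor \<open>\<delta> s\<close>, and solving for the
  translated value puts its inverse into the character. This is the inverse that appears in
  (v).\<close>

lemma \<zeta>_equivariant:
  "\<zeta> \<in> equivariant_distributions (G\<lparr>carrier := stabilizer G b y\<rparr>) a (fiber X p y) (\<lambda>s. inverse (\<delta> s))"
  unfolding equivariant_distributions_def
proof (intro CollectI conjI ballI)
  show "\<zeta> \<in> distributions (fiber X p y)" by (rule \<zeta>_distribution)
  fix s assume "s \<in> carrier (G\<lparr>carrier := stabilizer G b y\<rparr>)"
  then have s: "s \<in> stabilizer G b y" by simp
  then have sG: "s \<in> carrier G" and sy: "b s y = y" by (auto simp: stabilizer_def)
  have "\<zeta> (restr (function_action G a X (inv s) f)) = inverse (\<delta> s) * \<zeta> (restr f)"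
    if f: "f \<in> test_functions X" and K: "compact_open_subgroup K" and inv: "X.invariant_under K f" for f K
  proof -
    let ?K = "inv s <# K #> s"
    have K': "compact_open_subgroup ?K"
      using compact_open_subgroup_conjugate[OF K inv_closed[OF sG]] sG by simp
    have "s <# ?K #> inv s = K"
      using sG compact_open_subgroupD(5)[OF K] by (rule subgroup_conjugation_is_surj0)
    then have \<nu>: "\<delta> s * \<nu> K = \<nu> ?K" using \<nu>_conjugate[OF K' s] by simp
    then have "\<delta> s \<noteq> 0" using \<nu>_nonzero[OF K'] by auto
    have "\<zeta> (restr f) * \<nu> K = slice f (Q.partial_orbit K y)"
      using \<zeta>_restr[OF f K inv] \<nu>_nonzero[OF K] by simp
    also have "\<dots> = \<zeta> (restr (function_action G a X (inv s) f)) * \<nu> ?K"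
      using slice_orbit[OF f K inv sG] sy by simp
    finally show ?thesis
      using \<nu>[symmetric] \<nu>_nonzero[OF K] \<open>\<delta> s \<noteq> 0\<close> by (simp add: field_simps)
  qed
  then have "\<zeta> (function_action (G\<lparr>carrier := stabilizer G b y\<rparr>) a (fiber X p y)
      (inv\<^bsub>G\<lparr>carrier := stabilizer G b y\<rparr>\<^esub> s) \<phi>) = inverse (\<delta> s) * \<zeta> \<phi>"
    if "\<phi> \<in> test_functions (fiber X p y)" for \<phi>
    using extend_from_fiber[OF that] fiber_restrict_function_action[OF y(1) s] by metis
  then show "distribution_action (G\<lparr>carrier := stabilizer G b y\<rparr>) a (fiber X p y) s \<zeta> =
      (\<lambda>\<phi>\<in>test_functions (fiber X p y). inverse (\<delta> s) * \<zeta> \<phi>)"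
    unfolding distribution_action_def by (intro restrict_ext)
qed

text \<open>On a function supported over \<open>V\<close> and the orbit, \<open>\<xi>\<close> is a
  finite sum of slices, each of which is a multiple of a value of \<open>\<zeta>\<close>. The set
  over which \<open>\<xi>\<close> is known to vanish thus grows by one orbit.\<close>

lemma \<xi>_vanish_extend:
  assumes zero: "\<zeta> = zero_distribution (fiber X p y)"
    and f: "f \<in> test_functions X"
    and supp: "\<And>z. z \<in> topspace X \<Longrightarrow> p z \<notin> V \<union> orbit G b y \<Longrightarrow> f z = 0"
  shows "\<xi> f = 0"
proof -
  obtain K where K: "compact_open_subgroup K" "X.invariant_under K f"
    by (rule X.test_function_invariant[OF f openin_carrier one_closed])
  have supp': "p z \<in> V \<union> orbit G b y" if "z \<in> topspace X" "f z \<noteq> 0" for z using supp that by blast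
  note sum = \<xi>_eq_sum_slices[OF f K(1) supp']
  have "slice f W = 0" if W: "W \<in> Q.partial_orbit K ` (p ` {z. f z \<noteq> 0} \<inter> C)" for W
  proof -
    obtain q where q: "q \<in> p ` {z. f z \<noteq> 0} \<inter> C" "W = Q.partial_orbit K q" using W by (rule imageE)
    then obtain h where h: "h \<in> carrier G" "q = b h y" using sum(3) by (auto simp: orbit_def)
    let ?f = "function_action G a X (inv h) f"
    have "restr ?f \<in> test_functions (fiber X p y)"
      using h(1) f by (intro restr_in_test_functions X.function_action_in_test_functions) auto
    then have "\<zeta> (restr ?f) = 0" by (simp add: zero zero_distribution_def)
    then show ?thesis using slice_orbit[OF f K h(1)] q(2) h(2) by simp
  qed
  then show ?thesis using sum(1) by simp
qed

end

section \<open>Normalization by Haar contents of the group and of the stabilizer\<close>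

context stratum_orbit
begin

text \<open>The cell \<open>K y\<close> is the quotient of \<open>K\<close> by
  \<open>K \<inter> S\<close>, so the quotient of the two contents plays the role of its volume even
  when the orbit carries no invariant measure. Conjugation changes numerator and denominator by the
  modular characters of the group and of \<open>S\<close>, whence their quotient as
  \<open>\<delta>\<close>. The subgroup \<open>K0\<close> only fixes the scale.\<close>

lemma normalized_orbit_haar:
  assumes K0: "compact_open_subgroup K0"
  defines "S \<equiv> stabilizer G b y"
  defines "m \<equiv> lctd_topological_group.haar_content (G\<lparr>carrier := S\<rparr>) (subtopology T S) (K0 \<inter> S)"
  shows "normalized_orbit G T X a Q b p V \<xi> y
    (\<lambda>K. complex_of_real (haar_content K0 K / m (K \<inter> S)))
    (\<lambda>s. complex_of_real (relative_modular_character G T S s))"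
proof -
  have S: "subgroup S G" "closedin T S"
    unfolding S_def using Q.stabilizer_closed_subgroup[OF y(1)] by simp_all
  interpret S: lctd_topological_group "G\<lparr>carrier := S\<rparr>" "subtopology T S"
    using S by (rule lctd_closed_subgroup)
  have cos: "S.compact_open_subgroup (K \<inter> S)" if "compact_open_subgroup K" for K
    using that S by (rule compact_open_subgroup_closed_subgroup)
  have m_def': "m = S.haar_content (K0 \<inter> S)" by (simp add: m_def)
  have m_pos: "0 < m (K \<inter> S)" if "compact_open_subgroup K" for K
    unfolding m_def' using S.compact_open_subgroupD[OF cos[OF that]]
    by (intro S.haar_content_pos[OF cos[OF K0]]) auto
  have h_pos: "0 < haar_content K0 K" if "compact_open_subgroup K" for K
    using compact_open_subgroupD[OF that] by (intro haar_content_pos[OF K0]) auto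
  show ?thesis
  proof unfold_locales
    show "complex_of_real (haar_content K0 K / m (K \<inter> S)) \<noteq> 0" if "compact_open_subgroup K" for K
      using m_pos[OF that] h_pos[OF that] by simp
  next
    fix K N assume K: "compact_open_subgroup K" and N: "compact_open_subgroup N" "N \<subseteq> K"
      and normal: "\<And>k n. k \<in> K \<Longrightarrow> n \<in> N \<Longrightarrow> k \<otimes> n \<otimes> inv k \<in> N"
    let ?c = "card (Q.partial_orbit N ` Q.partial_orbit K y)"
    have adapted: "adapted N K"
      using N(2) by (intro adapted_subgroup compact_open_subgroupD(1)[OF K] compact_open_subgroupD(1)[OF N(1)])
    have 1: "haar_content K0 K = real (coset_count K N) * haar_content K0 N"
      by (rule haar_content_eq_coset_count[OF K0 N(1) compact_open_subgroupD(2)[OF K] adapted])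
    have "N \<inter> S \<subseteq> K \<inter> S" using N(2) by blast
    then have "S.adapted (N \<inter> S) (K \<inter> S)"
      by (intro S.adapted_subgroup S.compact_open_subgroupD(1)[OF cos[OF K]]
          S.compact_open_subgroupD(1)[OF cos[OF N(1)]])
    then have 2: "m (K \<inter> S) = real (S.coset_count (K \<inter> S) (N \<inter> S)) * m (N \<inter> S)"
      unfolding m_def'
      by (rule S.haar_content_eq_coset_count[OF cos[OF K0] cos[OF N(1)]
            S.compact_open_subgroupD(2)[OF cos[OF K]]])
    have "S.coset_count (K \<inter> S) (N \<inter> S) = card ((\<lambda>t. t <# (N \<inter> S)) ` (K \<inter> S))"
      by (simp add: S.coset_count_def l_coset_def)
    then have 3: "coset_count K N = ?c * S.coset_count (K \<inter> S) (N \<inter> S)"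
      using Q.coset_count_eq_orbits_times_stabilizer[OF K N normal y(1)] by (simp add: S_def)
    have "haar_content K0 K / m (K \<inter> S) = real ?c * (haar_content K0 N / m (N \<inter> S))"
      using 1 2 3 m_pos[OF K] by (auto simp: field_simps)
    then show "complex_of_real (haar_content K0 K / m (K \<inter> S)) =
        of_nat ?c * complex_of_real (haar_content K0 N / m (N \<inter> S))"
      by (metis of_real_mult of_real_of_nat_eq)
  next
    fix K s assume K: "compact_open_subgroup K" and "s \<in> stabilizer G b y"
    then have s: "s \<in> S" by (simp add: S_def)
    have sG: "s \<in> carrier G" using S(1) s by (rule subgroup.mem_carrier)
    have inv: "inv\<^bsub>G\<lparr>carrier := S\<rparr>\<^esub> s = inv s" using S(1) s by (rule m_inv_consistent)
    let ?K = "s <# K #> inv s"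
    \<comment> \<open>As \<open>s\<close> lies in \<open>S\<close>, conjugation by it preserves
      \<open>S\<close>, so intersecting with \<open>S\<close> and conjugating can be exchanged. This
      makes the conjugation law available inside \<open>S\<close>.\<close>
    have "?K \<inter> S = s <# (K \<inter> S) #> inv s"
    proof -
      interpret sub: subgroup S G by (rule S(1))
      have KG: "K \<subseteq> carrier G" using compact_open_subgroupD(5)[OF K] .
      have "s \<otimes> k \<otimes> inv s \<in> S \<longleftrightarrow> k \<in> S" if k: "k \<in> K" for k
      proof
        have kG: "k \<in> carrier G" using k KG by blast
        assume "s \<otimes> k \<otimes> inv s \<in> S"
        then have "inv s \<otimes> (s \<otimes> k \<otimes> inv s) \<otimes> s \<in> S" using s by simp
        moreover have "inv s \<otimes> (s \<otimes> k \<otimes> inv s) \<otimes> s = k"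
          using kG sG by (simp add: m_assoc) (simp add: m_assoc[symmetric])
        ultimately show "k \<in> S" by simp
      qed (use s in simp)
      then show ?thesis unfolding l_coset_eq_image r_coset_eq_image image_image by blast
    qed
    then have "?K \<inter> S = s <#\<^bsub>G\<lparr>carrier := S\<rparr>\<^esub> (K \<inter> S) #>\<^bsub>G\<lparr>carrier := S\<rparr>\<^esub> inv\<^bsub>G\<lparr>carrier := S\<rparr>\<^esub> s"
      unfolding inv by (simp add: l_coset_def r_coset_def)
    then have 1: "modular_character (G\<lparr>carrier := S\<rparr>) (subtopology T S) s * m (?K \<inter> S) = m (K \<inter> S)"
      unfolding m_def' using S.haar_content_conjugate[OF cos[OF K0] cos[OF K], of s] s by simp
    have 2: "modular_character G T s * haar_content K0 ?K = haar_content K0 K"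
      by (rule haar_content_conjugate[OF K0 K sG])
    have pos: "0 < modular_character (G\<lparr>carrier := S\<rparr>) (subtopology T S) s"
      using s by (intro S.modular_character_pos) simp
    have K': "compact_open_subgroup ?K" using K sG by (rule compact_open_subgroup_conjugate)
    have "relative_modular_character G T S s * (haar_content K0 ?K / m (?K \<inter> S)) =
        haar_content K0 K / m (K \<inter> S)"
      unfolding relative_modular_character_def 1[symmetric] 2[symmetric]
      using pos m_pos[OF K'] by (simp add: field_simps)
    then show "complex_of_real (relative_modular_character G T S s) *
        complex_of_real (haar_content K0 ?K / m (?K \<inter> S)) =
        complex_of_real (haar_content K0 K / m (K \<inter> S))"
      by (metis of_real_mult)
  qed
qed

end

section \<open>Invariant distributions\<close>

lemma (in lctd_action) invariant_distributions_iff: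
  "\<xi> \<in> invariant_distributions G a X \<longleftrightarrow>
    \<xi> \<in> distributions X \<and>
    (\<forall>g\<in>carrier G. \<forall>f\<in>test_functions X. \<xi> (function_action G a X g f) = \<xi> f)"
proof -
  have "distribution_action G a X g \<xi> = (\<lambda>f\<in>test_functions X. 1 * \<xi> f) \<longleftrightarrow>
      (\<forall>f\<in>test_functions X. \<xi> (function_action G a X (inv g) f) = \<xi> f)" for g
    unfolding distribution_action_def by (auto simp: restrict_def fun_eq_iff)
  then have "\<xi> \<in> invariant_distributions G a X \<longleftrightarrow> \<xi> \<in> distributions X \<and>
      (\<forall>g\<in>carrier G. \<forall>f\<in>test_functions X. \<xi> (function_action G a X (inv g) f) = \<xi> f)"
    unfolding equivariant_distributions_def by simp
  then show ?thesis by (metis inv_closed inv_inv)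
qed

lemma (in lctd_action) orbit_subset: "z \<in> topspace X \<Longrightarrow> orbit G a z \<subseteq> topspace X"
  by (auto simp: orbit_def)

lemma (in lctd_action) orbit_eq:
  "z \<in> topspace X \<Longrightarrow> w \<in> orbit G a z \<Longrightarrow> orbit G a w = orbit G a z"
  using partial_orbit_eq[OF subgroup_self, of z w] by (simp add: partial_orbit_carrier)

text \<open>Baire's theorem is applied to the orbit itself with the singleton \<open>{z}\<close> as
  set of representatives, so that the cell it provides is the one at \<open>z\<close>.\<close>

lemma (in lctd_action) openin_partial_orbit_orbit:
  assumes sigma: "sigma_compact_space T" and K: "compact_open_subgroup K" and z: "z \<in> topspace X"
    and loc: "locally_compact_space (subtopology X (orbit G a z))"
  shows "openin (subtopology X (orbit G a z)) (partial_orbit K z)"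
proof -
  have z': "z \<in> orbit G a z" using group_action.orbit_refl[OF group_action z] .
  have stable: "a g w \<in> orbit G a z" if g: "g \<in> carrier G" and w: "w \<in> orbit G a z" for g w
  proof -
    have "a g w \<in> orbit G a w" using g by (auto simp: orbit_def)
    then show ?thesis using orbit_eq[OF z w] by simp
  qed
  obtain y where "y \<in> {z}" "openin (subtopology X (orbit G a z)) (partial_orbit K y)"
  proof (rule open_partial_orbit[OF sigma K orbit_subset[OF z] loc _ stable, of "{z}"])
    show "orbit G a z \<noteq> {}" using z' by blast
  qed (use z' in auto)
  then show ?thesis by simp
qed

lemma (in lctd_topological_group) function_action_subgroup:
  assumes "subgroup S G" "g \<in> S"
  shows "function_action (G\<lparr>carrier := S\<rparr>) \<phi> X g f = function_action G \<phi> X g f"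
  unfolding function_action_def m_inv_consistent[OF assms] by (rule refl)

section \<open>Volumes given by an invariant distribution on the base\<close>

locale invariant_volume = lctd_action G T Q b for G (structure) and T and Q :: "'o topology" and b +
  fixes \<theta> :: "('o \<Rightarrow> complex) \<Rightarrow> complex" and x :: 'o
  assumes \<theta>_invariant: "\<theta> \<in> invariant_distributions G b Q"
    and x: "x \<in> topspace Q"
    and x_orbit_open: "compact_open_subgroup K \<Longrightarrow> openin Q (partial_orbit K x)"
begin

text \<open>The base is regarded as a fibration over itself with the identity as projection. Slices
  of indicator functions are then volumes, and the cell counting applies to them unchanged.\<close>

sublocale stratum_orbit G T Q b Q b "\<lambda>q. q" "{}" \<theta> x
proof unfold_locales
  fix f assume f: "f \<in> test_functions Q" "\<And>z. z \<in> topspace Q \<Longrightarrow> z \<notin> {} \<Longrightarrow> f z = 0"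
  have "f z = 0" for z
    using f(2)[of z] test_functions_outside[OF f(1), of z] by (cases "z \<in> topspace Q") simp_all
  then have "f = (\<lambda>z. 0)" by (rule ext)
  moreover have "\<theta> (\<lambda>z. 0) = 0"
    using \<theta>_invariant distributions_zero[of \<theta> Q] unfolding invariant_distributions_iff by blast
  ultimately show "\<theta> f = 0" by simp
qed (use \<theta>_invariant x x_orbit_open in \<open>simp_all add: invariant_distributions_iff\<close>)

text \<open>Since \<open>\<theta>\<close> is just a linear functional, these values are complex and
  need not be positive; that they do not vanish has to be derived.\<close>

definition volume :: "'o set \<Rightarrow> complex" where
  "volume B = \<theta> (indicator B)"

lemma compact_open_partial_orbit:
  "compact_open_subgroup K \<Longrightarrow> compact_open Q (partial_orbit K x)"
  using x_orbit_open compactin_partial_orbit[OF compact_open_subgroupD(4) x] by (simp add: compact_open_def)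

lemma slice_indicator:
  assumes B: "compact_open Q B" "compact_open Q W" "W \<subseteq> B"
  shows "slice (indicator B) W = volume W"
proof -
  have "W \<inter> C = W" using compact_open_subset[OF B(2)] by blast
  moreover have "cutoff (indicator B) W = indicator W"
    using B(3) by (auto simp: cutoff_def indicator_def fun_eq_iff)
  ultimately show ?thesis
    using slice_eq[OF test_functions_indicator[OF Hausdorff_X B(1)] B(2)] by (simp add: volume_def)
qed

text \<open>The indicator of \<open>K x\<close> is invariant under \<open>K\<close>, so the equality
  of its slices over the \<open>N\<close>-cells applies.\<close>

lemma volume_index:
  assumes K: "compact_open_subgroup K" and N: "compact_open_subgroup N" "N \<subseteq> K"
    and normal: "\<And>k n. k \<in> K \<Longrightarrow> n \<in> N \<Longrightarrow> k \<otimes> n \<otimes> inv k \<in> N"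
  shows "volume (partial_orbit K x) =
    of_nat (card (partial_orbit N ` partial_orbit K x)) * volume (partial_orbit N x)"
proof -
  let ?B = "partial_orbit K x"
  have B: "compact_open Q ?B" and BN: "compact_open Q (partial_orbit N x)"
    using K N(1) by (simp_all add: compact_open_partial_orbit)
  have sub: "partial_orbit N x \<subseteq> ?B" using N(2) by (auto simp: partial_orbit_def)
  have stable: "b k z \<in> ?B \<longleftrightarrow> z \<in> ?B" if "k \<in> K" "z \<in> topspace Q" for k z
  proof -
    have "b k z \<in> partial_orbit K z" using that(1) by (simp add: partial_orbit_def)
    then have "partial_orbit K (b k z) = partial_orbit K z"
      by (rule partial_orbit_eq[OF compact_open_subgroupD(1)[OF K] that(2)])
    moreover have "b k z \<in> topspace Q" using that compact_open_subgroup_closed(1)[OF K] by simp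
    ultimately show ?thesis
      using partial_orbit_eq_iff[OF compact_open_subgroupD(1)[OF K] x] that(2) by metis
  qed
  then have "invariant_under K (indicator ?B)" by (simp add: invariant_under_def indicator_def)
  then have "slice (indicator ?B) ?B =
      of_nat (card (partial_orbit N ` ?B)) * slice (indicator ?B) (partial_orbit N x)"
    by (intro slice_normal_subgroup test_functions_indicator[OF Hausdorff_X B] K N normal)
  then show ?thesis using slice_indicator[OF B B] slice_indicator[OF B BN sub] by simp
qed

lemma volume_translate:
  assumes g: "g \<in> carrier G" and B: "compact_open Q B"
  shows "volume (b g ` B) = volume B"
proof -
  have BQ: "B \<subseteq> topspace Q" using B by (rule compact_open_subset)
  have "function_action G b Q g (indicator B) = indicator (b g ` B)"
  proof
    fix q
    show "function_action G b Q g (indicator B) q = indicator (b g ` B) q"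
    proof (cases "q \<in> topspace Q")
      case q: True
      show ?thesis
        using q mem_action_image[OF g BQ q] by (simp add: function_action_def indicator_def)
    next
      case False
      moreover have "b g ` B \<subseteq> topspace Q" using g BQ by auto
      ultimately show ?thesis by (auto simp: function_action_def indicator_def)
    qed
  qed
  then show ?thesis
    using \<xi>_invariant[OF g test_functions_indicator[OF Hausdorff_X B]] by (simp add: volume_def)
qed

lemma volume_partial_orbit_translate:
  assumes K: "compact_open_subgroup K" and h: "h \<in> carrier G"
  shows "volume (partial_orbit K (b h x)) = volume (partial_orbit (inv h <# K #> h) x)"
proof -
  have "compact_open_subgroup (inv h <# K #> h)"
    using compact_open_subgroup_conjugate[OF K inv_closed[OF h]] h by simp
  then show ?thesis
    unfolding partial_orbit_translate[OF K h] by (intro volume_translate[OF h] compact_open_partial_orbit)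
qed

text \<open>Both groups are compared with their intersection through normal subgroups, and each
  comparison factor is a quotient of numbers of cells. The point is that the factor is positive even
  though the volumes are complex.\<close>

lemma volume_comparable:
  assumes K: "compact_open_subgroup K" and L: "compact_open_subgroup L"
  obtains r :: real where "0 < r" "volume (partial_orbit K x) = of_real r * volume (partial_orbit L x)"
proof -
  have pos: "0 < card (partial_orbit N ` partial_orbit M x)"
    if "compact_open_subgroup M" "compact_open_subgroup N" for M N
  proof -
    note MD = compact_open_subgroupD[OF that(1)]
    have "partial_orbit M x \<subseteq> orbit G b x" using MD(5) by (auto simp: partial_orbit_def orbit_def)
    then have "finite (partial_orbit N ` partial_orbit M x)"
      by (intro finite_partial_orbits[OF that(2)] compactin_partial_orbit[OF MD(4) x])
    moreover have "partial_orbit M x \<noteq> {}" using partial_orbit_self[OF MD(1) x] by blast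
    ultimately show ?thesis by (simp add: card_gt_0_iff)
  qed
  have below: "\<exists>r>0. volume (partial_orbit M x) = of_real r * volume (partial_orbit M' x)"
    if M: "compact_open_subgroup M" and M': "compact_open_subgroup M'" "M' \<subseteq> M" for M M'
  proof -
    note D = compact_open_subgroupD[OF M'(1)]
    obtain N where N: "compact_open_subgroup N" "N \<subseteq> M" "N \<subseteq> M'"
        "\<And>k n. k \<in> M \<Longrightarrow> n \<in> N \<Longrightarrow> k \<otimes> n \<otimes> inv k \<in> N"
      by (rule normal_compact_open_subgroup[OF M D(3,6)]) blast
    have normal: "k \<otimes> n \<otimes> inv k \<in> N" if "k \<in> M'" "n \<in> N" for k n using N(4) M'(2) that by blast
    let ?c = "card (partial_orbit N ` partial_orbit M x)"
    let ?d = "card (partial_orbit N ` partial_orbit M' x)"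
    have "volume (partial_orbit M x) = of_nat ?c * volume (partial_orbit N x)"
      by (rule volume_index[OF M N(1,2,4)])
    moreover have "volume (partial_orbit M' x) = of_nat ?d * volume (partial_orbit N x)"
      by (rule volume_index[OF M'(1) N(1,3) normal])
    ultimately have "volume (partial_orbit M x) = of_real (real ?c / real ?d) * volume (partial_orbit M' x)"
      using pos[OF M'(1) N(1)] by simp
    then show ?thesis using pos[OF M N(1)] pos[OF M'(1) N(1)] by (intro exI[of _ "real ?c / real ?d"]) simp
  qed
  have KL: "compact_open_subgroup (K \<inter> L)" using K L by (rule compact_open_subgroup_Int)
  obtain r where r: "0 < r" "volume (partial_orbit K x) = of_real r * volume (partial_orbit (K \<inter> L) x)"
    using below[OF K KL] by blast
  obtain s where s: "0 < s" "volume (partial_orbit L x) = of_real s * volume (partial_orbit (K \<inter> L) x)"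
    using below[OF L KL] by blast
  show thesis by (rule that[of "r / s"]) (use r s in simp_all)
qed

text \<open>By transitivity a nonempty compact open set splits into finitely many translated cells,
  each of whose volumes is a positive multiple of one fixed number \<open>?v\<close>. Positivity
  rules out cancellation, so all volumes are positive multiples of \<open>?v\<close>. If
  \<open>?v\<close> were zero, \<open>\<theta>\<close> would vanish on all indicators and hence on
  all test functions.\<close>

lemma volume_nonzero:
  assumes transitive: "topspace Q \<subseteq> orbit G b x" and nonzero: "\<theta> \<noteq> zero_distribution Q"
    and B: "compact_open Q B" "B \<noteq> {}"
  shows "volume B \<noteq> 0"
proof -
  obtain M where M: "compact_open_subgroup M" by (rule exists_compact_open_subgroup)
  let ?v = "volume (partial_orbit M x)"
  have multiple: "\<exists>r::real>0. volume D = of_real r * ?v" if D: "compact_open Q D" "D \<noteq> {}" for D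
  proof -
    let ?f = "indicator D :: 'o \<Rightarrow> complex"
    have f: "?f \<in> test_functions Q" using Hausdorff_X D(1) by (rule test_functions_indicator)
    obtain K where K: "compact_open_subgroup K" "invariant_under K ?f"
      by (rule test_function_invariant[OF f openin_carrier one_closed])
    have DQ: "D \<subseteq> topspace Q" using D(1) by (rule compact_open_subset)
    have supp: "z \<in> {} \<union> orbit G b x" if "z \<in> topspace Q" for z using that transitive by blast
    have A: "(\<lambda>q. q) ` {z. ?f z \<noteq> 0} \<inter> C = D" using DQ by (auto simp: indicator_def)
    note sum = \<xi>_eq_sum_slices[OF f K(1) supp, unfolded A]
    have "\<exists>r::real>0. slice ?f W = of_real r * ?v" if W: "W \<in> partial_orbit K ` D" for W
    proof -
      obtain q where q: "q \<in> D" "W = partial_orbit K q" using W by blast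
      obtain h where h: "h \<in> carrier G" "q = b h x" using transitive q(1) DQ by (auto simp: orbit_def)
      have "W \<subseteq> D"
      proof
        fix w assume "w \<in> W"
        then obtain k where k: "k \<in> K" "w = b k q" using q(2) by (auto simp: partial_orbit_def)
        then have "?f w = ?f q" using invariant_underD[OF K(2), of k q] q(1) DQ by blast
        then show "w \<in> D" using q(1) by (simp add: indicator_def split: if_splits)
      qed
      moreover have W': "compact_open Q W"
        using compact_open_orbit[OF K(1), of q] q transitive DQ by (auto simp: subset_iff)
      ultimately have s: "slice ?f W = volume W" using D(1) by (intro slice_indicator)
      have L: "compact_open_subgroup (inv h <# K #> h)"
        using compact_open_subgroup_conjugate[OF K(1) inv_closed[OF h(1)]] h(1) by simp
      obtain r :: real where "0 < r" "volume (partial_orbit (inv h <# K #> h) x) = of_real r * ?v"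
        by (rule volume_comparable[OF L M])
      then show ?thesis
        using s volume_partial_orbit_translate[OF K(1) h(1)] q(2) h(2) by auto
    qed
    then obtain r where r: "\<And>W. W \<in> partial_orbit K ` D \<Longrightarrow> 0 < r W \<and> slice ?f W = of_real (r W) * ?v"
      by metis
    have "volume D = (\<Sum>W\<in>partial_orbit K ` D. of_real (r W) * ?v)"
      using sum(1) r by (simp add: volume_def)
    also have "\<dots> = of_real (\<Sum>W\<in>partial_orbit K ` D. r W) * ?v"
      by (simp add: sum_distrib_right)
    finally have "volume D = of_real (\<Sum>W\<in>partial_orbit K ` D. r W) * ?v" .
    moreover have "0 < (\<Sum>W\<in>partial_orbit K ` D. r W)"
      using sum(2) D(2) r by (intro sum_pos) auto
    ultimately show ?thesis by blast
  qed
  have "?v \<noteq> 0"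
  proof
    assume v: "?v = 0"
    have zero: "volume D = 0" if "compact_open Q D" for D
    proof (cases "D = {}")
      case True
      have "indicator {} = (\<lambda>q::'o. 0::complex)" by (simp add: fun_eq_iff)
      then show ?thesis using distributions_zero[OF \<xi>_distribution] True by (simp add: volume_def)
    next
      case False
      then show ?thesis using multiple[OF that] v by auto
    qed
    have "\<theta> f = zero_distribution Q f" if f: "f \<in> test_functions Q" for f
    proof -
      have level: "compact_open Q {z. f z = c}" if "c \<in> range f - {0}" for c
        using test_functions_vimage_compact_open[OF f, of "{c}"] that by simp
      have "f = (\<lambda>q. \<Sum>c\<in>range f - {0}. c * indicator {z. f z = c} q)"
        using test_functions_expansion[OF f] by (rule ext)
      then have "\<theta> f = \<theta> (\<lambda>q. \<Sum>c\<in>range f - {0}. c * indicator {z. f z = c} q)" by (rule arg_cong)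
      also have "\<dots> = (\<Sum>c\<in>range f - {0}. \<theta> (\<lambda>q. c * indicator {z. f z = c} q))"
        using level
        by (intro distributions_sum[OF \<xi>_distribution] test_functions_cmult test_functions_indicator[OF Hausdorff_X])
      also have "\<dots> = (\<Sum>c\<in>range f - {0}. c * volume {z. f z = c})"
        using level
        by (intro sum.cong refl)
          (simp add: volume_def distributions_cmult[OF \<xi>_distribution] test_functions_indicator[OF Hausdorff_X])
      also have "\<dots> = 0" using level zero by (intro sum.neutral) auto
      finally show ?thesis using f by (simp add: zero_distribution_def)
    qed
    moreover have "zero_distribution Q \<in> distributions Q"
      by (rule distributionsI)
        (simp_all add: zero_distribution_def test_functions_add test_functions_cmult)
    ultimately have "\<theta> = zero_distribution Q" by (intro distributions_eqI[OF \<xi>_distribution])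
    then show False using nonzero by simp
  qed
  moreover obtain r :: real where "0 < r" "volume B = of_real r * ?v" using multiple[OF B] by blast
  ultimately show ?thesis by simp
qed

end

section \<open>Extending an invariant distribution from a fiber\<close>

locale fiber_extension = lctd_fibration G T X a Q b p
  for G (structure) and T :: "'a topology" and X :: "'x topology" and a and Q :: "'o topology" and b
    and p :: "'x \<Rightarrow> 'o" +
  fixes x :: 'o and \<zeta> :: "('x \<Rightarrow> complex) \<Rightarrow> complex"
  assumes x: "x \<in> topspace Q" and transitive: "topspace Q \<subseteq> orbit G b x"
    and sigma: "sigma_compact_space T"
    and \<zeta>: "\<zeta> \<in> invariant_distributions (G\<lparr>carrier := stabilizer G b x\<rparr>) a (fiber X p x)"
begin

lemma openin_partial_orbit:
  assumes K: "compact_open_subgroup K" and q: "q \<in> topspace Q"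
  shows "openin Q (Q.partial_orbit K q)"
proof -
  have "x \<in> orbit G b q"
    using group_action.orbit_sym[OF Q.group_action x q] transitive q by blast
  then have "orbit G b q = topspace Q"
    using Q.orbit_eq[OF q] Q.orbit_subset[OF x] transitive by blast
  then show ?thesis
    using Q.openin_partial_orbit_orbit[OF sigma K q] Q.lctd_X by (simp add: lctd_space_def)
qed

text \<open>At \<open>q\<close> this is the value on \<open>f\<close> of the translate of
  \<open>\<zeta>\<close> to the fiber over \<open>q\<close>. Which element carries \<open>x\<close>
  to \<open>q\<close> is immaterial because \<open>\<zeta>\<close> is invariant under the
  stabilizer; the value 0 outside the base matches the extension of test functions by zero.\<close>

definition transport :: "('x \<Rightarrow> complex) \<Rightarrow> 'o \<Rightarrow> complex" where
  "transport f q = (if q \<in> topspace Q then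
     \<zeta> (fiber_restrict x (function_action G a X (inv (SOME h. h \<in> carrier G \<and> b h x = q)) f)) else 0)"

lemma \<zeta>_stabilizer:
  assumes f: "f \<in> test_functions X" and s: "s \<in> stabilizer G b x"
  shows "\<zeta> (fiber_restrict x (function_action G a X (inv s) f)) = \<zeta> (fiber_restrict x f)"
proof -
  let ?S = "G\<lparr>carrier := stabilizer G b x\<rparr>"
  have "distribution_action ?S a (fiber X p x) s \<zeta> = (\<lambda>\<phi>\<in>test_functions (fiber X p x). 1 * \<zeta> \<phi>)"
    using \<zeta> s unfolding equivariant_distributions_def by simp
  from fun_cong[OF this, of "fiber_restrict x f"] show ?thesis
    using fiber_restrict_in_test_functions[OF x f] fiber_restrict_function_action[OF x s, of f]
    unfolding distribution_action_def by simp
qed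

text \<open>Two elements carrying \<open>x\<close> to the same point differ by the stabilizer
  element \<open>s\<close>, which \<open>\<zeta>\<close> does not see.\<close>

lemma transport_eq:
  assumes f: "f \<in> test_functions X" and g: "g \<in> carrier G"
  shows "transport f (b g x) = \<zeta> (fiber_restrict x (function_action G a X (inv g) f))"
proof -
  define h where "h = (SOME h. h \<in> carrier G \<and> b h x = b g x)"
  have h: "h \<in> carrier G \<and> b h x = b g x" unfolding h_def by (rule someI[of _ g]) (simp add: g)
  define s where "s = inv h \<otimes> g"
  have "b s x = b (inv h) (b g x)" using g h x by (simp add: s_def Q.action_mult)
  also have "\<dots> = b (inv h) (b h x)" using h by simp
  also have "\<dots> = x" using h x by (intro Q.action_inv(1)) simp_all
  finally have s: "s \<in> stabilizer G b x" using g h by (simp add: stabilizer_def s_def)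
  have sG: "s \<in> carrier G" using g h by (simp add: s_def)
  have "inv g = inv s \<otimes> inv h" using g h by (simp add: s_def inv_mult_group m_assoc)
  then have "function_action G a X (inv g) f =
      function_action G a X (inv s) (function_action G a X (inv h) f)"
    using X.function_action_mult[of "inv s" "inv h" f] sG h by simp
  then have "\<zeta> (fiber_restrict x (function_action G a X (inv g) f)) =
      \<zeta> (fiber_restrict x (function_action G a X (inv h) f))"
    using \<zeta>_stabilizer[OF X.function_action_in_test_functions[OF inv_closed f] s, of h] h by simp
  then show ?thesis using g x by (simp add: transport_def h_def)
qed

lemma transport_invariant:
  assumes f: "f \<in> test_functions X" and k: "k \<in> carrier G" "function_action G a X (inv k) f = f"
    and q: "q \<in> topspace Q"
  shows "transport f (b k q) = transport f q"
proof -
  obtain h where h: "h \<in> carrier G" "q = b h x" using transitive q by (auto simp: orbit_def)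
  have "transport f (b k q) = transport f (b (k \<otimes> h) x)"
    using k h x by (simp add: Q.action_mult)
  also have "\<dots> = \<zeta> (fiber_restrict x (function_action G a X (inv h) (function_action G a X (inv k) f)))"
    using transport_eq[OF f, of "k \<otimes> h"] X.function_action_mult[of "inv h" "inv k" f] k(1) h(1)
    by (simp add: inv_mult_group)
  also have "\<dots> = transport f q" using k(2) transport_eq[OF f h(1)] h(2) by simp
  finally show ?thesis .
qed

lemma \<zeta>_distribution: "\<zeta> \<in> distributions (fiber X p x)"
  using \<zeta> by (simp add: equivariant_distributions_def)

lemma transport_outside:
  assumes f: "f \<in> test_functions X" and q: "q \<notin> p ` {z. f z \<noteq> 0}"
  shows "transport f q = 0"
proof (cases "q \<in> topspace Q")
  case True
  then obtain h where h: "h \<in> carrier G" "q = b h x" using transitive by (auto simp: orbit_def)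
  have "fiber_restrict x (function_action G a X (inv h) f) = (\<lambda>z. 0)"
  proof
    fix z
    have "f (a h z) = 0" if "z \<in> topspace X" "p z = x"
    proof (rule ccontr)
      assume "f (a h z) \<noteq> 0"
      moreover have "q = p (a h z)" using h that by (simp add: equivariant)
      ultimately show False using q by blast
    qed
    then show "fiber_restrict x (function_action G a X (inv h) f) z = 0"
      using h(1) by (simp add: fiber_restrict_def function_action_def)
  qed
  then show ?thesis
    unfolding h(2) transport_eq[OF f h(1)] using distributions_zero[OF \<zeta>_distribution] by simp
qed (simp add: transport_def)

text \<open>If \<open>f\<close> is invariant under \<open>K\<close>, its transport is constant on
  \<open>K\<close>-orbits, and these are open in the base. The support stays inside the compact
  image of the support of \<open>f\<close>.\<close>

lemma transport_in_test_functions: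
  assumes f: "f \<in> test_functions X" shows "transport f \<in> test_functions Q"
proof (rule test_functionsI)
  show "compactin Q (p ` {z. f z \<noteq> 0})"
    using test_functions_support[OF f] image_compactin[OF _ continuous_p] by (simp add: compact_open_def)
  show "\<And>q. q \<notin> p ` {z. f z \<noteq> 0} \<Longrightarrow> transport f q = 0" using f by (rule transport_outside)
  fix q assume q: "q \<in> topspace Q"
  obtain K where K: "compact_open_subgroup K" "X.invariant_under K f"
    by (rule X.test_function_invariant[OF f openin_carrier one_closed])
  note KD = compact_open_subgroupD[OF K(1)]
  have "transport f r = transport f q" if r: "r \<in> Q.partial_orbit K q" for r
  proof -
    obtain k where k: "k \<in> K" "r = b k q" using r by (auto simp: Q.partial_orbit_def)
    have "function_action G a X (inv k) f = f"
      using KD(1) compact_open_subgroup_closed(2)[OF K(1) k(1)] f K(2)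
      by (rule X.function_action_invariant)
    then show ?thesis
      unfolding k(2) using f compact_open_subgroup_closed(1)[OF K(1) k(1)] q
      by (intro transport_invariant)
  qed
  then show "\<exists>U c. openin Q U \<and> q \<in> U \<and> (\<forall>r\<in>U. transport f r = c)"
    using openin_partial_orbit[OF K(1) q] Q.partial_orbit_self[OF KD(1) q]
    by (intro exI[of _ "Q.partial_orbit K q"] exI[of _ "transport f q"] conjI ballI)
qed

lemma transport_add:
  assumes f: "f \<in> test_functions X" and h: "h \<in> test_functions X"
  shows "transport (\<lambda>z. f z + h z) = (\<lambda>q. transport f q + transport h q)"
proof
  fix q
  show "transport (\<lambda>z. f z + h z) q = transport f q + transport h q"
  proof (cases "q \<in> topspace Q")
    case True
    then obtain g where g: "g \<in> carrier G" "q = b g x" using transitive by (auto simp: orbit_def)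
    let ?r = "\<lambda>f. fiber_restrict x (function_action G a X (inv g) f)"
    have "?r (\<lambda>z. f z + h z) = (\<lambda>z. ?r f z + ?r h z)"
      by (simp add: fiber_restrict_def function_action_def fun_eq_iff)
    moreover have "?r f \<in> test_functions (fiber X p x)" "?r h \<in> test_functions (fiber X p x)"
      using f h g(1) x by (auto intro!: fiber_restrict_in_test_functions X.function_action_in_test_functions)
    ultimately show ?thesis
      unfolding g(2) transport_eq[OF f g(1)] transport_eq[OF h g(1)]
        transport_eq[OF test_functions_add[OF f h] g(1)]
      using distributions_add[OF \<zeta>_distribution] by simp
  qed (simp add: transport_def)
qed

lemma transport_cmult:
  assumes f: "f \<in> test_functions X"
  shows "transport (\<lambda>z. c * f z) = (\<lambda>q. c * transport f q)"
proof
  fix q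
  show "transport (\<lambda>z. c * f z) q = c * transport f q"
  proof (cases "q \<in> topspace Q")
    case True
    then obtain g where g: "g \<in> carrier G" "q = b g x" using transitive by (auto simp: orbit_def)
    let ?r = "\<lambda>f. fiber_restrict x (function_action G a X (inv g) f)"
    have "?r (\<lambda>z. c * f z) = (\<lambda>z. c * ?r f z)"
      by (simp add: fiber_restrict_def function_action_def fun_eq_iff)
    moreover have "?r f \<in> test_functions (fiber X p x)"
      using f g(1) x by (auto intro!: fiber_restrict_in_test_functions X.function_action_in_test_functions)
    ultimately show ?thesis
      unfolding g(2) transport_eq[OF f g(1)] transport_eq[OF test_functions_cmult[OF f] g(1)]
      using distributions_cmult[OF \<zeta>_distribution] by simp
  qed (simp add: transport_def)
qed

lemma transport_function_action:
  assumes f: "f \<in> test_functions X" and g: "g \<in> carrier G"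
  shows "transport (function_action G a X g f) = function_action G b Q g (transport f)"
proof
  fix q
  show "transport (function_action G a X g f) q = function_action G b Q g (transport f) q"
  proof (cases "q \<in> topspace Q")
    case True
    then obtain h where h: "h \<in> carrier G" "q = b h x" using transitive by (auto simp: orbit_def)
    have "b (inv g) q = b (inv g \<otimes> h) x" using g h x by (simp add: Q.action_mult)
    then have "function_action G b Q g (transport f) q = transport f (b (inv g \<otimes> h) x)"
      using True by (simp add: function_action_def)
    also have "\<dots> = \<zeta> (fiber_restrict x (function_action G a X (inv h \<otimes> g) f))"
      using transport_eq[OF f, of "inv g \<otimes> h"] g h(1) by (simp add: inv_mult_group)
    also have "\<dots> = transport (function_action G a X g f) q"
      using transport_eq[OF X.function_action_in_test_functions[OF g f] h(1)] h
        X.function_action_mult[of "inv h" g f] g by simp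
    finally show ?thesis by simp
  qed (simp add: transport_def function_action_def)
qed

text \<open>Composing with \<open>transport\<close> amounts to integrating the translates of
  \<open>\<zeta>\<close> over the base against \<open>\<eta>\<close>. Invariance is inherited
  because transport intertwines the two actions.\<close>

lemma transport_distribution:
  assumes \<eta>: "\<eta> \<in> invariant_distributions G b Q"
  shows "(\<lambda>f\<in>test_functions X. \<eta> (transport f)) \<in> invariant_distributions G a X"
proof -
  have \<eta>': "\<eta> \<in> distributions Q" and inv: "\<And>g h. g \<in> carrier G \<Longrightarrow> h \<in> test_functions Q \<Longrightarrow>
      \<eta> (function_action G b Q g h) = \<eta> h"
    using \<eta> unfolding Q.invariant_distributions_iff by auto
  show ?thesis
    unfolding X.invariant_distributions_iff
  proof (intro conjI ballI)
    show "(\<lambda>f\<in>test_functions X. \<eta> (transport f)) \<in> distributions X"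
      by (rule distributionsI)
        (simp_all add: test_functions_add test_functions_cmult transport_add transport_cmult
          distributions_add[OF \<eta>'] distributions_cmult[OF \<eta>'] transport_in_test_functions)
    show "(\<lambda>f\<in>test_functions X. \<eta> (transport f)) (function_action G a X g f) =
        (\<lambda>f\<in>test_functions X. \<eta> (transport f)) f"
      if "g \<in> carrier G" "f \<in> test_functions X" for g f
      using that by (simp add: X.function_action_in_test_functions transport_function_action inv
          transport_in_test_functions)
  qed
qed

end

text \<open>Induction on the number of orbits in the complement of \<open>V\<close>: Baire's theorem provides an orbit
  that is open in the complement, and on it Frobenius reciprocity kills \<open>\<xi>\<close>.\<close>

lemma (in lctd_fibration) vanishing_by_strata:
  assumes sigma: "sigma_compact_space T" and \<xi>: "\<xi> \<in> invariant_distributions G a X"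
    and Y: "finite Y" "Y \<subseteq> topspace Q - V" "topspace Q - V \<subseteq> (\<Union>y\<in>Y. orbit G b y)"
    and V: "openin Q V" "\<And>g q. g \<in> carrier G \<Longrightarrow> q \<in> topspace Q - V \<Longrightarrow> b g q \<notin> V"
    and vanish: "\<And>f. f \<in> test_functions X \<Longrightarrow>
      (\<And>z. z \<in> topspace X \<Longrightarrow> p z \<notin> V \<Longrightarrow> f z = 0) \<Longrightarrow> \<xi> f = 0"
    and fibers: "\<And>y. y \<in> topspace Q - V \<Longrightarrow>
      equivariant_distributions (G\<lparr>carrier := stabilizer G b y\<rparr>) a (fiber X p y)
        (\<lambda>h. complex_of_real (inverse (relative_modular_character G T (stabilizer G b y) h)))
      = {zero_distribution (fiber X p y)}"
    and f: "f \<in> test_functions X"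
  shows "\<xi> f = 0"
  using Y V vanish fibers
proof (induction Y arbitrary: V rule: finite_psubset_induct)
  case (psubset Y)
  note cover = psubset.prems(1,2) and V = psubset.prems(3,4) and vanish = psubset.prems(5)
    and fibers = psubset.prems(6)
  show ?case
  proof (cases "topspace Q - V = {}")
    case True
    show ?thesis
    proof (rule vanish[OF f])
      fix z assume "z \<in> topspace X" "p z \<notin> V"
      then have "p z \<in> topspace Q - V" by simp
      then show "f z = 0" using True by blast
    qed
  next
    case False
    have \<xi>': "\<xi> \<in> distributions X" "\<And>g f. g \<in> carrier G \<Longrightarrow> f \<in> test_functions X \<Longrightarrow>
        \<xi> (function_action G a X g f) = \<xi> f"
      using \<xi> unfolding X.invariant_distributions_iff by auto
    interpret st: stratum G T X a Q b p V \<xi>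
      by unfold_locales (use V \<xi>' vanish in blast)+
    let ?C = "topspace Q - V" and ?QC = "subtopology Q (topspace Q - V)"
    have locC: "locally_compact_space ?QC" and HC: "Hausdorff_space ?QC"
      using lctd_space_closed_subtopology[OF Q.lctd_X st.C_closed] by (auto simp: lctd_space_def)
    obtain K0 where K0: "compact_open_subgroup K0" by (rule exists_compact_open_subgroup)
    have "?C \<subseteq> topspace Q" by blast
    then obtain y where yY: "y \<in> Y" and Ky: "openin ?QC (Q.partial_orbit K0 y)"
      by (rule Q.open_partial_orbit[OF sigma K0 _ locC False st.C_action
            countable_finite[OF \<open>finite Y\<close>] cover])
    have y: "y \<in> topspace Q" "y \<notin> V" using yY cover(1) by auto
    let ?Z = "orbit G b y"
    have ZC: "?Z \<subseteq> ?C" using st.C_action[of _ y] y by (auto simp: orbit_def)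
    have "Q.partial_orbit K0 y \<subseteq> ?C" using openin_subset[OF Ky] by simp
    then have co: "compact_open ?QC (Q.partial_orbit K0 y)"
      using Ky Q.compactin_partial_orbit[OF compact_open_subgroupD(4)[OF K0] y(1)]
      by (simp add: compact_open_def compactin_subtopology)
    \<comment> \<open>Baire's theorem yields only one open cell, but its translates by the group
      exhaust the orbit, so the whole orbit is open in the complement.\<close>
    have "?Z = (\<Union>h\<in>carrier G. b h ` Q.partial_orbit K0 y)"
    proof
      show "?Z \<subseteq> (\<Union>h\<in>carrier G. b h ` Q.partial_orbit K0 y)"
        using Q.partial_orbit_self[OF compact_open_subgroupD(1)[OF K0] y(1)]
        unfolding orbit_def by blast
      show "(\<Union>h\<in>carrier G. b h ` Q.partial_orbit K0 y) \<subseteq> ?Z"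
      proof
        fix q assume "q \<in> (\<Union>h\<in>carrier G. b h ` Q.partial_orbit K0 y)"
        then obtain h k where hk: "h \<in> carrier G" "k \<in> K0" "q = b h (b k y)"
          unfolding Q.partial_orbit_def by blast
        have "k \<in> carrier G" using compact_open_subgroup_closed(1)[OF K0 hk(2)] .
        then have "q = b (h \<otimes> k) y" "h \<otimes> k \<in> carrier G" using hk y(1) by (simp_all add: Q.action_mult)
        then show "q \<in> ?Z" unfolding orbit_def by blast
      qed
    qed
    moreover have "openin ?QC (b h ` Q.partial_orbit K0 y)" if "h \<in> carrier G" for h
      using st.compact_open_QC_image[OF that co] by (simp add: compact_open_def)
    ultimately have Zopen: "openin ?QC ?Z" by auto
    have Ztop: "subtopology ?QC ?Z = subtopology Q ?Z"
      using ZC by (simp add: subtopology_subtopology Int_absorb1)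
    have locZ: "locally_compact_space (subtopology Q ?Z)"
      using locally_compact_space_open_subset[OF _ locC Zopen] HC Ztop by simp
    \<comment> \<open>The first use of Baire's theorem concerned the single group \<open>K0\<close>.
      The orbit, open in a locally compact space, is now known to be locally compact, so a second
      use on the orbit itself opens the cells at \<open>y\<close> of every \<open>K\<close>.\<close>
    have orbit_open: "openin ?QC (Q.partial_orbit K y)" if K: "compact_open_subgroup K" for K
    proof -
      have "openin (subtopology ?QC ?Z) (Q.partial_orbit K y)"
        using Q.openin_partial_orbit_orbit[OF sigma K y(1) locZ] Ztop by simp
      then show ?thesis using Zopen by (rule openin_trans_full)
    qed
    interpret so: stratum_orbit G T X a Q b p V \<xi> y
      by unfold_locales (use y orbit_open in blast)+
    interpret no: normalized_orbit G T X a Q b p V \<xi> y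
      "\<lambda>K. complex_of_real (haar_content K0 K / lctd_topological_group.haar_content
        (G\<lparr>carrier := stabilizer G b y\<rparr>) (subtopology T (stabilizer G b y)) (K0 \<inter> stabilizer G b y)
        (K \<inter> stabilizer G b y))"
      "\<lambda>s. complex_of_real (relative_modular_character G T (stabilizer G b y) s)"
      by (rule so.normalized_orbit_haar[OF K0])
    have zero: "no.\<zeta> = zero_distribution (fiber X p y)"
      using no.\<zeta>_equivariant fibers[of y] y by simp
    obtain W where W: "openin Q W" "?Z = W \<inter> ?C" using Zopen unfolding openin_subtopology by blast
    have "V \<union> ?Z = V \<union> W" using W openin_subset[OF W(1)] by blast
    then have Vopen: "openin Q (V \<union> ?Z)" using V(1) W(1) by (simp add: openin_Un)
    have stable: "b g q \<notin> V \<union> ?Z" if g: "g \<in> carrier G" and q: "q \<in> topspace Q - (V \<union> ?Z)" for g q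
    proof -
      have "b g q \<notin> ?Z"
      proof
        assume "b g q \<in> ?Z"
        then obtain h where "h \<in> carrier G" "b g q = b h y" by (auto simp: orbit_def)
        then have "b (inv g) (b g q) = b (inv g \<otimes> h) y" "inv g \<otimes> h \<in> carrier G"
          using g y(1) by (simp_all add: Q.action_mult)
        then have "q = b (inv g \<otimes> h) y" "inv g \<otimes> h \<in> carrier G" using g q by simp_all
        then have "q \<in> ?Z" unfolding orbit_def by blast
        then show False using q by blast
      qed
      then show ?thesis using V(2)[OF g, of q] q by blast
    qed
    have y_in: "y \<in> ?Z" using group_action.orbit_refl[OF Q.group_action y(1)] .
    \<comment> \<open>\<open>Y\<close> may contain several points of the orbit; all of them are
      removed, so that the remaining representatives lie outside the enlarged open set.\<close>
    show ?thesis
    proof (rule psubset.IH[of "Y - ?Z" "V \<union> ?Z"])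
      show "Y - ?Z \<subset> Y" using yY y_in by blast
      show "Y - ?Z \<subseteq> topspace Q - (V \<union> ?Z)" using cover(1) by blast
      show "topspace Q - (V \<union> ?Z) \<subseteq> (\<Union>y\<in>Y - ?Z. orbit G b y)"
      proof
        fix q assume q: "q \<in> topspace Q - (V \<union> ?Z)"
        then obtain w where w: "w \<in> Y" "q \<in> orbit G b w" using cover(2) by blast
        have "w \<notin> ?Z" using Q.orbit_eq[OF y(1), of w] w(2) q by blast
        then show "q \<in> (\<Union>y\<in>Y - ?Z. orbit G b y)" using w by blast
      qed
      show "openin Q (V \<union> ?Z)" by (rule Vopen)
      show "\<And>g q. g \<in> carrier G \<Longrightarrow> q \<in> topspace Q - (V \<union> ?Z) \<Longrightarrow> b g q \<notin> V \<union> ?Z" by (rule stable)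
      show "\<xi> f = 0" if "f \<in> test_functions X" "\<And>z. z \<in> topspace X \<Longrightarrow> p z \<notin> V \<union> ?Z \<Longrightarrow> f z = 0" for f
        using that by (rule no.\<xi>_vanish_extend[OF zero])
      show "equivariant_distributions (G\<lparr>carrier := stabilizer G b y\<rparr>) a (fiber X p y)
          (\<lambda>h. complex_of_real (inverse (relative_modular_character G T (stabilizer G b y) h)))
        = {zero_distribution (fiber X p y)}" if "y \<in> topspace Q - (V \<union> ?Z)" for y
        using that by (intro fibers) blast
    qed
  qed
qed

theorem proposition2p2:
  fixes G :: "('g, 'm) monoid_scheme" and TG :: "'g topology" and P :: "'g set"
    and X :: "'x topology" and Q :: "'o topology"
    and a :: "'g \<Rightarrow> 'x \<Rightarrow> 'x" and b :: "'g \<Rightarrow> 'o \<Rightarrow> 'o"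
    and p :: "'x \<Rightarrow> 'o" and x :: 'o and U :: "'o set"
  assumes "lctd_group G TG" and "sigma_compact_space TG"
    and "subgroup P G" and "closedin TG P"
    and "lctd_space X" and "lctd_space Q"
    and "continuous_action G TG X a" and "continuous_action G TG Q b"
    and "continuous_map X Q p" and "p ` topspace X = topspace Q"
    and "\<forall>g\<in>carrier G. \<forall>z\<in>topspace X. p (a g z) = b g (p z)"
    and i: "transitive_action G (topspace Q) b"
    and ii: "\<exists>\<xi>\<in>invariant_distributions G b Q. \<xi> \<noteq> zero_distribution Q"
    and iii: "finite (orbits (restrict_group G P) (topspace Q) b)"
    and "x \<in> topspace Q" and "U \<in> orbits (restrict_group G P) (topspace Q) b"
    and "openin Q U" and "x \<in> U"
    and iv: "invariant_distributions
               (restrict_group G (stabilizer (restrict_group G P) b x)) a (fiber X p x) =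
             invariant_distributions
               (restrict_group G (stabilizer G b x)) a (fiber X p x)"
    and v: "\<forall>y\<in>topspace Q - U.
              equivariant_distributions
                (restrict_group G (stabilizer (restrict_group G P) b y)) a (fiber X p y)
                (\<lambda>h. complex_of_real (inverse
                   (relative_modular_character (restrict_group G P) (subtopology TG P)
                      (stabilizer (restrict_group G P) b y) h)))
              = {zero_distribution (fiber X p y)}"
  shows "invariant_distributions (restrict_group G P) a X = invariant_distributions G a X"
proof -
  note sigma = \<open>sigma_compact_space TG\<close> and P = \<open>subgroup P G\<close> and Pc = \<open>closedin TG P\<close>
    and xQ = \<open>x \<in> topspace Q\<close> and Uopen = \<open>openin Q U\<close> and xU = \<open>x \<in> U\<close>
  let ?P = "restrict_group G P" and ?TP = "subtopology TG P"
  have "group G" using \<open>lctd_group G TG\<close> by (simp add: lctd_group_def topological_group_def)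
  then interpret group G .
  interpret fib: lctd_fibration G TG X a Q b p
    by unfold_locales (use assms(1,5-9,11) in simp_all)
  interpret PX: lctd_action ?P ?TP X a using P Pc by (rule fib.X.action_closed_subgroup)
  interpret PQ: lctd_action ?P ?TP Q b using P Pc by (rule fib.Q.action_closed_subgroup)
  have PG: "P \<subseteq> carrier G" using P by (rule subgroup.subset)
  interpret PF: lctd_fibration ?P ?TP X a Q b p
    by unfold_locales (use assms(9,11) PG in \<open>auto simp: subset_iff\<close>)
  have sigmaP: "sigma_compact_space ?TP" using sigma Pc by (rule sigma_compact_closed_subtopology)
  have invP: "inv\<^bsub>?P\<^esub> g = inv\<^bsub>G\<^esub> g" if "g \<in> P" for g using P that by (rule m_inv_consistent)
  have actX: "function_action ?P a X g f = function_action G a X g f" if "g \<in> P" for g f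
    using P that by (rule fib.function_action_subgroup)
  have actQ: "function_action ?P b Q g f = function_action G b Q g f" if "g \<in> P" for g f
    using P that by (rule fib.function_action_subgroup)
  have easy: "\<xi> \<in> invariant_distributions ?P a X" if "\<xi> \<in> invariant_distributions G a X" for \<xi>
    using that PG unfolding fib.X.invariant_distributions_iff PX.invariant_distributions_iff
    by (auto simp: actX)
  obtain \<theta> where \<theta>: "\<theta> \<in> invariant_distributions G b Q" "\<theta> \<noteq> zero_distribution Q" using ii by blast
  then have \<theta>P: "\<theta> \<in> invariant_distributions ?P b Q"
    using PG unfolding fib.Q.invariant_distributions_iff PQ.invariant_distributions_iff
    by (auto simp: actQ)
  have transitive: "topspace Q \<subseteq> orbit G b x"
    using transitive_action.unique_orbit[OF i xQ] unfolding orbit_def by blast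
  then have orbitG: "orbit G b x = topspace Q" using fib.Q.orbit_subset[OF xQ] by blast
  have locQ: "locally_compact_space Q" using \<open>lctd_space Q\<close> by (simp add: lctd_space_def)
  \<comment> \<open>The distribution \<open>\<theta>\<close> is used under both groups: transitivity
    of the large group gives nonvanishing of volumes, while the cells that occur are orbits of
    subgroups of \<open>P\<close>. Both volumes are the value of \<open>\<theta>\<close> on an
    indicator, so nonvanishing carries over.\<close>
  interpret GV: invariant_volume G TG Q b \<theta> x
  proof unfold_locales
    show "openin Q (fib.Q.partial_orbit K x)" if "fib.compact_open_subgroup K" for K
      using fib.Q.openin_partial_orbit_orbit[OF sigma that xQ] orbitG locQ by simp
  qed (use \<theta>(1) xQ in simp_all)
  obtain u where u: "u \<in> topspace Q" "U = orbit ?P b u"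
    using \<open>U \<in> orbits ?P (topspace Q) b\<close> unfolding orbits_def by blast
  then have orbitP: "orbit ?P b x = U" using PQ.orbit_eq[OF u(1), of x] xU by simp
  have locU: "locally_compact_space (subtopology Q U)"
    using locally_compact_space_open_subset[OF _ locQ Uopen] lctd_space_Hausdorff[OF \<open>lctd_space Q\<close>] by simp
  \<comment> \<open>The orbit of \<open>x\<close> under \<open>P\<close> is \<open>U\<close>. It is
    open and hence locally compact, so its cells are open in \<open>U\<close> by Baire's theorem and
    therefore open in the base.\<close>
  have openP: "openin Q (PQ.partial_orbit K x)" if "PX.compact_open_subgroup K" for K
  proof -
    have "openin (subtopology Q U) (PQ.partial_orbit K x)"
      using PQ.openin_partial_orbit_orbit[OF sigmaP that xQ] orbitP locU by simp
    then show ?thesis using Uopen by (rule openin_trans_full)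
  qed
  interpret PV: invariant_volume ?P ?TP Q b \<theta> x
    by unfold_locales (use \<theta>P xQ openP in simp_all)
  have "\<xi> \<in> invariant_distributions G a X" if \<xi>: "\<xi> \<in> invariant_distributions ?P a X" for \<xi>
  proof -
    have \<xi>': "\<xi> \<in> distributions X" and \<xi>_inv: "\<And>g f. g \<in> P \<Longrightarrow> f \<in> test_functions X \<Longrightarrow>
        \<xi> (function_action ?P a X g f) = \<xi> f"
      using \<xi> unfolding PX.invariant_distributions_iff by auto
    \<comment> \<open>Nothing is discarded yet, so \<open>V\<close> is empty. The volume of a cell
      at \<open>x\<close> is unchanged when its group is conjugated by a stabilizer element, as this
      only translates the cell; hence \<delta> is 1 and the functional obtained is invariant without
      a character, as (iv) requires.\<close>
    interpret PN: normalized_orbit ?P ?TP X a Q b p "{}" \<xi> x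
      "\<lambda>K. PV.volume (PQ.partial_orbit K x)" "\<lambda>_. 1"
    proof unfold_locales
      fix f assume f: "f \<in> test_functions X" "\<And>z. z \<in> topspace X \<Longrightarrow> p z \<notin> {} \<Longrightarrow> f z = 0"
      have "f z = 0" for z
        using f(2)[of z] test_functions_outside[OF f(1), of z] by (cases "z \<in> topspace X") simp_all
      then have "f = (\<lambda>z. 0)" by (rule ext)
      then show "\<xi> f = 0" using distributions_zero[OF \<xi>'] by simp
    next
      fix K assume K: "PX.compact_open_subgroup K"
      have "PQ.partial_orbit K x \<noteq> {}"
        using PQ.partial_orbit_self[OF PX.compact_open_subgroupD(1)[OF K] xQ] by blast
      then show "PV.volume (PQ.partial_orbit K x) \<noteq> 0"
        using GV.volume_nonzero[OF transitive \<theta>(2) PV.compact_open_partial_orbit[OF K]]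
        by (simp add: PV.volume_def GV.volume_def)
      fix N assume N: "PX.compact_open_subgroup N" "N \<subseteq> K"
        "\<And>k n. k \<in> K \<Longrightarrow> n \<in> N \<Longrightarrow> k \<otimes>\<^bsub>?P\<^esub> n \<otimes>\<^bsub>?P\<^esub> inv\<^bsub>?P\<^esub> k \<in> N"
      show "PV.volume (PQ.partial_orbit K x) =
          of_nat (card (PQ.partial_orbit N ` PQ.partial_orbit K x)) * PV.volume (PQ.partial_orbit N x)"
        using K N by (rule PV.volume_index)
    next
      fix K s assume K: "PX.compact_open_subgroup K" and s: "s \<in> stabilizer ?P b x"
      then have sP: "s \<in> carrier ?P" and sx: "b s x = x" by (auto simp: stabilizer_def)
      have "PQ.partial_orbit (s <#\<^bsub>?P\<^esub> K #>\<^bsub>?P\<^esub> inv\<^bsub>?P\<^esub> s) x = b s ` PQ.partial_orbit K x"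
        using PQ.partial_orbit_conjugate[OF sP PX.compact_open_subgroupD(5)[OF K] xQ] sx by simp
      then show "1 * PV.volume (PQ.partial_orbit (s <#\<^bsub>?P\<^esub> K #>\<^bsub>?P\<^esub> inv\<^bsub>?P\<^esub> s) x) =
          PV.volume (PQ.partial_orbit K x)"
        using PV.volume_translate[OF sP PV.compact_open_partial_orbit[OF K]] by simp
    qed (use \<xi>' \<xi>_inv xQ openP in simp_all)
    have "PN.\<zeta> \<in> invariant_distributions
        (restrict_group G (stabilizer (restrict_group G P) b x)) a (fiber X p x)"
      using PN.\<zeta>_equivariant by simp
    then have "PN.\<zeta> \<in> invariant_distributions (restrict_group G (stabilizer G b x)) a (fiber X p x)"
      unfolding iv .
    then interpret FE: fiber_extension G TG X a Q b p x PN.\<zeta>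
      by unfold_locales (use xQ transitive sigma in simp_all)
    define \<xi>1 where "\<xi>1 = (\<lambda>f\<in>test_functions X. \<theta> (FE.transport f))"
    have \<xi>1: "\<xi>1 \<in> invariant_distributions G a X"
      unfolding \<xi>1_def using \<theta>(1) by (rule FE.transport_distribution)
    have eq: "\<xi> f = \<xi>1 f"
      if f: "f \<in> test_functions X" and supp: "\<And>z. z \<in> topspace X \<Longrightarrow> p z \<notin> U \<Longrightarrow> f z = 0" for f
    proof -
      obtain K where K: "PX.compact_open_subgroup K" "PX.invariant_under K f"
        by (rule PX.test_function_invariant[OF f PX.openin_carrier PX.one_closed])
      note KD = PX.compact_open_subgroupD[OF K(1)]
      have KP: "K \<subseteq> P" using KD(5) by simp
      have supp': "p z \<in> {} \<union> orbit ?P b x" if "z \<in> topspace X" "f z \<noteq> 0" for z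
        using supp that orbitP by blast
      let ?A = "p ` {z. f z \<noteq> 0} \<inter> (topspace Q - {})"
      let ?\<W> = "PQ.partial_orbit K ` ?A"
      note sums = PN.\<xi>_eq_sum_slices[OF f K(1) supp']
      \<comment> \<open>On each cell \<open>W\<close> the transport of \<open>f\<close> is constant,
        and this constant times the volume of \<open>W\<close> is the slice of \<open>\<xi>\<close>.
        The volume by which \<open>\<zeta>\<close> was normalized belongs to the cell translated
        back to \<open>x\<close>, which by invariance has the volume of \<open>W\<close>, so the
        normalization cancels.\<close>
      have "\<forall>W\<in>?\<W>. \<exists>c. (\<forall>r\<in>W. FE.transport f r = c) \<and> PN.slice f W = c * \<theta> (indicator W)"
      proof
        fix W assume W: "W \<in> ?\<W>"
        obtain q where q: "q \<in> ?A" "W = PQ.partial_orbit K q" using W by (rule imageE)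
        then obtain h where h: "h \<in> P" "q = b h x" using sums(3) by (auto simp: orbit_def)
        have hG: "h \<in> carrier G" using h(1) PG by blast
        have qQ: "q \<in> topspace Q" using q(1) by blast
        have "FE.transport f r = FE.transport f q" if r: "r \<in> W" for r
        proof -
          obtain k where k: "k \<in> K" "r = b k q" using r q(2) by (auto simp: PQ.partial_orbit_def)
          have kP: "k \<in> P" "inv\<^bsub>G\<^esub> k \<in> P" using k(1) KP subgroup.m_inv_closed[OF P] by auto
          have "function_action ?P a X (inv\<^bsub>?P\<^esub> k) f = f"
            using KD(1) PX.compact_open_subgroup_closed(2)[OF K(1) k(1)] f K(2)
            by (rule PX.function_action_invariant)
          then have "function_action G a X (inv\<^bsub>G\<^esub> k) f = f" unfolding invP[OF kP(1)] actX[OF kP(2)] .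
          then show ?thesis
            unfolding k(2) using kP(1) PG qQ by (intro FE.transport_invariant[OF f]) auto
        qed
        moreover have "PN.slice f W = FE.transport f q * \<theta> (indicator W)"
        proof -
          have hP: "h \<in> carrier ?P" "inv\<^bsub>G\<^esub> h \<in> P" using h(1) subgroup.m_inv_closed[OF P] by auto
          have s: "PN.slice f W = PN.\<zeta> (PF.fiber_restrict x (function_action ?P a X (inv\<^bsub>?P\<^esub> h) f)) *
              PV.volume (PQ.partial_orbit (inv\<^bsub>?P\<^esub> h <#\<^bsub>?P\<^esub> K #>\<^bsub>?P\<^esub> h) x)"
            unfolding q(2) h(2) by (rule PN.slice_orbit[OF f K hP(1)])
          have t: "FE.transport f q = PN.\<zeta> (PF.fiber_restrict x (function_action ?P a X (inv\<^bsub>?P\<^esub> h) f))"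
            unfolding h(2) FE.transport_eq[OF f hG] invP[OF h(1)] actX[OF hP(2)] by (rule refl)
          have e: "PV.volume W = PV.volume (PQ.partial_orbit (inv\<^bsub>?P\<^esub> h <#\<^bsub>?P\<^esub> K #>\<^bsub>?P\<^esub> h) x)"
            unfolding q(2) h(2) by (rule PV.volume_partial_orbit_translate[OF K(1) hP(1)])
          show ?thesis
            unfolding s t trans[OF e[symmetric] PV.volume_def] by (rule refl)
        qed
        ultimately show "\<exists>c. (\<forall>r\<in>W. FE.transport f r = c) \<and> PN.slice f W = c * \<theta> (indicator W)"
          by (intro exI[of _ "FE.transport f q"] conjI ballI)
      qed
      from bchoice[OF this] obtain c where
        c': "\<forall>W\<in>?\<W>. (\<forall>r\<in>W. FE.transport f r = c W) \<and> PN.slice f W = c W * \<theta> (indicator W)" ..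
      have c: "FE.transport f r = c W" if "W \<in> ?\<W>" "r \<in> W" for W r
        using bspec[OF c' that(1)] that(2) by simp
      have c2: "PN.slice f W = c W * \<theta> (indicator W)" if "W \<in> ?\<W>" for W
        using bspec[OF c' that] by simp
      have AQ: "?A \<subseteq> topspace Q" by blast
      have self: "q \<in> PQ.partial_orbit K q" if "q \<in> topspace Q" for q
        using KD(1) that by (rule PQ.partial_orbit_self)
      \<comment> \<open>The transport of \<open>f\<close> is a step function on the finitely many
        disjoint cells that meet the image of the support. Linearity of \<open>\<theta>\<close> then
        turns \<open>\<xi>1 f\<close> into the same sum as \<open>\<xi> f\<close>.\<close>
      have expand: "FE.transport f q = (\<Sum>W\<in>?\<W>. c W * indicator W q)" for q
      proof (cases "\<exists>W\<in>?\<W>. q \<in> W")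
        case True
        then obtain W0 where W0: "W0 \<in> ?\<W>" "q \<in> W0" by blast
        have "c W * indicator W q = (if W = W0 then c W0 else 0)" if "W \<in> ?\<W>" for W
        proof (cases "W = W0")
          case False
          then have "W \<inter> W0 = {}"
            using PN.disjoint_partial_orbits[OF KD(1) AQ] that W0(1) unfolding disjoint_def by blast
          then show ?thesis using False W0(2) by (auto simp: indicator_def)
        qed (simp add: W0(2))
        then have "(\<Sum>W\<in>?\<W>. c W * indicator W q) = (\<Sum>W\<in>?\<W>. if W = W0 then c W0 else 0)"
          by (rule sum.cong[OF refl])
        also have "\<dots> = c W0" using sums(2) W0(1) by (simp add: sum.delta)
        finally show ?thesis using c[OF W0] by simp
      next
        case False
        have "q \<notin> p ` {z. f z \<noteq> 0}"
        proof
          assume q: "q \<in> p ` {z. f z \<noteq> 0}"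
          then obtain z where z: "f z \<noteq> 0" "q = p z" by blast
          have "z \<in> topspace X" using test_functions_outside[OF f, of z] z(1) by blast
          then have "q \<in> topspace Q" using z(2) by simp
          then have "q \<in> ?A" using q by blast
          then show False using False self[OF \<open>q \<in> topspace Q\<close>] by blast
        qed
        then have "FE.transport f q = 0" by (rule FE.transport_outside[OF f])
        moreover have "(\<Sum>W\<in>?\<W>. c W * indicator W q) = 0"
        proof (intro sum.neutral ballI)
          fix W assume "W \<in> ?\<W>"
          then have "q \<notin> W" using False by blast
          then show "c W * indicator W q = 0" by simp
        qed
        ultimately show ?thesis by simp
      qed
      have ind: "indicator W \<in> test_functions Q" if W: "W \<in> ?\<W>" for W
      proof -
        obtain q where q: "q \<in> ?A" "W = PQ.partial_orbit K q" using W by (rule imageE)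
        have "compact_open (subtopology Q (topspace Q - {})) W"
          unfolding q(2) using q(1) sums(3) by (intro PN.compact_open_orbit[OF K(1)]) blast
        then show ?thesis
          by (intro test_functions_indicator lctd_space_Hausdorff[OF \<open>lctd_space Q\<close>]) simp
      qed
      have \<theta>': "\<theta> \<in> distributions Q" using \<theta>(1) unfolding fib.Q.invariant_distributions_iff by blast
      have "\<xi>1 f = \<theta> (\<lambda>q. \<Sum>W\<in>?\<W>. c W * indicator W q)"
        using f ext[of "FE.transport f", OF expand] by (simp add: \<xi>1_def)
      also have "\<dots> = (\<Sum>W\<in>?\<W>. \<theta> (\<lambda>q. c W * indicator W q))"
        using ind by (intro distributions_sum[OF \<theta>'] test_functions_cmult)
      also have "\<dots> = (\<Sum>W\<in>?\<W>. c W * \<theta> (indicator W))"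
        using distributions_cmult[OF \<theta>' ind] by (intro sum.cong refl)
      also have "\<dots> = (\<Sum>W\<in>?\<W>. PN.slice f W)" by (rule sum.cong[OF refl]) (simp only: c2)
      also have "\<dots> = \<xi> f" by (rule sums(1)[symmetric])
      finally show ?thesis by simp
    qed
    define \<xi>2 where "\<xi>2 = (\<lambda>f\<in>test_functions X. \<xi> f - \<xi>1 f)"
    have \<xi>1': "\<xi>1 \<in> distributions X" and \<xi>1_inv: "\<And>g f. g \<in> P \<Longrightarrow> f \<in> test_functions X \<Longrightarrow>
        \<xi>1 (function_action ?P a X g f) = \<xi>1 f"
      using easy[OF \<xi>1] unfolding PX.invariant_distributions_iff by auto
    have "\<xi>2 \<in> distributions X"
      by (rule distributionsI)
        (simp_all add: \<xi>2_def test_functions_add test_functions_cmult distributions_add[OF \<xi>']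
          distributions_add[OF \<xi>1'] distributions_cmult[OF \<xi>'] distributions_cmult[OF \<xi>1'] algebra_simps)
    then have \<xi>2: "\<xi>2 \<in> invariant_distributions ?P a X"
      unfolding PX.invariant_distributions_iff
      by (simp add: \<xi>2_def PX.function_action_in_test_functions \<xi>_inv \<xi>1_inv)
    \<comment> \<open>Finiteness of the set of orbits is converted into a finite set of
      representatives, the form in which the induction over strata can remove points.\<close>
    have "orbits ?P (topspace Q) b = (\<lambda>y. orbit ?P b y) ` topspace Q" by (auto simp: orbits_def)
    then obtain Y where Y: "Y \<subseteq> topspace Q" "finite Y" "(\<lambda>y. orbit ?P b y) ` topspace Q = (\<lambda>y. orbit ?P b y) ` Y"
      using finite_subset_image[OF iii, of "\<lambda>y. orbit ?P b y" "topspace Q"] by auto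
    have U_stable: "b g q \<notin> U" if g: "g \<in> carrier ?P" and q: "q \<in> topspace Q - U" for g q
    proof
      assume "b g q \<in> U"
      moreover have "b g q \<in> orbit ?P b q" using g unfolding orbit_def by blast
      moreover have "q \<in> orbit ?P b q" using group_action.orbit_refl[OF PQ.group_action] q by blast
      ultimately have "q \<in> U"
        using PQ.orbit_eq[of q "b g q"] PQ.orbit_eq[OF xQ, of "b g q"] q unfolding orbitP by blast
      then show False using q by blast
    qed
    have "\<xi>2 f = 0" if "f \<in> test_functions X" for f
    \<comment> \<open>The induction starts with \<open>U\<close> as the set over which the
      difference is already zero; the remaining orbits are exactly those to which (v)
      applies.\<close>
    proof (rule PF.vanishing_by_strata[OF sigmaP \<xi>2 _ _ _ Uopen U_stable _ _ that])
      show "finite (Y - U)" using Y(2) by blast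
      show "Y - U \<subseteq> topspace Q - U" using Y(1) by blast
      show "topspace Q - U \<subseteq> (\<Union>y\<in>Y - U. orbit ?P b y)"
      proof
        fix q assume q: "q \<in> topspace Q - U"
        then obtain y where y: "y \<in> Y" "orbit ?P b q = orbit ?P b y" using Y(3) by blast
        have qy: "q \<in> orbit ?P b y"
          using group_action.orbit_refl[OF PQ.group_action, of q] q y(2) by blast
        have "y \<notin> U"
        proof
          assume "y \<in> U"
          then have "orbit ?P b y = U" using PQ.orbit_eq[OF xQ, of y] unfolding orbitP by blast
          then show False using qy q by blast
        qed
        then show "q \<in> (\<Union>y\<in>Y - U. orbit ?P b y)" using y(1) qy by blast
      qed
      show "\<xi>2 h = 0" if "h \<in> test_functions X" "\<And>z. z \<in> topspace X \<Longrightarrow> p z \<notin> U \<Longrightarrow> h z = 0" for h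
        using eq[OF that] that(1) by (simp add: \<xi>2_def)
      show "equivariant_distributions (?P\<lparr>carrier := stabilizer ?P b y\<rparr>) a (fiber X p y)
          (\<lambda>h. complex_of_real (inverse (relative_modular_character ?P ?TP (stabilizer ?P b y) h)))
        = {zero_distribution (fiber X p y)}" if "y \<in> topspace Q - U" for y
        using bspec[OF v that] by simp
    qed
    then have "\<xi> = \<xi>1"
      by (intro distributions_eqI[OF \<xi>' \<xi>1']) (simp add: \<xi>2_def)
    then show ?thesis using \<xi>1 by simp
  qed
  then show ?thesis using easy by blast
qed

end
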